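(* Let $K$ be a finite simplicial complex and $X\to K=X/\Gamma$ a covering. Let $F_{\Gamma,k}(\lambda)=\dim_\Gamma E_\lambda=\tau_\Gamma(\chi_A(]0,\lambda]))$ denote the spectral density function of $A=d_k^*d_k$ on $(\ker d_k)^\perp$. If $F_{\Gamma,k}(\lambda)\le C\lambda^{\alpha/2}$ for some $\alpha>2$ (and some constant $C$), then for every $p\ge 2$ with $1/p\le 1/2-1/\alpha$: (i) there exists $C'$ such that $\|\beta\|_p\le C'\|d_k\beta\|_2$ for all $\beta\in(\ker d_k)^\perp\subset\ell^2X^k$; (ii) $\overline{d_k(\ell^2X^k)}^{\ell^2}\subset d_k(\ell^pX^k)$.
   Context: $X\to K=X/\Gamma$ is a covering with deck group the discrete group $\Gamma$ acting freely, $X$ carrying the lifted simplicial structure. $\ell^pX^k$ is the space of $\ell^p$ simplicial $k$-cochains of $X$, with its norm $\|\cdot\|_p$, and $d_k$ is the simplicial coboundary from $k$-cochains to $(k+1)$-cochains (dual to the usual boundary of simplexes), bounded $\ell^pX^k\to\ell^pX^{k+1}$ for all $p$. $d_k^*$ and orthogonal complements are taken in $\ell^2$. $E_\lambda$ is the range of the spectral projection $\Pi_\lambda=\chi_A(]0,\lambda])$, with $]0,\lambda]=(0,\lambda]$. Choosing representatives of the finitely many $\Gamma$-orbits of $k$-simplexes identifies $\ell^2X^k$ with $\ell^2(\Gamma)\otimes H$, $H$ finite dimensional; for a positive $\Gamma$-invariant operator $P$ with kernel $K_P$, the von Neumann $\Gamma$-trace is $\tau_\Gamma(P)=\tau_H(K_P(e,e))$,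 and $\dim_\Gamma$ of a closed $\Gamma$-invariant subspace is the $\Gamma$-trace of its orthogonal projection. $\overline{\,\cdot\,}^{\ell^2}$ is closure in $\ell^2X^{k+1}$. *)

theory Defs
  imports "HOL-Analysis.Analysis" "HOL-Algebra.Group_Action"
begin

definition abstract_complex :: "'v set set \<Rightarrow> bool" where
  "abstract_complex X \<longleftrightarrow>
     (\<forall>\<sigma>\<in>X. finite \<sigma> \<and> \<sigma> \<noteq> {}) \<and> (\<forall>\<sigma>\<in>X. \<forall>\<tau>. \<tau> \<subseteq> \<sigma> \<and> \<tau> \<noteq> {} \<longrightarrow> \<tau> \<in> X)"

definition simplexes :: "'v set set \<Rightarrow> nat \<Rightarrow> 'v set set" where
  "simplexes X k = {\<sigma> \<in> X. card \<sigma> = k + 1}"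

text \<open>A covering \<open>X \<rightarrow> K = X/\<Gamma>\<close> whose total space carries the lifted simplicial structure: the
  vertex map \<open>pr\<close> is surjective and maps the simplexes at each vertex \<open>x\<close> bijectively to
  the simplexes at \<open>pr x\<close> (unique lifting of simplexes; applied to edges, this also makes
  \<open>pr\<close> injective on every simplex). The group acts on the left, simplicially and freely, and the
  fibres of \<open>pr\<close> are its orbits.\<close>

locale simplicial_covering = group_action G "\<Union>X" \<phi>
  for G :: "('g, 'm) monoid_scheme" and X :: "'v set set" and \<phi> :: "'g \<Rightarrow> 'v \<Rightarrow> 'v" +
  fixes K :: "'w set set" and pr :: "'v \<Rightarrow> 'w"
  assumes complex_base: "abstract_complex K"
    and complex_total: "abstract_complex X"
    and surjective: "pr ` (\<Union>X) = \<Union>K"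
    and star_bij: "x \<in> \<Union>X \<Longrightarrow>
      bij_betw (\<lambda>\<sigma>. pr ` \<sigma>) {\<sigma> \<in> X. x \<in> \<sigma>} {\<tau> \<in> K. pr x \<in> \<tau>}"
    and simplicial_action: "\<lbrakk>g \<in> carrier G; \<sigma> \<in> X\<rbrakk> \<Longrightarrow> \<phi> g ` \<sigma> \<in> X"
    and free_action: "\<lbrakk>g \<in> carrier G; x \<in> \<Union>X; \<phi> g x = x\<rbrakk> \<Longrightarrow> g = \<one>\<^bsub>G\<^esub>"
    and fibres_are_orbits: "\<lbrakk>x \<in> \<Union>X; y \<in> \<Union>X\<rbrakk> \<Longrightarrow>
      pr x = pr y \<longleftrightarrow> (\<exists>g\<in>carrier G. y = \<phi> g x)"

text \<open>\<open>lp_space p S\<close> is \<open>\<ell>\<^sup>p(S)\<close> for \<open>p \<in> [1,\<infinity>]\<close>; its elements are extended by zero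
  outside \<open>S\<close>, so that norms and inner products can be computed over the whole type.\<close>

definition lp_space :: "ereal \<Rightarrow> 'i set \<Rightarrow> ('i \<Rightarrow> real) set" where
  "lp_space p S = {f. (\<forall>i. i \<notin> S \<longrightarrow> f i = 0) \<and>
     (if p = \<infinity> then bdd_above (range (\<lambda>i. \<bar>f i\<bar>))
      else (\<lambda>i. \<bar>f i\<bar> powr real_of_ereal p) summable_on UNIV)}"

definition lp_norm :: "ereal \<Rightarrow> ('i \<Rightarrow> real) \<Rightarrow> real" where
  "lp_norm p f =
     (if p = \<infinity> then (SUP i. \<bar>f i\<bar>)
      else (\<Sum>\<^sub>\<infinity>i. \<bar>f i\<bar> powr real_of_ereal p) powr (1 / real_of_ereal p))"

abbreviation l2_space :: "'i set \<Rightarrow> ('i \<Rightarrow> real) set" where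
  "l2_space \<equiv> lp_space 2"

definition l2_inner :: "('i \<Rightarrow> real) \<Rightarrow> ('i \<Rightarrow> real) \<Rightarrow> real" where
  "l2_inner f g = (\<Sum>\<^sub>\<infinity>i. f i * g i)"

definition l2_closure :: "'i set \<Rightarrow> ('i \<Rightarrow> real) set \<Rightarrow> ('i \<Rightarrow> real) set" where
  "l2_closure S M = {y \<in> l2_space S. \<forall>\<epsilon>>0. \<exists>m\<in>M. lp_norm 2 (\<lambda>i. y i - m i) < \<epsilon>}"

definition l2_orthogonal :: "'i set \<Rightarrow> ('i \<Rightarrow> real) set \<Rightarrow> ('i \<Rightarrow> real) set" where
  "l2_orthogonal S M = {x \<in> l2_space S. \<forall>y\<in>M. l2_inner x y = 0}"

definition l2_adjoint ::
  "'i set \<Rightarrow> (('i \<Rightarrow> real) \<Rightarrow> ('j \<Rightarrow> real)) \<Rightarrow> ('j \<Rightarrow> real) \<Rightarrow> ('i \<Rightarrow> real)" where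
  "l2_adjoint S D y =
     (THE z. z \<in> l2_space S \<and> (\<forall>x\<in>l2_space S. l2_inner (D x) y = l2_inner x z))"

definition l2_projection_onto :: "'i set \<Rightarrow> ('i \<Rightarrow> real) set \<Rightarrow> ('i \<Rightarrow> real) \<Rightarrow> ('i \<Rightarrow> real)" where
  "l2_projection_onto S L x = (THE y. y \<in> L \<and> (\<lambda>i. x i - y i) \<in> l2_orthogonal S L)"

definition is_l2_projection :: "'i set \<Rightarrow> (('i \<Rightarrow> real) \<Rightarrow> ('i \<Rightarrow> real)) \<Rightarrow> bool" where
  "is_l2_projection S P \<longleftrightarrow>
     P \<in> l2_space S \<rightarrow> l2_space S \<and>
     (\<forall>x\<in>l2_space S. \<forall>y\<in>l2_space S. \<forall>a b.
        P (\<lambda>i. a * x i + b * y i) = (\<lambda>i. a * P x i + b * P y i)) \<and>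
     (\<forall>x\<in>l2_space S. P (P x) = P x) \<and>
     (\<forall>x\<in>l2_space S. \<forall>y\<in>l2_space S. l2_inner (P x) y = l2_inner x (P y))"

text \<open>\<open>E\<close> is the projection-valued Borel measure with \<open>A = \<integral> t dE(t)\<close>. For self-adjoint bounded \<open>A\<close>
  the last identity, which is about the scalar measures \<open>\<Omega> \<mapsto> \<langle>E(\<Omega>)x, x\<rangle>\<close>, determines \<open>A\<close>
  by polarization, and by the spectral theorem \<open>E\<close> exists and is unique on \<open>\<ell>\<^sup>2(S)\<close>.\<close>

definition is_spectral_measure ::
  "'i set \<Rightarrow> (('i \<Rightarrow> real) \<Rightarrow> ('i \<Rightarrow> real)) \<Rightarrow> (real set \<Rightarrow> ('i \<Rightarrow> real) \<Rightarrow> ('i \<Rightarrow> real)) \<Rightarrow> bool" where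
  "is_spectral_measure S A E \<longleftrightarrow>
     (\<forall>\<Omega>\<in>sets borel. is_l2_projection S (E \<Omega>)) \<and>
     (\<forall>x\<in>l2_space S. E UNIV x = x) \<and>
     (\<forall>\<Omega>\<in>sets borel. \<forall>\<Omega>'\<in>sets borel. \<forall>x\<in>l2_space S. E (\<Omega> \<inter> \<Omega>') x = E \<Omega> (E \<Omega>' x)) \<and>
     (\<forall>\<Omega> :: nat \<Rightarrow> real set. range \<Omega> \<subseteq> sets borel \<and> disjoint_family \<Omega> \<longrightarrow>
        (\<forall>x\<in>l2_space S. \<forall>y\<in>l2_space S.
           (\<lambda>n. l2_inner (E (\<Omega> n) x) y) sums l2_inner (E (\<Union>n. \<Omega> n) x) y)) \<and>
     (\<forall>x\<in>l2_space S.
        let \<mu> = measure_of UNIV (sets borel) (\<lambda>\<Omega>. ennreal (l2_inner (E \<Omega> x) x))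
        in integrable \<mu> (\<lambda>t. t) \<and> (LINT t|\<mu>. t) = l2_inner (A x) x)"

definition spectral_projection ::
  "'i set \<Rightarrow> (('i \<Rightarrow> real) \<Rightarrow> ('i \<Rightarrow> real)) \<Rightarrow> real set \<Rightarrow> ('i \<Rightarrow> real) \<Rightarrow> ('i \<Rightarrow> real)" where
  "spectral_projection S A = (SOME E. is_spectral_measure S A E)"

text \<open>\<open>idx\<close> enumerates the vertices of \<open>K\<close>. Each simplex of \<open>X\<close> is oriented by the
  order in which \<open>idx \<circ> pr\<close> lists its vertices. Relative to these orientations, which the group
  preserves, a \<open>k\<close>-cochain is a real function on the \<open>k\<close>-simplexes, and the sign below is
  the coefficient of the face \<open>\<tau> - {v}\<close> in the boundary of \<open>\<tau>\<close>.\<close>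

definition coboundary ::
  "'v set set \<Rightarrow> ('v \<Rightarrow> 'w) \<Rightarrow> ('w \<Rightarrow> nat) \<Rightarrow> nat \<Rightarrow> ('v set \<Rightarrow> real) \<Rightarrow> ('v set \<Rightarrow> real)" where
  "coboundary X pr idx k c \<tau> =
     (if \<tau> \<in> simplexes X (k + 1)
      then \<Sum>v\<in>\<tau>. (- 1) ^ card {w \<in> \<tau>. idx (pr w) < idx (pr v)} * c (\<tau> - {v})
      else 0)"

definition cocycles ::
  "'v set set \<Rightarrow> ('v \<Rightarrow> 'w) \<Rightarrow> ('w \<Rightarrow> nat) \<Rightarrow> nat \<Rightarrow> ('v set \<Rightarrow> real) set" where
  "cocycles X pr idx k =
     {\<beta> \<in> l2_space (simplexes X k). coboundary X pr idx k \<beta> = (\<lambda>\<tau>. 0)}"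

definition up_laplacian ::
  "'v set set \<Rightarrow> ('v \<Rightarrow> 'w) \<Rightarrow> ('w \<Rightarrow> nat) \<Rightarrow> nat \<Rightarrow> ('v set \<Rightarrow> real) \<Rightarrow> ('v set \<Rightarrow> real)" where
  "up_laplacian X pr idx k \<beta> =
     l2_adjoint (simplexes X k) (coboundary X pr idx k)
       (coboundary X pr idx k \<beta>)"

definition simplex_orbits ::
  "('g, 'm) monoid_scheme \<Rightarrow> ('g \<Rightarrow> 'v \<Rightarrow> 'v) \<Rightarrow> 'v set set \<Rightarrow> 'v set set set" where
  "simplex_orbits G \<phi> S = (\<lambda>\<sigma>. {\<phi> g ` \<sigma> | g. g \<in> carrier G}) ` S"

text \<open>With representatives \<open>\<sigma>\<^sub>1, \<dots>, \<sigma>\<^sub>m\<close> of the orbits of simplexes, \<open>\<delta>\<^bsub>g\<sigma>\<^sub>i\<^esub>\<close> corresponds to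
  \<open>\<delta>\<^sub>g \<otimes> e\<^sub>i\<close> in \<open>\<ell>\<^sup>2(\<Gamma>) \<otimes> \<real>\<^sup>m\<close>. Thus the diagonal entries of the block \<open>K\<^sub>P(e,e)\<close> are
  \<open>\<langle>P \<delta>\<^bsub>\<sigma>\<^sub>i\<^esub>, \<delta>\<^bsub>\<sigma>\<^sub>i\<^esub>\<rangle>\<close>.\<close>

definition vN_trace ::
  "('g, 'm) monoid_scheme \<Rightarrow> ('g \<Rightarrow> 'v \<Rightarrow> 'v) \<Rightarrow> 'v set set
     \<Rightarrow> (('v set \<Rightarrow> real) \<Rightarrow> ('v set \<Rightarrow> real)) \<Rightarrow> real" where
  "vN_trace G \<phi> S P =
     (\<Sum>B\<in>simplex_orbits G \<phi> S.
        let \<delta> = indicator {SOME \<sigma>. \<sigma> \<in> B} in l2_inner (P \<delta>) \<delta>)"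

definition vN_dim ::
  "('g, 'm) monoid_scheme \<Rightarrow> ('g \<Rightarrow> 'v \<Rightarrow> 'v) \<Rightarrow> 'v set set \<Rightarrow> ('v set \<Rightarrow> real) set \<Rightarrow> real" where
  "vN_dim G \<phi> S L = vN_trace G \<phi> S (l2_projection_onto S L)"

text \<open>The spectral projection is formed on all of \<open>\<ell>\<^sup>2X\<^sup>k\<close>; since \<open>0 \<notin> ]0,\<lambda>]\<close>, its range
  lies in \<open>(ker d\<^sub>k)\<^sup>\<bottom>\<close> and it agrees there with that of the restricted operator.\<close>

definition spectral_density ::
  "('g, 'm) monoid_scheme \<Rightarrow> ('g \<Rightarrow> 'v \<Rightarrow> 'v) \<Rightarrow> 'v set set \<Rightarrow> ('v \<Rightarrow> 'w) \<Rightarrow> ('w \<Rightarrow> nat)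
     \<Rightarrow> nat \<Rightarrow> real \<Rightarrow> real" where
  "spectral_density G \<phi> X pr idx k s =
     vN_dim G \<phi> (simplexes X k)
       (spectral_projection (simplexes X k) (up_laplacian X pr idx k) {0<..s}
          ` l2_space (simplexes X k))"

end

(* Choosing E to be the spectral measure of A = d* d, the hypothesis bounds every diagonal entry
   <E(]0,s]) delta, delta> by C s^(alpha/2): the diagonal is constant along orbits, because the range of
   E(]-oo,s]) is {x. |A^n x| <= s^n |x| for all n}, a set that the group preserves. By Cauchy-Schwarz on
   the dyadic shells ]s/2^(n+1), s/2^n] the part of a cochain beta of energy below s is then pointwise at
   most c s^gamma |d beta| with gamma = (alpha - 2)/4. Where |beta| = 2 c s^gamma |d beta|, at least half of
   beta comes from energies above s, and summing over the level sets gives the l^q norm of beta, with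
   q = 2 + 1/gamma and 1/q = 1/2 - 1/alpha, against the integral of t d<E_t beta, beta> = |d beta|^2.
   Larger exponents follow since l^q norms decrease in q, and (ii) since the bound makes the minimal
   preimages of a Cauchy sequence in the image of d converge pointwise to an l^q cochain.

   The spectral measure itself is obtained from the Hausdorff moments <A^n x, x>, which have a representing
   measure by Helly's theorem; E(Omega) x is the limit of p_n(A) x for polynomials p_n tending to the
   indicator of Omega in L^2 of that measure. *)
theory Submission
  imports Defs "HOL-Probability.Helly_Selection" "HOL-Computational_Algebra.Polynomial"
    "HOL-Real_Asymp.Real_Asymp"
begin

section \<open>Moments of a positive contraction\<close>

text \<open>\<open>spectral_projection\<close> is an indefinite choice, and
  \<open>is_spectral_measure\<close> ties it to A only through the numbers <A x, x>. Existence must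
  therefore be proved before anything is known about the chosen E, and even the commutation of E
  with A has to be derived for an arbitrary E with these properties. The exponents come from one
  product. On a shell of energy about r the part of \<beta> has norm at most sqrt (2 / r) |d
  \<beta>|, and the part of a unit vector at most a constant times r^(\<alpha>/4). Together this is
  r^(\<alpha>/4 - 1/2), so \<gamma> = (\<alpha> - 2)/4, and \<alpha> > 2 makes the sum over the
  shells near 0 converge. Then 2 + 1/\<gamma> = 2 \<alpha> / (\<alpha> - 2). In (ii) the limit
  cochain is not known to be in l^2, so the boundedness of d does not apply to it. Instead d is
  evaluated coordinatewise, each value being a finite sum over faces.\<close>

definition poly_op :: "('a::real_vector \<Rightarrow> 'a) \<Rightarrow> real poly \<Rightarrow> 'a \<Rightarrow> 'a" where
  "poly_op A p x = (\<Sum>i\<le>degree p. coeff p i *\<^sub>R (A ^^ i) x)"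

lemma poly_op_altdef:
  assumes "degree p \<le> n"
  shows "poly_op A p x = (\<Sum>i\<le>n. coeff p i *\<^sub>R (A ^^ i) x)"
  unfolding poly_op_def
  by (rule sum.mono_neutral_left) (use assms in \<open>auto simp: coeff_eq_0\<close>)

lemma poly_op_add: "poly_op A (p + q) x = poly_op A p x + poly_op A q x"
proof -
  define n where "n = max (degree p) (degree q)"
  have "degree p \<le> n" "degree q \<le> n" "degree (p + q) \<le> n"
    unfolding n_def by (auto intro: degree_add_le)
  then show ?thesis
    by (simp add: poly_op_altdef[of _ n] scaleR_add_left sum.distrib)
qed

lemma poly_op_smult: "poly_op A (smult c p) x = c *\<^sub>R poly_op A p x"
  by (simp add: poly_op_altdef[of _ "degree p"] scaleR_sum_right degree_smult_le)

lemma poly_op_0 [simp]: "poly_op A 0 x = 0"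
  by (simp add: poly_op_def)

lemma poly_op_1 [simp]: "poly_op A 1 x = x"
  by (simp add: poly_op_def)

lemma poly_op_diff: "poly_op A (p - q) x = poly_op A p x - poly_op A q x"
  using poly_op_add[of A p "smult (-1) q" x] poly_op_smult[of A "-1" q x] by simp

lemma poly_op_sum: "poly_op A (\<Sum>i\<in>I. f i) x = (\<Sum>i\<in>I. poly_op A (f i) x)"
  by (induction I rule: infinite_finite_induct) (auto simp: poly_op_add)

lemma poly_op_monom: "poly_op A (monom c n) x = c *\<^sub>R (A ^^ n) x"
proof -
  have "poly_op A (monom c n) x = (\<Sum>i\<le>n. (if i = n then c *\<^sub>R (A ^^ n) x else 0))"
    unfolding poly_op_altdef[OF degree_monom_le] by (intro sum.cong) auto
  then show ?thesis by simp
qed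

lemma poly_op_const [simp]: "poly_op A [:c:] x = c *\<^sub>R x"
  by (simp add: poly_op_def)

lemma poly_op_of_nat_mult: "poly_op A (of_nat c * p) x = real c *\<^sub>R poly_op A p x"
  by (simp add: of_nat_poly poly_op_smult)

lemma linear_funpow: "linear A \<Longrightarrow> linear (A ^^ n)" for A :: "'a::real_vector \<Rightarrow> 'a"
  by (induction n) (auto intro: linear_compose linearI)

lemma linear_poly_op:
  assumes "linear A"
  shows "linear (poly_op A p)"
  unfolding poly_op_def[abs_def]
  by (intro linear_compose_sum ballI linear_compose_scale_right linear_funpow assms)

lemma poly_op_pCons:
  assumes "linear A"
  shows "poly_op A (pCons a p) x = a *\<^sub>R x + A (poly_op A p x)"
proof -
  have "poly_op A (pCons a p) x = (\<Sum>i\<le>Suc (degree p). coeff (pCons a p) i *\<^sub>R (A ^^ i) x)"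
    by (rule poly_op_altdef) (simp add: degree_pCons_le)
  also have "\<dots> = a *\<^sub>R x + (\<Sum>i\<le>degree p. coeff p i *\<^sub>R (A ^^ Suc i) x)"
    by (subst sum.atMost_Suc_shift) simp
  also have "(\<Sum>i\<le>degree p. coeff p i *\<^sub>R (A ^^ Suc i) x) = A (poly_op A p x)"
    by (simp add: poly_op_def linear_sum[OF assms] linear_scale[OF assms] o_def)
  finally show ?thesis .
qed

lemma poly_op_mult:
  assumes "linear A"
  shows "poly_op A (p * q) x = poly_op A p (poly_op A q x)"
proof (induction p)
  case 0
  then show ?case by simp
next
  case (pCons a p)
  then show ?case
    by (simp add: poly_op_add poly_op_smult poly_op_pCons[OF assms])
qed

lemma poly_op_in_subspace:
  assumes "subspace W" "\<And>x. x \<in> W \<Longrightarrow> A x \<in> W" "x \<in> W"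
  shows "poly_op A p x \<in> W"
proof -
  have "(A ^^ i) x \<in> W" for i
    by (induction i) (use assms in auto)
  then show ?thesis
    unfolding poly_op_def by (intro subspace_sum subspace_scale assms(1)) auto
qed

lemma inner_funpow_commute:
  fixes A :: "'a::real_inner \<Rightarrow> 'a"
  assumes "\<And>x y. inner (A x) y = inner x (A y)"
  shows "inner ((A ^^ n) x) y = inner x ((A ^^ n) y)"
proof (induction n arbitrary: x y)
  case (Suc n)
  have "inner ((A ^^ Suc n) x) y = inner ((A ^^ n) x) (A y)" by (simp add: assms)
  also have "\<dots> = inner x ((A ^^ n) (A y))" by (rule Suc)
  finally show ?case by (simp add: funpow_swap1)
qed auto

lemma inner_poly_op_commute:
  fixes A :: "'a::real_inner \<Rightarrow> 'a"
  assumes "\<And>x y. inner (A x) y = inner x (A y)"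
  shows "inner (poly_op A p x) y = inner x (poly_op A p y)"
  by (simp add: poly_op_def inner_sum_left inner_sum_right inner_funpow_commute[OF assms])

lemma poly_op_square:
  fixes A :: "'a::real_inner \<Rightarrow> 'a"
  assumes "linear A" "\<And>x y. inner (A x) y = inner x (A y)"
  shows "inner (poly_op A (p * q) x) y = inner (poly_op A q x) (poly_op A p y)"
  by (simp add: poly_op_mult[OF assms(1)] inner_poly_op_commute[OF assms(2)])

text \<open>Splitting off an even power reduces to the four cases \<open>1\<close>, \<open>X\<close>, \<open>1 - X\<close> and
  \<open>X (1 - X) = (1 - X) X\<^sup>2 + X (1 - X)\<^sup>2\<close>.\<close>

lemma inner_bernstein_op_nonneg:
  fixes A :: "'a::real_inner \<Rightarrow> 'a"
  assumes lin: "linear A" and sym: "\<And>x y. inner (A x) y = inner x (A y)"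
    and pos: "\<And>x. 0 \<le> inner (A x) x" and le: "\<And>x. inner (A x) x \<le> inner x x"
  shows "0 \<le> inner (poly_op A ([:0, 1:] ^ k * [:1, -1:] ^ l) x) x"
proof -
  define X Y :: "real poly" where "X = [:0, 1:]" and "Y = [:1, -1:]"
  have X: "poly_op A X z = A z" for z
    by (simp add: X_def poly_op_pCons[OF lin])
  have Y: "poly_op A Y z = z - A z" for z
    using poly_op_pCons[OF lin, of 1 "[:-1:]" z] by (simp add: Y_def linear_neg[OF lin])
  have XY: "X * Y = Y * (X * X) + X * (Y * Y)"
    by (simp add: X_def Y_def)
  define q where "q = X ^ (k div 2) * Y ^ (l div 2)"
  define y where "y = poly_op A q x"
  have *: "inner (poly_op A (q * (r * q)) x) x = inner (poly_op A r y) y" for r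
    by (subst poly_op_square[OF lin sym]) (simp add: poly_op_mult[OF lin] y_def)
  have pX: "0 \<le> inner (poly_op A X z) z" and pY: "0 \<le> inner (poly_op A Y z) z" for z
    using pos[of z] le[of z] by (simp_all add: X Y inner_diff_left)
  have sq: "inner (poly_op A (r * (s * s)) z) z = inner (poly_op A r (poly_op A s z)) (poly_op A s z)" for r s z
    using poly_op_square[OF lin sym, of s "r * s" z z]
    by (simp add: poly_op_mult[OF lin] mult.assoc mult.left_commute)
  have pXY: "0 \<le> inner (poly_op A (X * Y) z) z" for z
    unfolding XY poly_op_add inner_add_left sq using pX pY by (simp add: add_nonneg_nonneg)
  have "X ^ k * Y ^ l = q * (X ^ (k mod 2) * Y ^ (l mod 2) * q)"
  proof -
    have "X ^ k = X ^ (k div 2) * X ^ (k div 2) * X ^ (k mod 2)" "Y ^ l = Y ^ (l div 2) * Y ^ (l div 2) * Y ^ (l mod 2)"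
      by (metis div_mult_mod_eq mult_2_right power_add)+
    then show ?thesis unfolding q_def by (simp only: ac_simps)
  qed
  then have "inner (poly_op A (X ^ k * Y ^ l) x) x = inner (poly_op A (X ^ (k mod 2) * Y ^ (l mod 2)) y) y"
    using * by simp
  also have "0 \<le> \<dots>"
  proof -
    have "k mod 2 = 0 \<or> k mod 2 = 1" "l mod 2 = 0 \<or> l mod 2 = 1" by auto
    then show ?thesis using pX pY pXY by (elim disjE) simp_all
  qed
  finally show ?thesis by (simp add: X_def Y_def)
qed

text \<open>Since (n choose k) (k choose m) = (n choose m) (n-m choose k-m), the sum collapses to
  the binomial expansion of (X + (1 - X))^(n-m) = 1. The ring is general because X will be the
  polynomial variable; the identity then gives the factorial moments of the Bernstein weights
  exactly.\<close>

lemma bernstein_moment_identity: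
  fixes X :: "'a::comm_ring_1"
  assumes "m \<le> n"
  shows "(\<Sum>k\<le>n. of_nat ((n choose k) * (k choose m)) * (X ^ k * (1 - X) ^ (n - k))) = of_nat (n choose m) * X ^ m"
proof -
  have "(\<Sum>k\<le>n. of_nat ((n choose k) * (k choose m)) * (X ^ k * (1 - X) ^ (n - k)))
      = (\<Sum>k\<in>{m..n}. of_nat ((n choose k) * (k choose m)) * (X ^ k * (1 - X) ^ (n - k)))"
    by (rule sum.mono_neutral_right) (auto simp: binomial_eq_0)
  also have "\<dots> = (\<Sum>k\<in>{m..n}. of_nat (n choose m) * (of_nat ((n - m) choose (k - m)) * (X ^ k * (1 - X) ^ (n - k))))"
    by (rule sum.cong) (auto simp: choose_mult mult.assoc)
  also have "\<dots> = (\<Sum>j\<le>n - m. of_nat (n choose m) * (of_nat ((n - m) choose j) * (X ^ (m + j) * (1 - X) ^ (n - m - j))))"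
    by (rule sum.reindex_bij_witness[of _ "\<lambda>j. m + j" "\<lambda>k. k - m"]) (use assms in auto)
  also have "\<dots> = of_nat (n choose m) * X ^ m * (\<Sum>j\<le>n - m. of_nat ((n - m) choose j) * X ^ j * (1 - X) ^ (n - m - j))"
    by (simp add: sum_distrib_left power_add mult_ac)
  also have "(\<Sum>j\<le>n - m. of_nat ((n - m) choose j) * X ^ j * (1 - X) ^ (n - m - j)) = (X + (1 - X)) ^ (n - m)"
    by (rule binomial_ring[symmetric])
  finally show ?thesis by simp
qed

text \<open>The exact moments of the Bernstein weights involve this quotient in place of (k/n)^m.
  Both are products of m factors, those of the quotient being (k-i)/(n-i), and for factors of size
  at most 1 the products differ by at most the sum of the differences of the factors.\<close>

lemma binomial_quotient_close:
  assumes "k \<le> n" "2 * m < n"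
  shows "\<bar>(real k / real n) ^ m - real (k choose m) / real (n choose m)\<bar> \<le> real m * (real m / (real n - real m))"
proof -
  have quot: "real (k choose m) / real (n choose m) = (\<Prod>i<m. (real k - real i) / (real n - real i))"
    by (simp add: binomial_gbinomial gbinomial_prod_rev prod_dividef atLeast0LessThan)
  have "\<bar>(\<Prod>i<m. real k / real n) - (\<Prod>i<m. (real k - real i) / (real n - real i))\<bar>
      \<le> (\<Sum>i<m. \<bar>real k / real n - (real k - real i) / (real n - real i)\<bar>)"
  proof -
    \<comment> \<open>For k < i the numerator is negative; 2 m < n still bounds its size by n -
      i.\<close>
    have "\<bar>real k - real i\<bar> \<le> real n - real i" if "i < m" for i
      using that assms by linarith
    then have "\<bar>(real k - real i) / (real n - real i)\<bar> \<le> 1" if "i < m" for i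
      using that assms by (simp add: abs_divide)
    then show ?thesis
      using norm_prod_diff[of "{..<m}" "\<lambda>_. real k / real n" "\<lambda>i. (real k - real i) / (real n - real i)"] assms
      by simp
  qed
  also have "\<dots> \<le> (\<Sum>i<m. real m / (real n - real m))"
  proof (rule sum_mono)
    fix i assume "i \<in> {..<m}"
    then have i: "i < m" "real i < real n" using assms by auto
    have eq: "real k / real n - (real k - real i) / (real n - real i)
        = (real i / (real n - real i)) * ((real n - real k) / real n)"
      using i assms by (simp add: field_simps)
    have "\<bar>real k / real n - (real k - real i) / (real n - real i)\<bar> = (real i / (real n - real i)) * ((real n - real k) / real n)"
      unfolding eq using i assms by simp
    also have "\<dots> \<le> (real i / (real n - real i)) * 1"
      using i assms by (intro mult_left_mono) auto
    also have "\<dots> \<le> real m / (real n - real m)"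
      using i assms by (auto intro!: frac_le)
    finally show "\<bar>real k / real n - (real k - real i) / (real n - real i)\<bar> \<le> real m / (real n - real m)" .
  qed
  finally show ?thesis by (simp add: quot)
qed

definition moment_measure :: "('a::real_inner \<Rightarrow> 'a) \<Rightarrow> real \<Rightarrow> 'a \<Rightarrow> real measure \<Rightarrow> bool" where
  "moment_measure A M x \<mu> \<longleftrightarrow> finite_measure \<mu> \<and> sets \<mu> = sets borel \<and> (AE t in \<mu>. t \<in> {0..M}) \<and>
     (\<forall>m. (\<integral>t. t ^ m \<partial>\<mu>) = inner ((A ^^ m) x) x)"

text \<open>Hausdorff's solution of the moment problem: the mass \<open>w n k\<close>, the value at
  A of a Bernstein basis polynomial, is put on the point k/n, and a weak limit is taken. The norm of
  x is 1 so that these are probability measures, to which Helly selection applies.\<close>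

lemma moment_measure_unit:
  fixes A :: "'a::real_inner \<Rightarrow> 'a"
  assumes lin: "linear A" and sym: "\<And>x y. inner (A x) y = inner x (A y)"
    and pos: "\<And>x. 0 \<le> inner (A x) x" and le: "\<And>x. inner (A x) x \<le> inner x x"
    and x: "norm x = 1"
  shows "\<exists>\<mu>. moment_measure A 1 x \<mu>"
proof -
  define w where "w n k = real (n choose k) * inner (poly_op A ([:0, 1:] ^ k * [:1, -1:] ^ (n - k)) x) x" for n k
  have w0: "0 \<le> w n k" for n k
    unfolding w_def using inner_bernstein_op_nonneg[OF assms(1-4)] by simp
  have mom: "(\<Sum>k\<le>n. w n k * real (k choose m)) = real (n choose m) * inner ((A ^^ m) x) x" if "m \<le> n" for m n
  proof -
    have Y: "[:1, -1:] = 1 - [:0, 1::real:]" by (simp add: one_pCons)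
    have mon: "[:0, 1::real:] ^ m = monom 1 m" by (simp add: monom_altdef)
    have "inner (poly_op A (\<Sum>k\<le>n. of_nat ((n choose k) * (k choose m)) * ([:0, 1:] ^ k * [:1, -1:] ^ (n - k))) x) x
       = inner (poly_op A (of_nat (n choose m) * [:0, 1:] ^ m) x) x"
      unfolding Y using bernstein_moment_identity[OF that, of "[:0, 1::real:]"] by simp
    then show ?thesis
      by (simp only: poly_op_sum inner_sum_left poly_op_of_nat_mult mon poly_op_monom)
        (simp add: w_def mult_ac)
  qed
  have sumw: "(\<Sum>k\<le>n. w n k) = 1" for n
    using mom[of 0 n] x by (simp add: dot_square_norm)
  define \<nu> where "\<nu> n = distr (point_measure {..n} (\<lambda>k. ennreal (w n k))) borel (\<lambda>k. real k / real n)" for n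
  have int: "(\<integral>t. f t \<partial>\<nu> n) = (\<Sum>k\<le>n. w n k * f (real k / real n))" if [measurable]: "f \<in> borel_measurable borel" for f :: "real \<Rightarrow> real" and n
    unfolding \<nu>_def
    by (subst integral_distr) (simp_all add: lebesgue_integral_point_measure_finite w0)
  have ae: "AE t in \<nu> n. t \<in> {0..1}" for n
    unfolding \<nu>_def by (subst AE_distr_iff) (auto simp: AE_point_measure divide_le_eq)
  have rd: "real_distribution (\<nu> n)" for n
  proof -
    have "emeasure (\<nu> n) UNIV = emeasure (point_measure {..n} (\<lambda>k. ennreal (w n k))) {..n}"
      unfolding \<nu>_def by (subst emeasure_distr) (auto simp: space_point_measure)
    also have "\<dots> = 1"
      using sumw[of n] w0 by (subst emeasure_point_measure_finite) (auto simp: sum_ennreal)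
    finally have "emeasure (\<nu> n) (space (\<nu> n)) = 1" by (simp add: \<nu>_def)
    then interpret prob_space "\<nu> n" by (rule prob_spaceI)
    show ?thesis by standard (simp add: \<nu>_def)
  qed
  have "tight \<nu>"
    unfolding tight_def
  proof (intro conjI allI impI rd)
    fix e :: real assume e: "e > 0"
    have "measure (\<nu> n) {-1<..2} = 1" for n
    proof -
      interpret real_distribution "\<nu> n" by (rule rd)
      show ?thesis
        by (rule prob_eq_1[THEN iffD2]) (use ae[of n] in \<open>auto elim: eventually_mono\<close>)
    qed
    then show "\<exists>a b. a < b \<and> (\<forall>n. 1 - e < measure (\<nu> n) {a<..b})"
      using e by (intro exI[of _ "-1"] exI[of _ 2]) auto
  qed
  from tight_imp_convergent_subsubsequence[OF this strict_mono_id]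
  obtain r \<mu> where r: "strict_mono r" and \<mu>: "real_distribution \<mu>" and wc: "weak_conv_m (\<nu> \<circ> r) \<mu>"
    by auto
  interpret \<mu>: real_distribution \<mu> by (rule \<mu>)
  have conv: "(\<lambda>n. \<integral>t. f t \<partial>\<nu> (r n)) \<longlonglongrightarrow> (\<integral>t. f t \<partial>\<mu>)"
    if "\<And>x. isCont f x" "\<And>x. norm (f x) \<le> B" for f :: "real \<Rightarrow> real" and B
    using weak_conv_imp_integral_bdd_continuous_conv[of "\<nu> \<circ> r" \<mu> f B] rd \<mu> wc that by (auto simp: o_def)
  \<comment> \<open>Weak convergence tests bounded continuous functions only, so t^m is composed
    with the clamp to [0,1], which changes nothing on the support.\<close>
  define cl where "cl t = max 0 (min 1 (t::real))" for t
  have cl_cont: "isCont cl t" for t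
    unfolding cl_def by (intro continuous_intros)
  have cl_bd: "0 \<le> cl t" "cl t \<le> 1" for t
    by (auto simp: cl_def)
  have cl_id: "cl t = t" if "t \<in> {0..1}" for t
    using that by (auto simp: cl_def)
  have clk: "cl (real k / real n) = real k / real n" if "k \<le> n" for k n
    using that by (intro cl_id) (auto simp: divide_le_eq)
  have clm [measurable]: "cl \<in> borel_measurable borel"
    unfolding cl_def by measurable
  have supp: "AE t in \<mu>. t \<in> {0..1}"
  proof -
    \<comment> \<open>Continuous, bounded and zero exactly on [0,1]: its integrals vanish, hence so
      does the limit, and this forces the support.\<close>
    define f where "f t = min 1 \<bar>t - cl t\<bar>" for t
    have [measurable]: "f \<in> borel_measurable borel" unfolding f_def by measurable
    have fb: "0 \<le> f t" "f t \<le> 1" for t by (auto simp: f_def)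
    have "(\<lambda>n. \<integral>t. f t \<partial>\<nu> (r n)) \<longlonglongrightarrow> (\<integral>t. f t \<partial>\<mu>)"
      by (rule conv[of _ 1]) (use fb in \<open>auto simp: f_def intro!: continuous_intros cl_cont\<close>)
    moreover have "(\<integral>t. f t \<partial>\<nu> n) = 0" for n
      by (subst int) (auto simp: f_def clk intro!: sum.neutral)
    ultimately have "(\<integral>t. f t \<partial>\<mu>) = 0"
      by (simp add: LIMSEQ_const_iff)
    moreover have "integrable \<mu> f"
      by (rule \<mu>.integrable_const_bound[of _ 1]) (use fb in auto)
    ultimately have "AE t in \<mu>. f t = 0"
      using integral_nonneg_eq_0_iff_AE[of \<mu> f] fb by auto
    then show ?thesis
      by (rule AE_mp) (auto simp: f_def cl_def)
  qed
  have "(\<integral>t. t ^ m \<partial>\<mu>) = inner ((A ^^ m) x) x" for m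
  proof -
    have "(\<lambda>n. \<integral>t. cl t ^ m \<partial>\<nu> (r n)) \<longlonglongrightarrow> (\<integral>t. cl t ^ m \<partial>\<mu>)"
      by (rule conv[of _ 1])
        (use cl_bd in \<open>auto intro!: continuous_intros cl_cont simp: power_le_one\<close>)
    moreover have "(\<lambda>n. \<integral>t. cl t ^ m \<partial>\<nu> n) \<longlonglongrightarrow> inner ((A ^^ m) x) x"
    proof (rule LIM_zero_cancel, rule Lim_null_comparison)
      show "\<forall>\<^sub>F n in sequentially. norm ((\<integral>t. cl t ^ m \<partial>\<nu> n) - inner ((A ^^ m) x) x) \<le> real m * (real m / (real n - real m))"
      proof (rule eventually_sequentiallyI[of "2 * m + 1"])
        fix n assume n: "2 * m + 1 \<le> n"
        \<comment> \<open>\<open>mom\<close> writes the target as an average with the same weights,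
          so the two averages can be compared term by term.\<close>
        have eq: "inner ((A ^^ m) x) x = (\<Sum>k\<le>n. w n k * (real (k choose m) / real (n choose m)))"
          using mom[of m n] n by (simp add: sum_divide_distrib[symmetric])
        have "(\<integral>t. cl t ^ m \<partial>\<nu> n) = (\<Sum>k\<le>n. w n k * (real k / real n) ^ m)"
          by (subst int) (auto intro!: sum.cong simp: clk)
        then have "\<bar>(\<integral>t. cl t ^ m \<partial>\<nu> n) - inner ((A ^^ m) x) x\<bar>
          = \<bar>\<Sum>k\<le>n. w n k * ((real k / real n) ^ m - real (k choose m) / real (n choose m))\<bar>"
          unfolding eq by (simp add: right_diff_distrib sum_subtractf)
        also have "\<dots> \<le> (\<Sum>k\<le>n. w n k * (real m * (real m / (real n - real m))))"
        proof (rule order_trans[OF sum_abs sum_mono])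
          fix k assume "k \<in> {..n}"
          then have "w n k * \<bar>(real k / real n) ^ m - real (k choose m) / real (n choose m)\<bar>
            \<le> w n k * (real m * (real m / (real n - real m)))"
            by (intro mult_left_mono binomial_quotient_close) (use n w0 in auto)
          then show "\<bar>w n k * ((real k / real n) ^ m - real (k choose m) / real (n choose m))\<bar>
            \<le> w n k * (real m * (real m / (real n - real m)))"
            by (simp only: abs_mult abs_of_nonneg[OF w0])
        qed
        also have "\<dots> = real m * (real m / (real n - real m))"
          by (simp only: sum_distrib_right[symmetric] sumw)
        finally show "norm ((\<integral>t. cl t ^ m \<partial>\<nu> n) - inner ((A ^^ m) x) x) \<le> real m * (real m / (real n - real m))" by simp
      qed
      show "(\<lambda>n. real m * (real m / (real n - real m))) \<longlonglongrightarrow> 0"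
        by real_asymp
    qed
    then have "(\<lambda>n. \<integral>t. cl t ^ m \<partial>\<nu> (r n)) \<longlonglongrightarrow> inner ((A ^^ m) x) x"
      using r LIMSEQ_subseq_LIMSEQ by (fastforce simp: o_def)
    ultimately have "(\<integral>t. cl t ^ m \<partial>\<mu>) = inner ((A ^^ m) x) x"
      using LIMSEQ_unique by blast
    moreover have "(\<integral>t. cl t ^ m \<partial>\<mu>) = (\<integral>t. t ^ m \<partial>\<mu>)"
    proof (rule integral_cong_AE)
      show "AE t in \<mu>. cl t ^ m = t ^ m"
        using supp by eventually_elim (simp only: cl_id)
    qed auto
    ultimately show ?thesis by simp
  qed
  then have "moment_measure A 1 x \<mu>"
    using supp \<mu>.finite_measure_axioms unfolding moment_measure_def by simp
  then show ?thesis ..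
qed

section \<open>Density of polynomials\<close>

text \<open>Reduction to a contraction and a unit vector: divide A by M and x by its norm, then undo
  both by pushing forward along t -> M t and scaling the mass by the squared norm.\<close>

lemma moment_measure_exists:
  fixes A :: "'a::real_inner \<Rightarrow> 'a"
  assumes lin: "linear A" and sym: "\<And>x y. inner (A x) y = inner x (A y)"
    and pos: "\<And>x. 0 \<le> inner (A x) x" and le: "\<And>x. inner (A x) x \<le> M * inner x x" and M: "M > 0"
  shows "\<exists>\<mu>. moment_measure A M x \<mu>"
proof (cases "x = 0")
  case True
  have "(A ^^ m) 0 = 0" for m
    using linear_0[OF linear_funpow[OF lin]] .
  then have "moment_measure A M x (null_measure borel)"
    using True by (auto simp: moment_measure_def intro!: finite_measureI AE_I[of _ _ UNIV])
  then show ?thesis ..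
next
  case False
  define B where "B y = (1 / M) *\<^sub>R A y" for y
  define u where "u = (1 / norm x) *\<^sub>R x"
  have linB: "linear B"
    unfolding B_def by (intro linear_compose_scale_right lin)
  have "\<exists>\<nu>. moment_measure B 1 u \<nu>"
  proof (rule moment_measure_unit[OF linB])
    show "norm u = 1" using False by (simp add: u_def)
  qed (use M pos le in \<open>simp_all add: B_def sym divide_le_eq mult.commute\<close>)
  then obtain \<nu> where \<nu>: "moment_measure B 1 u \<nu>" ..
  then interpret \<nu>: finite_measure \<nu> by (simp add: moment_measure_def)
  have sets_\<nu> [measurable_cong, simp]: "sets \<nu> = sets borel"
    and ae: "AE t in \<nu>. t \<in> {0..1}" and mom: "\<And>m. (\<integral>t. t ^ m \<partial>\<nu>) = inner ((B ^^ m) u) u"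
    using \<nu> by (auto simp: moment_measure_def)
  define \<mu> where "\<mu> = distr (density \<nu> (\<lambda>_. ennreal ((norm x)\<^sup>2))) borel (\<lambda>t. M * t)"
  have Bm: "(B ^^ m) y = (1 / M) ^ m *\<^sub>R (A ^^ m) y" for m y
    by (induction m) (simp_all add: B_def linear_scale[OF lin])
  have "(\<integral>t. t ^ m \<partial>\<mu>) = inner ((A ^^ m) x) x" for m
  proof -
    have "(\<integral>t. t ^ m \<partial>\<mu>) = (\<integral>t. (norm x)\<^sup>2 * (M ^ m * t ^ m) \<partial>\<nu>)"
      unfolding \<mu>_def by (simp add: integral_distr integral_density power_mult_distrib)
    also have "\<dots> = (norm x)\<^sup>2 * (M ^ m * inner ((B ^^ m) u) u)"
      by (simp add: mom)
    also have "\<dots> = inner ((A ^^ m) x) x"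
      using M False by (simp add: Bm u_def linear_scale[OF linear_funpow[OF lin]] field_simps power2_eq_square)
    finally show ?thesis .
  qed
  moreover have "finite_measure \<mu>"
    unfolding \<mu>_def
    by (intro finite_measure.finite_measure_distr finite_measureI)
       (auto simp: emeasure_density_const[OF sets.top] ennreal_mult_eq_top_iff \<nu>.emeasure_eq_measure)
  moreover have "AE t in \<mu>. t \<in> {0..M}"
    unfolding \<mu>_def using M ae by (subst AE_distr_iff) (auto simp: AE_density elim!: eventually_mono)
  ultimately have "moment_measure A M x \<mu>"
    unfolding moment_measure_def by (simp add: \<mu>_def)
  then show ?thesis ..
qed

section \<open>Polynomial approximation in L^2 of finitely many measures\<close>

lemma integrable_poly_on_interval:
  fixes \<mu> :: "real measure"
  assumes "finite_measure \<mu>" and [measurable_cong]: "sets \<mu> = sets borel" and ae: "AE t in \<mu>. t \<in> {0..M}"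
  shows "integrable \<mu> (poly p)"
proof -
  interpret finite_measure \<mu> by fact
  have "compact (poly p ` {0..M})"
    by (intro compact_continuous_image continuous_intros) auto
  then obtain B where B: "\<And>t. t \<in> {0..M} \<Longrightarrow> \<bar>poly p t\<bar> \<le> B"
    by (meson bounded_real compact_imp_bounded imageI)
  have [measurable]: "poly p \<in> borel_measurable borel"
    by (auto intro!: borel_measurable_continuous_onI continuous_intros)
  show ?thesis
  proof (rule integrable_const_bound[of _ B])
    show "AE t in \<mu>. norm (poly p t) \<le> B"
      using ae by eventually_elim (simp add: B)
  qed measurable
qed

text \<open>A family rather than one measure, because polarization needs a single sequence of polynomials
  that works for \<open>x\<close>, \<open>y\<close>, \<open>x + y\<close> and \<open>x - y\<close> at once.\<close>

locale interval_measures =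
  fixes F :: "real measure set" and M :: real
  assumes finite_F: "finite F"
    and finite_measure_F: "\<mu> \<in> F \<Longrightarrow> finite_measure \<mu>"
    and sets_F: "\<mu> \<in> F \<Longrightarrow> sets \<mu> = sets borel"
    and AE_F: "\<mu> \<in> F \<Longrightarrow> AE t in \<mu>. t \<in> {0..M}"
begin

text \<open>The bound on f makes the squared errors integrable, so that a small integral is genuine
  and not the default value 0 of a non-integrable function.\<close>

definition poly_dense_at :: "(real \<Rightarrow> real) \<Rightarrow> bool" where
  "poly_dense_at f \<longleftrightarrow> f \<in> borel_measurable borel \<and> (\<exists>B. \<forall>t. \<bar>f t\<bar> \<le> B) \<and>
     (\<forall>e>0. \<exists>p. \<forall>\<mu>\<in>F. (\<integral>t. (poly p t - f t)\<^sup>2 \<partial>\<mu>) < e)"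

lemma integrable_bounded:
  assumes "\<mu> \<in> F" "f \<in> borel_measurable borel" "\<And>t. \<bar>f t :: real\<bar> \<le> B"
  shows "integrable \<mu> f"
proof -
  interpret finite_measure \<mu> using finite_measure_F assms(1) .
  show ?thesis
    by (rule integrable_const_bound[of _ B])
      (use assms in \<open>auto simp: measurable_cong_sets[OF sets_F refl]\<close>)
qed

lemma integrable_poly_diff_square:
  assumes "\<mu> \<in> F" "f \<in> borel_measurable borel" "\<And>t. \<bar>f t :: real\<bar> \<le> B"
  shows "integrable \<mu> (\<lambda>t. (poly p t - f t)\<^sup>2)"
proof -
  interpret finite_measure \<mu> using finite_measure_F assms(1) .
  have s [measurable_cong]: "sets \<mu> = sets borel" using sets_F assms(1) .
  have "compact (poly p ` {0..M})"
    by (intro compact_continuous_image continuous_intros) auto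
  then obtain C where C: "\<And>t. t \<in> {0..M} \<Longrightarrow> \<bar>poly p t\<bar> \<le> C"
    by (meson bounded_real compact_imp_bounded imageI)
  have [measurable]: "poly p \<in> borel_measurable borel" "f \<in> borel_measurable borel"
    by (auto intro!: borel_measurable_continuous_onI continuous_intros assms)
  show ?thesis
  proof (rule integrable_const_bound[of _ "(C + B)\<^sup>2"])
    show "AE t in \<mu>. norm ((poly p t - f t)\<^sup>2) \<le> (C + B)\<^sup>2"
      using AE_F[OF assms(1)]
    proof eventually_elim
      case (elim t)
      have "\<bar>poly p t - f t\<bar> \<le> C + B"
        using C[OF elim] assms(3)[of t] by linarith
      then have "\<bar>poly p t - f t\<bar>\<^sup>2 \<le> (C + B)\<^sup>2"
        by (intro power_mono) auto
      then show ?case by simp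
    qed
  qed measurable
qed

text \<open>Dominated convergence gives an index that is good for each \<mu>, finiteness of F one
  that is good for all, and the polynomial for that \<open>u k\<close> then serves f. The two errors
  are combined by (a + b)^2 <= 2 a^2 + 2 b^2, whence e / 4.\<close>

lemma poly_dense_at_limit:
  assumes f: "f \<in> borel_measurable borel" and u: "\<And>k. poly_dense_at (u k)"
    and B: "\<And>k t. \<bar>u k t\<bar> \<le> B" and lim: "\<And>t. (\<lambda>k. u k t) \<longlonglongrightarrow> f t"
  shows "poly_dense_at f"
  unfolding poly_dense_at_def
proof (intro conjI allI impI exI[of _ B] f)
  fix t show "\<bar>f t\<bar> \<le> B"
    using tendsto_upperbound[OF tendsto_rabs[OF lim[of t]]] B by auto
next
  have um: "u k \<in> borel_measurable borel" for k using u by (auto simp: poly_dense_at_def)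
  have fB: "\<bar>f t\<bar> \<le> B" for t
    using tendsto_upperbound[OF tendsto_rabs[OF lim[of t]]] B by auto
  fix e :: real assume e: "e > 0"
  then have e4: "e / 4 > 0" by simp
  have "(\<lambda>k. \<integral>t. (u k t - f t)\<^sup>2 \<partial>\<mu>) \<longlonglongrightarrow> 0" if "\<mu> \<in> F" for \<mu>
  proof -
    interpret finite_measure \<mu> using finite_measure_F that .
    have s [measurable_cong]: "sets \<mu> = sets borel" using sets_F that .
    note [measurable] = f um
    have "(\<lambda>k. \<integral>t. (u k t - f t)\<^sup>2 \<partial>\<mu>) \<longlonglongrightarrow> (\<integral>t. 0 \<partial>\<mu>)"
    proof (rule integral_dominated_convergence[where w = "\<lambda>_. (2 * B)\<^sup>2"])
      show "AE t in \<mu>. (\<lambda>k. (u k t - f t)\<^sup>2) \<longlonglongrightarrow> 0"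
        using tendsto_power[OF LIM_zero[OF lim], of _ 2] by simp
      show "AE t in \<mu>. norm ((u k t - f t)\<^sup>2) \<le> (2 * B)\<^sup>2" for k
      proof (rule AE_I2)
        fix t
        have "\<bar>u k t - f t\<bar> \<le> 2 * B" using B[of k t] fB[of t] by linarith
        then have "\<bar>u k t - f t\<bar>\<^sup>2 \<le> (2 * B)\<^sup>2" by (intro power_mono) auto
        then show "norm ((u k t - f t)\<^sup>2) \<le> (2 * B)\<^sup>2" by simp
      qed
    qed auto
    then show ?thesis by simp
  qed
  then have "\<forall>\<mu>\<in>F. \<forall>\<^sub>F k in sequentially. (\<integral>t. (u k t - f t)\<^sup>2 \<partial>\<mu>) < e / 4"
    using e by (auto intro!: order_tendstoD(2))
  then have "\<forall>\<^sub>F k in sequentially. \<forall>\<mu>\<in>F. (\<integral>t. (u k t - f t)\<^sup>2 \<partial>\<mu>) < e / 4"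
    by (rule eventually_ball_finite[OF finite_F])
  then obtain k where k: "\<And>\<mu>. \<mu> \<in> F \<Longrightarrow> (\<integral>t. (u k t - f t)\<^sup>2 \<partial>\<mu>) < e / 4"
    using eventually_happens by force
  have "\<exists>p. \<forall>\<mu>\<in>F. (\<integral>t. (poly p t - u k t)\<^sup>2 \<partial>\<mu>) < e / 4"
    using u[of k] e4 unfolding poly_dense_at_def by blast
  then obtain p where p: "\<And>\<mu>. \<mu> \<in> F \<Longrightarrow> (\<integral>t. (poly p t - u k t)\<^sup>2 \<partial>\<mu>) < e / 4"
    by blast
  have "(\<integral>t. (poly p t - f t)\<^sup>2 \<partial>\<mu>) < e" if "\<mu> \<in> F" for \<mu>
  proof -
    have [measurable_cong]: "sets \<mu> = sets borel" using sets_F that .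
    have i1: "integrable \<mu> (\<lambda>t. (poly p t - u k t)\<^sup>2)"
      by (rule integrable_poly_diff_square[OF that um B])
    have i2: "integrable \<mu> (\<lambda>t. (u k t - f t)\<^sup>2)"
    proof (rule integrable_bounded[OF that, of _ "(2 * B)\<^sup>2"])
      fix t
      have "\<bar>u k t - f t\<bar> \<le> 2 * B" using B[of k t] fB[of t] by linarith
      then have "\<bar>u k t - f t\<bar>\<^sup>2 \<le> (2 * B)\<^sup>2" by (intro power_mono) auto
      then show "\<bar>(u k t - f t)\<^sup>2\<bar> \<le> (2 * B)\<^sup>2" by simp
    qed (use f um in auto)
    have "(\<integral>t. (poly p t - f t)\<^sup>2 \<partial>\<mu>) \<le> (\<integral>t. 2 * (poly p t - u k t)\<^sup>2 + 2 * (u k t - f t)\<^sup>2 \<partial>\<mu>)"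
    proof (rule integral_mono)
      fix t
      show "(poly p t - f t)\<^sup>2 \<le> 2 * (poly p t - u k t)\<^sup>2 + 2 * (u k t - f t)\<^sup>2"
        using sum_squares_bound[of "poly p t - u k t" "u k t - f t"]
        by (simp add: power2_eq_square algebra_simps)
    qed (use i1 i2 integrable_poly_diff_square[OF that f fB] in auto)
    also have "\<dots> = 2 * (\<integral>t. (poly p t - u k t)\<^sup>2 \<partial>\<mu>) + 2 * (\<integral>t. (u k t - f t)\<^sup>2 \<partial>\<mu>)"
      using i1 i2 by simp
    also have "\<dots> < e" using k[OF that] p[OF that] by simp
    finally show ?thesis .
  qed
  then show "\<exists>p. \<forall>\<mu>\<in>F. (\<integral>t. (poly p t - f t)\<^sup>2 \<partial>\<mu>) < e" by blast
qed

text \<open>The case c = -1 is for complements and c = 1 for disjoint unions; in both, c^2 = 1 drops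
  out of the error estimate.\<close>

lemma poly_dense_at_add_scaled:
  assumes f: "poly_dense_at f" and g: "poly_dense_at g" and c: "\<bar>c\<bar> = 1"
  shows "poly_dense_at (\<lambda>t. f t + c * g t)"
proof -
  from f g obtain B C where B: "\<And>t. \<bar>f t\<bar> \<le> B" and C: "\<And>t. \<bar>g t\<bar> \<le> C"
    and fm [measurable]: "f \<in> borel_measurable borel" and gm [measurable]: "g \<in> borel_measurable borel"
    unfolding poly_dense_at_def by blast
  have bd: "\<bar>f t + c * g t\<bar> \<le> B + C" for t
    using B[of t] C[of t] abs_triangle_ineq[of "f t" "c * g t"] c by (simp add: abs_mult)
  have cc: "c\<^sup>2 = 1" using c by (simp add: power2_eq_1_iff abs_if split: if_splits)
  show ?thesis
    unfolding poly_dense_at_def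
  proof (intro conjI allI impI)
    show "\<exists>B. \<forall>t. \<bar>f t + c * g t\<bar> \<le> B" using bd by blast
    fix e :: real assume e: "e > 0"
    then have e4: "e / 4 > 0" by simp
    have "\<exists>p. \<forall>\<mu>\<in>F. (\<integral>t. (poly p t - f t)\<^sup>2 \<partial>\<mu>) < e / 4"
         "\<exists>p. \<forall>\<mu>\<in>F. (\<integral>t. (poly p t - g t)\<^sup>2 \<partial>\<mu>) < e / 4"
      using f g e4 unfolding poly_dense_at_def by blast+
    then obtain p q where p: "\<And>\<mu>. \<mu> \<in> F \<Longrightarrow> (\<integral>t. (poly p t - f t)\<^sup>2 \<partial>\<mu>) < e / 4"
      and q: "\<And>\<mu>. \<mu> \<in> F \<Longrightarrow> (\<integral>t. (poly q t - g t)\<^sup>2 \<partial>\<mu>) < e / 4"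
      by blast
    have "(\<integral>t. (poly (p + smult c q) t - (f t + c * g t))\<^sup>2 \<partial>\<mu>) < e" if "\<mu> \<in> F" for \<mu>
    proof -
      have [measurable_cong]: "sets \<mu> = sets borel" using sets_F that .
      have i1: "integrable \<mu> (\<lambda>t. (poly p t - f t)\<^sup>2)"
        by (rule integrable_poly_diff_square[OF that fm B])
      have i2: "integrable \<mu> (\<lambda>t. (poly q t - g t)\<^sup>2)"
        by (rule integrable_poly_diff_square[OF that gm C])
      have i3: "integrable \<mu> (\<lambda>t. (poly (p + smult c q) t - (f t + c * g t))\<^sup>2)"
        by (rule integrable_poly_diff_square[OF that _ bd]) measurable
      have "(\<integral>t. (poly (p + smult c q) t - (f t + c * g t))\<^sup>2 \<partial>\<mu>)
          \<le> (\<integral>t. 2 * (poly p t - f t)\<^sup>2 + 2 * (poly q t - g t)\<^sup>2 \<partial>\<mu>)"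
      proof (rule integral_mono)
        fix t
        have "(poly (p + smult c q) t - (f t + c * g t))\<^sup>2 = ((poly p t - f t) + c * (poly q t - g t))\<^sup>2"
          by (simp add: algebra_simps)
        also have "\<dots> \<le> 2 * (poly p t - f t)\<^sup>2 + 2 * (c * (poly q t - g t))\<^sup>2"
          using sum_squares_bound[of "poly p t - f t" "c * (poly q t - g t)"]
          by (simp add: power2_eq_square algebra_simps)
        finally show "(poly (p + smult c q) t - (f t + c * g t))\<^sup>2 \<le> 2 * (poly p t - f t)\<^sup>2 + 2 * (poly q t - g t)\<^sup>2"
          by (simp add: power_mult_distrib cc)
      qed (use i1 i2 i3 in auto)
      also have "\<dots> = 2 * (\<integral>t. (poly p t - f t)\<^sup>2 \<partial>\<mu>) + 2 * (\<integral>t. (poly q t - g t)\<^sup>2 \<partial>\<mu>)"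
        using i1 i2 by simp
      also have "\<dots> < e" using q[OF that] p[OF that] by simp
      finally show ?thesis .
    qed
    then show "\<exists>p. \<forall>\<mu>\<in>F. (\<integral>t. (poly p t - (f t + c * g t))\<^sup>2 \<partial>\<mu>) < e" by blast
  qed measurable
qed

lemma poly_dense_at_continuous:
  assumes f: "continuous_on UNIV f" and B: "\<And>t. \<bar>f t\<bar> \<le> B"
  shows "poly_dense_at f"
  unfolding poly_dense_at_def
proof (intro conjI allI impI exI[of _ B] B)
  show fm: "f \<in> borel_measurable borel" using f by (rule borel_measurable_continuous_onI)
  fix e :: real assume e: "e > 0"
  \<comment> \<open>The added 1 makes K positive and strictly larger than every total mass, also
    when F is empty.\<close>
  define K where "K = (\<Sum>\<mu>\<in>F. measure \<mu> UNIV) + 1"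
  have K: "K > 0" "\<And>\<mu>. \<mu> \<in> F \<Longrightarrow> measure \<mu> UNIV < K"
  proof -
    have "measure \<mu> UNIV \<le> (\<Sum>\<mu>\<in>F. measure \<mu> UNIV)" if "\<mu> \<in> F" for \<mu>
      using finite_F that by (intro member_le_sum) auto
    then show "\<And>\<mu>. \<mu> \<in> F \<Longrightarrow> measure \<mu> UNIV < K" by (force simp: K_def)
    show "K > 0" by (simp add: K_def add_nonneg_pos sum_nonneg)
  qed
  define d where "d = sqrt (e / K)"
  have d: "d > 0" "d\<^sup>2 = e / K" using e K by (auto simp: d_def)
  obtain g where g: "real_polynomial_function g" "\<And>t. t \<in> {0..M} \<Longrightarrow> \<bar>f t - g t\<bar> < d"
    using Stone_Weierstrass_real_polynomial_function[of "{0..M}" f d] d f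
    by (metis compact_Icc continuous_on_subset subset_UNIV)
  then obtain a n where "g = (\<lambda>x. \<Sum>i\<le>n. a i * x ^ i)"
    using real_polynomial_function_iff_sum by blast
  then have gp: "poly (\<Sum>i\<le>n. monom (a i) i) t = g t" for t
    by (simp add: poly_sum poly_monom)
  have "(\<integral>t. (poly (\<Sum>i\<le>n. monom (a i) i) t - f t)\<^sup>2 \<partial>\<mu>) < e" if "\<mu> \<in> F" for \<mu>
  proof -
    interpret finite_measure \<mu> using finite_measure_F that .
    have sp: "space \<mu> = UNIV" using sets_F[OF that] by (metis sets_eq_imp_space_eq space_borel)
    have "(\<integral>t. (poly (\<Sum>i\<le>n. monom (a i) i) t - f t)\<^sup>2 \<partial>\<mu>) \<le> (\<integral>t. d\<^sup>2 \<partial>\<mu>)"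
    proof (rule integral_mono_AE)
      show "AE t in \<mu>. (poly (\<Sum>i\<le>n. monom (a i) i) t - f t)\<^sup>2 \<le> d\<^sup>2"
        using AE_F[OF that]
      proof eventually_elim
        case (elim t)
        have "\<bar>g t - f t\<bar> \<le> d" using g(2)[OF elim] by linarith
        then have "\<bar>g t - f t\<bar>\<^sup>2 \<le> d\<^sup>2" by (intro power_mono) auto
        then show ?case by (simp add: gp)
      qed
    qed (use integrable_poly_diff_square[OF that fm B] in auto)
    also have "\<dots> = d\<^sup>2 * measure \<mu> UNIV" by (simp add: sp)
    also have "\<dots> < d\<^sup>2 * K" using K(2)[OF that] d(1) by simp
    also have "\<dots> = e" using d K by simp
    finally show ?thesis .
  qed
  then show "\<exists>p. \<forall>\<mu>\<in>F. (\<integral>t. (poly p t - f t)\<^sup>2 \<partial>\<mu>) < e" by blast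
qed

text \<open>Ramps descending from 1 to 0 with slope -k to the right of a are continuous and tend
  pointwise to the indicator.\<close>

lemma poly_dense_at_atMost: "poly_dense_at (indicator {..a})"
proof (rule poly_dense_at_limit[where u = "\<lambda>k t. max 0 (min 1 (1 - real k * (t - a)))" and B = 1])
  show "poly_dense_at (\<lambda>t. max 0 (min 1 (1 - real k * (t - a))))" for k
    by (rule poly_dense_at_continuous[where B = 1]) (auto intro!: continuous_intros)
  show "(\<lambda>k. max 0 (min 1 (1 - real k * (t - a)))) \<longlonglongrightarrow> indicator {..a} t" for t
  proof (cases "t \<le> a")
    case True
    then have "max 0 (min 1 (1 - real k * (t - a))) = 1" for k
      by (simp add: mult_nonneg_nonpos)
    then show ?thesis using True by simp
  next
    case False
    then have "\<forall>\<^sub>F k in sequentially. 1 / (t - a) \<le> real k"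
      by (intro eventually_sequentiallyI[of "nat \<lceil>1 / (t - a)\<rceil>"]) linarith
    then have "\<forall>\<^sub>F k in sequentially. max 0 (min 1 (1 - real k * (t - a))) = 0"
      by (rule eventually_mono) (use False in \<open>auto simp: field_simps\<close>)
    then show ?thesis using False by (simp add: tendsto_eventually)
  qed
qed auto

text \<open>Dynkin induction from the half-lines: complements are differences from the constant 1,
  and a countable disjoint union is the bounded limit of its finite partial sums.\<close>

lemma poly_dense_at_borel:
  assumes "\<Omega> \<in> sets borel"
  shows "poly_dense_at (indicator \<Omega>)"
proof -
  have one: "poly_dense_at (\<lambda>_. c)" for c
    by (rule poly_dense_at_continuous[where B = "\<bar>c\<bar>"]) auto
  have borel: "sets borel = sigma_sets UNIV (range (\<lambda>a::real. {..a}))"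
    by (subst borel_eq_atMost) (simp add: sets_measure_of)
  have "Int_stable (range (\<lambda>a::real. {..a}))" "range (\<lambda>a::real. {..a}) \<subseteq> Pow UNIV"
    "\<Omega> \<in> sigma_sets UNIV (range (\<lambda>a::real. {..a}))"
    using assms by (auto simp: Int_stable_def borel)
  then show ?thesis
  proof (induction rule: sigma_sets_induct_disjoint)
    case (basic a)
    then show ?case using poly_dense_at_atMost by auto
  next
    case empty
    show ?case using one[of 0] by (simp add: indicator_def[abs_def])
  next
    case (compl \<Omega>)
    have "indicator (UNIV - \<Omega>) = (\<lambda>t. 1 + (-1) * indicator \<Omega> t :: real)"
      by (auto simp: indicator_def)
    then show ?case using poly_dense_at_add_scaled[OF one[of 1] compl(2), of "-1"] by simp
  next
    case (union \<Omega>)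
    have disj: "i \<noteq> j \<Longrightarrow> \<Omega> i \<inter> \<Omega> j = {}" for i j using union(1) by (auto simp: disjoint_family_on_def)
    have part: "indicator (\<Union>i<n. \<Omega> i) t = (\<Sum>i<n. indicator (\<Omega> i) t :: real)" for n t
      using indicator_UN_disjoint[of "{..<n}" \<Omega> t] union(1)
      by (auto simp: disjoint_family_on_def)
    show ?case
    proof (rule poly_dense_at_limit[where u = "\<lambda>n. indicator (\<Union>i<n. \<Omega> i)" and B = 1])
      show "poly_dense_at (indicator (\<Union>i<n. \<Omega> i))" for n
        unfolding part[abs_def]
      proof (induction n)
        case 0
        show ?case using one[of 0] by simp
      next
        case (Suc n)
        show ?case using poly_dense_at_add_scaled[OF Suc union(3)[of n], of 1] by simp
      qed
      show "(\<lambda>n. indicator (\<Union>i<n. \<Omega> i) t) \<longlonglongrightarrow> indicator (\<Union>i. \<Omega> i) t" for t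
        by (rule LIMSEQ_indicator_UN)
      show "indicator (\<Union>i. \<Omega> i) \<in> borel_measurable borel"
        using union(2)[folded borel] by (intro borel_measurable_indicator sets.countable_UN) auto
    qed auto
  qed
qed

lemma poly_sequence_exists:
  assumes "\<Omega> \<in> sets borel"
  shows "\<exists>p. \<forall>\<mu>\<in>F. (\<lambda>n. \<integral>t. (poly (p n) t - indicator \<Omega> t)\<^sup>2 \<partial>\<mu>) \<longlonglongrightarrow> 0"
proof -
  have "\<exists>p. \<forall>\<mu>\<in>F. (\<integral>t. (poly p t - indicator \<Omega> t)\<^sup>2 \<partial>\<mu>) < 1 / real (Suc n)" for n
    using poly_dense_at_borel[OF assms] by (auto simp: poly_dense_at_def)
  then obtain p where p: "\<And>n \<mu>. \<mu> \<in> F \<Longrightarrow> (\<integral>t. (poly (p n) t - indicator \<Omega> t)\<^sup>2 \<partial>\<mu>) < 1 / real (Suc n)"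
    by metis
  have "(\<lambda>n. \<integral>t. (poly (p n) t - indicator \<Omega> t)\<^sup>2 \<partial>\<mu>) \<longlonglongrightarrow> 0" if "\<mu> \<in> F" for \<mu>
    by (rule real_tendsto_sandwich[OF _ _ tendsto_const LIMSEQ_inverse_real_of_nat])
       (use p[OF that] in \<open>auto simp: inverse_eq_divide intro!: always_eventually less_imp_le\<close>)
  then show ?thesis by blast
qed

end

section \<open>The spectral theorem for positive bounded operators\<close>

text \<open>\<open>E UNIV\<close> is not required to be the identity: a spectral measure on \<open>\<ell>\<^sup>2(S)\<close> will be extended by
  zero to all square summable functions, and \<open>E UNIV\<close> is then the restriction to \<open>S\<close>.\<close>

definition resolution :: "('a::real_inner \<Rightarrow> 'a) \<Rightarrow> (real set \<Rightarrow> 'a \<Rightarrow> 'a) \<Rightarrow> bool" where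
  "resolution A E \<longleftrightarrow>
     (\<forall>\<Omega>\<in>sets borel. linear (E \<Omega>) \<and> (\<forall>x y. inner (E \<Omega> x) y = inner x (E \<Omega> y))) \<and>
     (\<forall>\<Omega>\<in>sets borel. \<forall>\<Omega>'\<in>sets borel. \<forall>x. E (\<Omega> \<inter> \<Omega>') x = E \<Omega> (E \<Omega>' x)) \<and>
     (\<forall>\<Omega> :: nat \<Rightarrow> real set. range \<Omega> \<subseteq> sets borel \<and> disjoint_family \<Omega> \<longrightarrow>
        (\<forall>x y. (\<lambda>n. inner (E (\<Omega> n) x) y) sums inner (E (\<Union>n. \<Omega> n) x) y)) \<and>
     (\<forall>x. let \<mu> = measure_of UNIV (sets borel) (\<lambda>\<Omega>. ennreal (inner (E \<Omega> x) x))
          in integrable \<mu> (\<lambda>t. t) \<and> (LINT t|\<mu>. t) = inner (A x) x)"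

text \<open>Bounding \<open>\<bar>u\<bar>\<close> by \<open>\<epsilon> + u\<^sup>2 / \<epsilon>\<close> replaces the Cauchy-Schwarz inequality for integrals.\<close>

lemma integral_tendsto_0_of_square:
  fixes u :: "nat \<Rightarrow> 'b \<Rightarrow> real"
  assumes "finite_measure \<mu>" and u: "\<And>n. integrable \<mu> (\<lambda>t. (u n t)\<^sup>2)" and um: "\<And>n. u n \<in> borel_measurable \<mu>"
    and lim: "(\<lambda>n. \<integral>t. (u n t)\<^sup>2 \<partial>\<mu>) \<longlonglongrightarrow> 0"
    and g: "g \<in> borel_measurable \<mu>" "\<And>t. \<bar>g t\<bar> \<le> 1"
  shows "integrable \<mu> (\<lambda>t. u n t * g t)" and "(\<lambda>n. \<integral>t. u n t * g t \<partial>\<mu>) \<longlonglongrightarrow> 0"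
proof -
  interpret finite_measure \<mu> by fact
  have bd: "\<bar>u n t * g t\<bar> \<le> e + (u n t)\<^sup>2 / e" if "e > 0" for n t e
  proof -
    have "\<bar>u n t * g t\<bar> \<le> \<bar>u n t\<bar>"
      using g(2)[of t] by (simp add: abs_mult mult_left_le)
    also have "\<dots> \<le> e + (u n t)\<^sup>2 / e"
    proof -
      have "0 \<le> e * \<bar>u n t\<bar>" using that by simp
      then have "e * \<bar>u n t\<bar> \<le> e * e + u n t * u n t"
        using sum_squares_bound[of e "\<bar>u n t\<bar>"] by (simp add: power2_eq_square)
      then show ?thesis using that by (simp add: field_simps power2_eq_square)
    qed
    finally show ?thesis .
  qed
  show int: "integrable \<mu> (\<lambda>t. u n t * g t)" for n
    by (rule Bochner_Integration.integrable_bound[of _ "\<lambda>t. 1 + (u n t)\<^sup>2 / 1"])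
       (use u um g bd[of 1 n] in \<open>auto intro!: AE_I2\<close>)
  show "(\<lambda>n. \<integral>t. u n t * g t \<partial>\<mu>) \<longlonglongrightarrow> 0"
  proof (rule LIMSEQ_I)
    fix r :: real assume r: "r > 0"
    define m where "m = measure \<mu> (space \<mu>)"
    \<comment> \<open>The denominator has m + 1 and not m, since the total mass may be 0.\<close>
    define e where "e = r / (2 * (m + 1))"
    have m: "m \<ge> 0" by (simp add: m_def)
    have e: "e > 0" using r m by (simp add: e_def)
    have em: "e * m < r / 2" using r m by (simp add: e_def field_simps)
    have "\<forall>\<^sub>F n in sequentially. (\<integral>t. (u n t)\<^sup>2 \<partial>\<mu>) < e * (r / 2)"
      using lim e r by (intro order_tendstoD(2)) auto
    then obtain N where N: "\<And>n. n \<ge> N \<Longrightarrow> (\<integral>t. (u n t)\<^sup>2 \<partial>\<mu>) < e * (r / 2)"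
      by (auto simp: eventually_sequentially)
    show "\<exists>N. \<forall>n\<ge>N. norm ((\<integral>t. u n t * g t \<partial>\<mu>) - 0) < r"
    proof (intro exI allI impI)
      fix n assume n: "n \<ge> N"
      have "norm (\<integral>t. u n t * g t \<partial>\<mu>) \<le> (\<integral>t. norm (u n t * g t) \<partial>\<mu>)" by (rule integral_norm_bound)
      also have "\<dots> \<le> (\<integral>t. e + (u n t)\<^sup>2 / e \<partial>\<mu>)"
        by (rule integral_mono) (use int u bd[OF e] in auto)
      also have "\<dots> = e * m + (\<integral>t. (u n t)\<^sup>2 \<partial>\<mu>) / e" using u by (simp add: m_def)
      also have "\<dots> < r / 2 + (e * (r / 2)) / e"
        using em N[OF n] e by (intro add_strict_mono divide_strict_right_mono) auto
      also have "\<dots> = r" using e by simp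
      finally show "norm ((\<integral>t. u n t * g t \<partial>\<mu>) - 0) < r" by simp
    qed
  qed
qed

text \<open>With u = a - f and v = b - g one has a b = u v + u g + v f + f g. The first term is at
  most u^2 + v^2, and the next two are covered by the preceding lemma. With indicators for f and g,
  this sends <p(A) x, q(A) x> to the measure of an intersection.\<close>

lemma integral_mult_tendsto:
  fixes a b :: "nat \<Rightarrow> 'b \<Rightarrow> real"
  assumes \<mu>: "finite_measure \<mu>"
    and a: "\<And>n. a n \<in> borel_measurable \<mu>" and b: "\<And>n. b n \<in> borel_measurable \<mu>"
    and f: "f \<in> borel_measurable \<mu>" and g: "g \<in> borel_measurable \<mu>"
    and f1: "\<And>t. \<bar>f t\<bar> \<le> 1" and g1: "\<And>t. \<bar>g t\<bar> \<le> 1"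
    and ia: "\<And>n. integrable \<mu> (\<lambda>t. (a n t - f t)\<^sup>2)" and ib: "\<And>n. integrable \<mu> (\<lambda>t. (b n t - g t)\<^sup>2)"
    and la: "(\<lambda>n. \<integral>t. (a n t - f t)\<^sup>2 \<partial>\<mu>) \<longlonglongrightarrow> 0" and lb: "(\<lambda>n. \<integral>t. (b n t - g t)\<^sup>2 \<partial>\<mu>) \<longlonglongrightarrow> 0"
  shows "(\<lambda>n. \<integral>t. a n t * b n t \<partial>\<mu>) \<longlonglongrightarrow> (\<integral>t. f t * g t \<partial>\<mu>)"
proof -
  interpret finite_measure \<mu> by (rule \<mu>)
  define u where "u n t = a n t - f t" for n t
  define v where "v n t = b n t - g t" for n t
  have [measurable]: "u n \<in> borel_measurable \<mu>" "v n \<in> borel_measurable \<mu>" for n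
    unfolding u_def[abs_def] v_def[abs_def] using a b f g by measurable
  note iu = ia[folded u_def] and iv = ib[folded v_def] and lu = la[folded u_def] and lv = lb[folded v_def]
  have uv_le: "\<bar>u n t * v n t\<bar> \<le> (u n t)\<^sup>2 + (v n t)\<^sup>2" for n t
  proof -
    have "2 * \<bar>u n t\<bar> * \<bar>v n t\<bar> \<le> \<bar>u n t\<bar>\<^sup>2 + \<bar>v n t\<bar>\<^sup>2" by (rule sum_squares_bound)
    moreover have "0 \<le> \<bar>u n t\<bar> * \<bar>v n t\<bar>" by simp
    ultimately show ?thesis
      unfolding abs_mult power2_abs by linarith
  qed
  have iuv: "integrable \<mu> (\<lambda>t. u n t * v n t)" for n
  proof (rule Bochner_Integration.integrable_bound[OF Bochner_Integration.integrable_add[OF iu[of n] iv[of n]]])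
    show "AE t in \<mu>. norm (u n t * v n t) \<le> norm ((u n t)\<^sup>2 + (v n t)\<^sup>2)"
    proof (rule AE_I2)
      fix t
      show "norm (u n t * v n t) \<le> norm ((u n t)\<^sup>2 + (v n t)\<^sup>2)"
        unfolding real_norm_def using uv_le[of n t] abs_ge_self[of "(u n t)\<^sup>2 + (v n t)\<^sup>2"] by (rule order_trans)
    qed
  qed measurable
  have uv: "(\<lambda>n. \<integral>t. u n t * v n t \<partial>\<mu>) \<longlonglongrightarrow> 0"
  proof (rule Lim_null_comparison)
    show "\<forall>\<^sub>F n in sequentially. norm (\<integral>t. u n t * v n t \<partial>\<mu>) \<le> (\<integral>t. (u n t)\<^sup>2 \<partial>\<mu>) + (\<integral>t. (v n t)\<^sup>2 \<partial>\<mu>)"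
    proof (rule always_eventually, rule allI)
      fix n
      have "norm (\<integral>t. u n t * v n t \<partial>\<mu>) \<le> (\<integral>t. norm (u n t * v n t) \<partial>\<mu>)" by (rule integral_norm_bound)
      also have "\<dots> \<le> (\<integral>t. (u n t)\<^sup>2 + (v n t)\<^sup>2 \<partial>\<mu>)"
      proof (rule integral_mono)
        show "integrable \<mu> (\<lambda>t. norm (u n t * v n t))" by (rule integrable_norm[OF iuv])
        show "integrable \<mu> (\<lambda>t. (u n t)\<^sup>2 + (v n t)\<^sup>2)" by (rule Bochner_Integration.integrable_add[OF iu iv])
        show "norm (u n t * v n t) \<le> (u n t)\<^sup>2 + (v n t)\<^sup>2" for t unfolding real_norm_def by (rule uv_le)
      qed
      also have "\<dots> = (\<integral>t. (u n t)\<^sup>2 \<partial>\<mu>) + (\<integral>t. (v n t)\<^sup>2 \<partial>\<mu>)"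
        by (rule Bochner_Integration.integral_add[OF iu iv])
      finally show "norm (\<integral>t. u n t * v n t \<partial>\<mu>) \<le> (\<integral>t. (u n t)\<^sup>2 \<partial>\<mu>) + (\<integral>t. (v n t)\<^sup>2 \<partial>\<mu>)" .
    qed
    show "(\<lambda>n. (\<integral>t. (u n t)\<^sup>2 \<partial>\<mu>) + (\<integral>t. (v n t)\<^sup>2 \<partial>\<mu>)) \<longlonglongrightarrow> 0"
      using tendsto_add[OF lu lv] by simp
  qed
  have um: "u n \<in> borel_measurable \<mu>" "v n \<in> borel_measurable \<mu>" for n by measurable
  note iu' = integral_tendsto_0_of_square[OF \<mu> iu um(1) lu g g1]
  note iv' = integral_tendsto_0_of_square[OF \<mu> iv um(2) lv f f1]
  have ii: "integrable \<mu> (\<lambda>t. f t * g t)"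
  proof (rule integrable_const_bound[of _ 1])
    show "AE t in \<mu>. norm (f t * g t) \<le> 1"
      by (rule AE_I2) (simp add: abs_mult mult_le_one f1 g1)
  qed (use f g in measurable)
  have eq: "(\<integral>t. a n t * b n t \<partial>\<mu>) = (\<integral>t. u n t * v n t \<partial>\<mu>) + (\<integral>t. u n t * g t \<partial>\<mu>)
    + (\<integral>t. v n t * f t \<partial>\<mu>) + (\<integral>t. f t * g t \<partial>\<mu>)" for n
  proof -
    have 1: "integrable \<mu> (\<lambda>t. u n t * v n t + u n t * g t)"
      by (rule Bochner_Integration.integrable_add[OF iuv iu'(1)])
    have 2: "integrable \<mu> (\<lambda>t. u n t * v n t + u n t * g t + v n t * f t)"
      by (rule Bochner_Integration.integrable_add[OF 1 iv'(1)])
    have "(\<integral>t. a n t * b n t \<partial>\<mu>) = (\<integral>t. u n t * v n t + u n t * g t + v n t * f t + f t * g t \<partial>\<mu>)"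
      by (rule Bochner_Integration.integral_cong[OF refl]) (simp add: u_def v_def algebra_simps)
    then show ?thesis
      by (simp only: Bochner_Integration.integral_add[OF 2 ii] Bochner_Integration.integral_add[OF 1 iv'(1)]
          Bochner_Integration.integral_add[OF iuv iu'(1)])
  qed
  show ?thesis
    unfolding eq using tendsto_add[OF tendsto_add[OF tendsto_add[OF uv iu'(2)] iv'(2)] tendsto_const[of "\<integral>t. f t * g t \<partial>\<mu>"]]
    by simp
qed

lemma inner_eq_all: "(\<And>z. inner x z = inner y z) \<Longrightarrow> x = (y :: 'a::real_inner)"
  using vector_eq_rdot by blast

text \<open>The clause on invariant subspaces holds because E \<Omega> x is a limit of polynomials
  in A applied to x; it will keep E inside the functions supported on S. Symmetry and
  multiplicativity cannot be seen from the pointwise construction of E and are read off from the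
  numbers <E \<Omega> x, E \<Omega>' y>.\<close>

theorem spectral_theorem_nonneg:
  fixes A :: "'a::{real_inner, complete_space} \<Rightarrow> 'a"
  assumes lin: "linear A" and sym: "\<And>x y. inner (A x) y = inner x (A y)"
    and pos: "\<And>x. 0 \<le> inner (A x) x" and le: "\<And>x. inner (A x) x \<le> M * inner x x" and M: "M > 0"
  shows "\<exists>E. resolution A E \<and> (\<forall>x. E UNIV x = x) \<and>
    (\<forall>\<Omega>\<in>sets borel. \<forall>W x. subspace W \<and> closed W \<and> (\<forall>w\<in>W. A w \<in> W) \<and> x \<in> W \<longrightarrow> E \<Omega> x \<in> W)"
proof -
  define \<mu> where "\<mu> x = (SOME \<mu>. moment_measure A M x \<mu>)" for x
  have mm: "moment_measure A M x (\<mu> x)" for x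
    unfolding \<mu>_def by (rule someI_ex, rule moment_measure_exists) fact+
  have fin: "finite_measure (\<mu> x)" and sets\<mu>: "sets (\<mu> x) = sets borel" and ae: "AE t in \<mu> x. t \<in> {0..M}"
    and mom: "(\<integral>t. t ^ m \<partial>\<mu> x) = inner ((A ^^ m) x) x" for x m
    using mm[of x] by (auto simp: moment_measure_def)
  note [measurable_cong] = sets\<mu>
  have sp: "space (\<mu> x) = UNIV" for x
    using sets\<mu>[of x] by (metis sets_eq_imp_space_eq space_borel)
  have intp: "integrable (\<mu> x) (poly p)" for x and p :: "real poly"
    by (rule integrable_poly_on_interval[OF fin sets\<mu> ae])
  have polym [measurable]: "poly p \<in> borel_measurable borel" for p :: "real poly"
    by (auto intro!: borel_measurable_continuous_onI continuous_intros)
  have momp: "(\<integral>t. poly p t \<partial>\<mu> x) = inner (poly_op A p x) x" for x and p :: "real poly"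
  proof -
    have "integrable (\<mu> x) (\<lambda>t. t ^ i)" for i :: nat
    proof -
      have "poly (monom 1 i) = (\<lambda>t. t ^ i :: real)" by (auto simp: poly_monom)
      then show ?thesis using intp[where x = x and p = "monom 1 i"] by simp
    qed
    then show ?thesis
      by (simp add: poly_altdef poly_op_def inner_sum_left mom)
  qed
  have normp: "(norm (poly_op A p x))\<^sup>2 = (\<integral>t. (poly p t)\<^sup>2 \<partial>\<mu> x)" for p x
    using momp[where p = "p * p" and x = x] poly_op_square[OF lin sym, of p p x x]
    unfolding power2_norm_eq_inner by (simp add: power2_eq_square)
  have IM: "interval_measures (\<mu> ` X) M" if "finite X" for X
    by (rule interval_measures.intro) (use that fin sets\<mu> ae in blast)+
  define approx where "approx X \<Omega> p \<longleftrightarrow>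
    (\<forall>x\<in>X. (\<lambda>n. \<integral>t. (poly (p n) t - indicator \<Omega> t)\<^sup>2 \<partial>\<mu> x) \<longlonglongrightarrow> 0)" for X \<Omega> and p :: "nat \<Rightarrow> real poly"
  have approx_ex: "\<exists>p. approx X \<Omega> p" if "finite X" "\<Omega> \<in> sets borel" for X \<Omega>
    using interval_measures.poly_sequence_exists[OF IM[OF that(1)] that(2)] by (simp add: approx_def)
  have intsq: "integrable (\<mu> x) (\<lambda>t. (poly p t - indicator \<Omega> t)\<^sup>2)" if "\<Omega> \<in> sets borel" for x p \<Omega>
    by (rule interval_measures.integrable_poly_diff_square[OF IM[of "{x}"], where B = 1])
      (auto intro: borel_measurable_indicator that simp: indicator_le_1)
  \<comment> \<open>Two sequences and two index maps, so that one estimate yields both the Cauchy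
    property (p = q) and the independence of the approximating sequence.\<close>
  have diff: "(\<lambda>n. poly_op A (p (f n)) x - poly_op A (q (g n)) x) \<longlonglongrightarrow> 0"
    if "approx {x} \<Omega> p" "approx {x} \<Omega> q" "\<Omega> \<in> sets borel" "filterlim f at_top sequentially" "filterlim g at_top sequentially"
    for x \<Omega> p q f g
  proof -
    let ?a = "\<lambda>n. \<integral>t. (poly (p n) t - indicator \<Omega> t)\<^sup>2 \<partial>\<mu> x"
    let ?b = "\<lambda>n. \<integral>t. (poly (q n) t - indicator \<Omega> t)\<^sup>2 \<partial>\<mu> x"
    have bound: "(norm (poly_op A (p m) x - poly_op A (q n) x))\<^sup>2 \<le> 2 * ?a m + 2 * ?b n" for m n
    proof -
      have "(norm (poly_op A (p m) x - poly_op A (q n) x))\<^sup>2 = (\<integral>t. (poly (p m) t - poly (q n) t)\<^sup>2 \<partial>\<mu> x)"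
        using normp[where p = "p m - q n" and x = x] by (simp add: poly_op_diff)
      also have "\<dots> \<le> (\<integral>t. 2 * (poly (p m) t - indicator \<Omega> t)\<^sup>2 + 2 * (poly (q n) t - indicator \<Omega> t)\<^sup>2 \<partial>\<mu> x)"
      proof (rule integral_mono)
        show "integrable (\<mu> x) (\<lambda>t. (poly (p m) t - poly (q n) t)\<^sup>2)"
        proof -
          have eq: "poly ((p m - q n)\<^sup>2) = (\<lambda>t. (poly (p m) t - poly (q n) t)\<^sup>2)"
            by (rule ext) simp
          from intp[where x = x and p = "(p m - q n)\<^sup>2"] show ?thesis unfolding eq .
        qed
        fix t
        define i where "i = indicat_real \<Omega> t"
        have "0 \<le> ((poly (p m) t - i) + (poly (q n) t - i))\<^sup>2" by simp
        then show "(poly (p m) t - poly (q n) t)\<^sup>2 \<le> 2 * (poly (p m) t - indicator \<Omega> t)\<^sup>2 + 2 * (poly (q n) t - indicator \<Omega> t)\<^sup>2"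
          unfolding i_def[symmetric] by (simp add: power2_eq_square algebra_simps)
      qed (use intsq[OF that(3)] in auto)
      also have "\<dots> = 2 * ?a m + 2 * ?b n"
        using intsq[OF that(3)] by simp
      finally show ?thesis .
    qed
    have lim: "(\<lambda>n. 2 * ?a (f n) + 2 * ?b (g n)) \<longlonglongrightarrow> 2 * 0 + 2 * 0"
    proof -
      have a: "?a \<longlonglongrightarrow> 0" and b: "?b \<longlonglongrightarrow> 0"
        using that(1,2) unfolding approx_def by blast+
      show ?thesis
        by (intro tendsto_add tendsto_mult_left filterlim_compose[OF a that(4)] filterlim_compose[OF b that(5)])
    qed
    have "(\<lambda>n. (norm (poly_op A (p (f n)) x - poly_op A (q (g n)) x))\<^sup>2) \<longlonglongrightarrow> 0"
    proof (rule real_tendsto_sandwich[OF _ _ tendsto_const lim[simplified]])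
      show "\<forall>\<^sub>F n in sequentially. (norm (poly_op A (p (f n)) x - poly_op A (q (g n)) x))\<^sup>2 \<le> 2 * ?a (f n) + 2 * ?b (g n)"
        using bound by (rule always_eventually[OF allI])
    qed simp_all
    then have "(\<lambda>n. sqrt ((norm (poly_op A (p (f n)) x - poly_op A (q (g n)) x))\<^sup>2)) \<longlonglongrightarrow> sqrt 0"
      by (rule tendsto_real_sqrt)
    then show ?thesis by (simp add: tendsto_norm_zero_iff)
  qed
  have conv: "convergent (\<lambda>n. poly_op A (p n) x)" if "approx {x} \<Omega> p" "\<Omega> \<in> sets borel" for x \<Omega> p
  proof (rule Cauchy_convergent, rule CauchyI)
    fix e :: real assume e: "e > 0"
    show "\<exists>K. \<forall>m\<ge>K. \<forall>n\<ge>K. norm (poly_op A (p m) x - poly_op A (p n) x) < e"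
    proof (rule ccontr)
      assume "\<not> ?thesis"
      then obtain f g where fg: "\<And>K. f K \<ge> K" "\<And>K. g K \<ge> K" 
        "\<And>K. \<not> norm (poly_op A (p (f K)) x - poly_op A (p (g K)) x) < e"
        by metis
      have "filterlim f at_top sequentially" "filterlim g at_top sequentially"
        using fg by (auto intro: filterlim_at_top_mono[OF filterlim_ident])
      from tendstoD[OF diff[OF that(1,1,2) this] e] fg(3) show False
        by (auto simp: eventually_sequentially)
    qed
  qed
  \<comment> \<open>The polynomials chosen here depend on x; \<open>E_lim\<close> shows that every
    sequence approximating at x gives the same vector.\<close>
  define E where "E \<Omega> x = lim (\<lambda>n. poly_op A ((SOME p. approx {x} \<Omega> p) n) x)" for \<Omega> x
  have E_lim: "(\<lambda>n. poly_op A (p n) x) \<longlonglongrightarrow> E \<Omega> x" if "approx X \<Omega> p" "x \<in> X" "\<Omega> \<in> sets borel" for X \<Omega> p x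
  proof -
    have p: "approx {x} \<Omega> p" using that by (auto simp: approx_def)
    define q where "q = (SOME p. approx {x} \<Omega> p)"
    have q: "approx {x} \<Omega> q" using someI_ex[OF approx_ex[of "{x}" \<Omega>]] that(3) unfolding q_def by simp
    have "(\<lambda>n. poly_op A (q n) x) \<longlonglongrightarrow> E \<Omega> x"
      using conv[OF q that(3)] unfolding E_def q_def[symmetric] by (simp add: convergent_LIMSEQ_iff)
    moreover have "(\<lambda>n. poly_op A (p n) x - poly_op A (q n) x) \<longlonglongrightarrow> 0"
      by (rule diff[OF p q that(3)]) (auto intro: filterlim_ident)
    ultimately show ?thesis
      using tendsto_add[of "\<lambda>n. poly_op A (p n) x - poly_op A (q n) x" 0 sequentially "\<lambda>n. poly_op A (q n) x" "E \<Omega> x"] by simp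
  qed
  have inner_lim: "(\<lambda>n. inner (poly_op A (p n * q n) z) z) \<longlonglongrightarrow> measure (\<mu> z) (\<Omega> \<inter> \<Omega>')"
    if "approx X \<Omega> p" "approx X \<Omega>' q" "z \<in> X" "\<Omega> \<in> sets borel" "\<Omega>' \<in> sets borel" for X \<Omega> \<Omega>' p q z
  proof -
    have ind: "\<bar>indicat_real S t\<bar> \<le> 1" for S and t :: real by (simp add: indicator_def)
    have meas: "f \<in> borel_measurable (\<mu> z)" if "f \<in> borel_measurable borel" for f :: "real \<Rightarrow> real"
      using that by (simp only: measurable_cong_sets[OF sets\<mu> refl])
    have "(\<lambda>n. \<integral>t. poly (p n) t * poly (q n) t \<partial>\<mu> z) \<longlonglongrightarrow> (\<integral>t. indicator \<Omega> t * indicator \<Omega>' t \<partial>\<mu> z)"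
    proof (rule integral_mult_tendsto[OF fin])
      show "(\<lambda>n. \<integral>t. (poly (p n) t - indicator \<Omega> t)\<^sup>2 \<partial>\<mu> z) \<longlonglongrightarrow> 0"
        "(\<lambda>n. \<integral>t. (poly (q n) t - indicator \<Omega>' t)\<^sup>2 \<partial>\<mu> z) \<longlonglongrightarrow> 0"
        using that(1-3) unfolding approx_def by blast+
    qed (rule meas polym borel_measurable_indicator that ind intsq)+
    moreover have "(\<integral>t. poly (p n) t * poly (q n) t \<partial>\<mu> z) = inner (poly_op A (p n * q n) z) z" for n
      unfolding momp[symmetric] poly_mult ..
    moreover have "(\<integral>t. indicator \<Omega> t * indicator \<Omega>' t \<partial>\<mu> z) = measure (\<mu> z) (\<Omega> \<inter> \<Omega>')"
      unfolding indicator_inter_arith[symmetric] by (simp add: sp)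
    ultimately show ?thesis by simp
  qed
  \<comment> \<open>Polarized scalar measures. Bilinearity of \<open>b\<close> is not proved; the
    linearity of E will come from its symmetry.\<close>
  define b where "b \<Omega> x y = (measure (\<mu> (x + y)) \<Omega> - measure (\<mu> (x - y)) \<Omega>) / 4" for \<Omega> x y
  have E_b: "inner (E \<Omega> x) (E \<Omega>' y) = b (\<Omega> \<inter> \<Omega>') x y" if "\<Omega> \<in> sets borel" "\<Omega>' \<in> sets borel" for \<Omega> \<Omega>' x y
  proof -
    \<comment> \<open>The polarization identity requires the same polynomials at all four
      vectors.\<close>
    let ?X = "{x, y, x + y, x - y}"
    have "\<exists>p. approx ?X \<Omega> p" "\<exists>q. approx ?X \<Omega>' q" by (intro approx_ex that; simp)+
    then obtain p q where p: "approx ?X \<Omega> p" and q: "approx ?X \<Omega>' q" by (elim exE)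
    have "(\<lambda>n. inner (poly_op A (p n) x) (poly_op A (q n) y)) \<longlonglongrightarrow> inner (E \<Omega> x) (E \<Omega>' y)"
      by (intro tendsto_inner E_lim[OF p _ that(1)] E_lim[OF q _ that(2)]) simp_all
    moreover have "inner (poly_op A (p n) x) (poly_op A (q n) y) = 
      (inner (poly_op A (p n * q n) (x + y)) (x + y) - inner (poly_op A (p n * q n) (x - y)) (x - y)) / 4" for n
    proof -
      let ?P = "poly_op A (p n * q n)"
      have l: "linear ?P" by (rule linear_poly_op[OF lin])
      have s: "inner (?P y) x = inner (?P x) y"
        using inner_poly_op_commute[OF sym, of "p n * q n" y x] by (simp add: inner_commute)
      have "inner (poly_op A (p n) x) (poly_op A (q n) y) = inner (?P x) y"
        using poly_op_square[OF lin sym, of "q n" "p n" x y] by (simp add: mult.commute)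
      also have "\<dots> = (inner (?P (x + y)) (x + y) - inner (?P (x - y)) (x - y)) / 4"
        by (simp add: linear_add[OF l] linear_diff[OF l] inner_simps s)
      finally show ?thesis .
    qed
    moreover have "(\<lambda>n. (inner (poly_op A (p n * q n) (x + y)) (x + y) - inner (poly_op A (p n * q n) (x - y)) (x - y)) / 4)
       \<longlonglongrightarrow> b (\<Omega> \<inter> \<Omega>') x y"
      unfolding b_def
      by (intro tendsto_divide tendsto_diff tendsto_const inner_lim[OF p q _ that]) simp_all
    ultimately show ?thesis
      by (simp only:) (rule LIMSEQ_unique)
  qed
  \<comment> \<open>Computed directly, as \<open>b\<close> with y = x would give the measures at 2 x
    and at 0 instead of the one at x.\<close>
  have E_meas: "inner (E \<Omega> x) (E \<Omega>' x) = measure (\<mu> x) (\<Omega> \<inter> \<Omega>')" if "\<Omega> \<in> sets borel" "\<Omega>' \<in> sets borel" for \<Omega> \<Omega>' x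
  proof -
    have "\<exists>p. approx {x} \<Omega> p" "\<exists>q. approx {x} \<Omega>' q" by (intro approx_ex that; simp)+
    then obtain p q where p: "approx {x} \<Omega> p" and q: "approx {x} \<Omega>' q" by (elim exE)
    have "(\<lambda>n. inner (poly_op A (p n) x) (poly_op A (q n) x)) \<longlonglongrightarrow> inner (E \<Omega> x) (E \<Omega>' x)"
      by (intro tendsto_inner E_lim[OF p _ that(1)] E_lim[OF q _ that(2)]) simp_all
    moreover have "inner (poly_op A (p n) x) (poly_op A (q n) x) = inner (poly_op A (p n * q n) x) x" for n
      using poly_op_square[OF lin sym, of "q n" "p n" x x] by (simp add: mult.commute)
    ultimately show ?thesis
      using LIMSEQ_unique[OF _ inner_lim[OF p q _ that]] by simp
  qed
  have E_UNIV: "E UNIV x = x" for x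
  proof -
    have "approx {x} UNIV (\<lambda>_. 1)" by (simp add: approx_def)
    from E_lim[OF this singletonI] have "(\<lambda>n. poly_op A 1 x) \<longlonglongrightarrow> E UNIV x" by simp
    then show ?thesis by (simp add: LIMSEQ_const_iff)
  qed
  have E1: "inner (E \<Omega> x) y = b \<Omega> x y" "inner x (E \<Omega> y) = b \<Omega> x y" if "\<Omega> \<in> sets borel" for \<Omega> x y
    using E_b[OF that, of UNIV x y] E_b[OF _ that, of UNIV x y] by (simp_all add: E_UNIV)
  have E_sym: "inner (E \<Omega> x) y = inner x (E \<Omega> y)" if "\<Omega> \<in> sets borel" for \<Omega> x y
    by (simp only: E1[OF that])
  have E_lin: "linear (E \<Omega>)" if "\<Omega> \<in> sets borel" for \<Omega>
    \<comment> \<open>An everywhere defined symmetric map is linear: move it to the other side of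
      the inner product.\<close>
    by (rule linearI; rule inner_eq_all) (simp_all add: E_sym[OF that] inner_simps)
  have E_mult: "E (\<Omega> \<inter> \<Omega>') x = E \<Omega> (E \<Omega>' x)" if "\<Omega> \<in> sets borel" "\<Omega>' \<in> sets borel" for \<Omega> \<Omega>' x
  proof (rule inner_eq_all)
    fix z
    have "inner (E (\<Omega> \<inter> \<Omega>') x) z = b (\<Omega>' \<inter> \<Omega>) x z" unfolding Int_commute[of \<Omega> \<Omega>'] by (rule E1(1)) (simp add: that sets.Int)
    also have "\<dots> = inner (E \<Omega>' x) (E \<Omega> z)" by (rule E_b[OF that(2,1), symmetric])
    also have "\<dots> = inner (E \<Omega> (E \<Omega>' x)) z" by (rule E_sym[OF that(1), symmetric])
    finally show "inner (E (\<Omega> \<inter> \<Omega>') x) z = inner (E \<Omega> (E \<Omega>' x)) z" .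
  qed
  have E_sums: "(\<lambda>n. inner (E (\<Omega> n) x) y) sums inner (E (\<Union>n. \<Omega> n) x) y"
    if "range \<Omega> \<subseteq> sets borel" "disjoint_family \<Omega>" for \<Omega> :: "nat \<Rightarrow> real set" and x y
  proof -
    have "\<Omega> n \<in> sets borel" "(\<Union>n. \<Omega> n) \<in> sets borel" for n using that by auto
    moreover have "(\<lambda>n. b (\<Omega> n) x y) sums b (\<Union>n. \<Omega> n) x y"
      unfolding b_def
      by (intro sums_divide sums_diff finite_measure.finite_measure_UNION fin) (use that in \<open>auto simp: sets\<mu>\<close>)
    ultimately show ?thesis by (simp add: E1)
  qed
  have E_quad: "inner (E \<Omega> x) x = measure (\<mu> x) \<Omega>" if "\<Omega> \<in> sets borel" for \<Omega> x
    using E_meas[of \<Omega> UNIV x] that by (simp add: E_UNIV)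
  have \<mu>_eq: "measure_of UNIV (sets borel) (\<lambda>\<Omega>. ennreal (inner (E \<Omega> x) x)) = \<mu> x" for x
  proof -
    interpret finite_measure "\<mu> x" by (rule fin)
    have "\<mu> x = measure_of (space (\<mu> x)) (sets (\<mu> x)) (emeasure (\<mu> x))" by (simp add: measure_of_of_measure)
    also have "\<dots> = measure_of UNIV (sets borel) (emeasure (\<mu> x))" by (simp add: sp sets\<mu>)
    also have "\<dots> = measure_of UNIV (sets borel) (\<lambda>\<Omega>. ennreal (inner (E \<Omega> x) x))"
      by (rule measure_of_eq) (auto simp: sets.sigma_sets_eq[of borel, simplified] emeasure_eq_measure E_quad)
    finally show ?thesis by simp
  qed
  have "resolution A E"
    unfolding resolution_def Let_def \<mu>_eq
  proof (intro conjI ballI allI impI)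
    show "integrable (\<mu> x) (\<lambda>t. t)" "(\<integral>t. t \<partial>\<mu> x) = inner (A x) x" for x
    proof -
      have eq: "poly [:0, 1:] = (\<lambda>t. t :: real)" by (rule ext) simp
      from intp[where x = x and p = "[:0, 1:]"] show "integrable (\<mu> x) (\<lambda>t. t)" unfolding eq .
      show "(\<integral>t. t \<partial>\<mu> x) = inner (A x) x" using mom[where m = 1 and x = x] by simp
    qed
  qed (use E_lin E_sym E_mult E_sums in auto)
  moreover have "E \<Omega> x \<in> W" if "\<Omega> \<in> sets borel" "subspace W" "closed W" "\<forall>w\<in>W. A w \<in> W" "x \<in> W" for \<Omega> W x
  proof -
    have "\<exists>p. approx {x} \<Omega> p" by (intro approx_ex that) simp
    then obtain p where "approx {x} \<Omega> p" ..
    from closed_sequentially[OF that(3) _ E_lim[OF this _ that(1)]] poly_op_in_subspace[OF that(2)] that(4,5)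
    show ?thesis by blast
  qed
  ultimately show ?thesis using E_UNIV by blast
qed

section \<open>The Hilbert space of square summable functions\<close>

text \<open>A type, so that the theory of real inner product spaces and of complete spaces applies.
  It covers the whole index type; functions on S will form the closed subspace
  \<open>l2_supp S\<close>.\<close>

typedef 'i l2 = "{f :: 'i \<Rightarrow> real. (\<lambda>i. (f i)\<^sup>2) summable_on UNIV}"
  morphisms l2_nth Abs_l2
  by (rule exI[of _ "\<lambda>_. 0"]) simp

lemma summable_on_mult_of_squares:
  fixes f g :: "'i \<Rightarrow> real"
  assumes "(\<lambda>i. (f i)\<^sup>2) summable_on UNIV" "(\<lambda>i. (g i)\<^sup>2) summable_on UNIV"
  shows "(\<lambda>i. f i * g i) summable_on UNIV"
  using abs_summable_product[of f UNIV g] assms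
  by (simp add: power2_eq_square abs_summable_summable)

lemma summable_on_square_add:
  fixes f g :: "'i \<Rightarrow> real"
  assumes "(\<lambda>i. (f i)\<^sup>2) summable_on UNIV" "(\<lambda>i. (g i)\<^sup>2) summable_on UNIV"
  shows "(\<lambda>i. (f i + g i)\<^sup>2) summable_on UNIV"
proof -
  have "(\<lambda>i. (f i)\<^sup>2 + (g i)\<^sup>2 + 2 * (f i * g i)) summable_on UNIV"
    by (intro summable_on_add summable_on_cmult_right summable_on_mult_of_squares assms)
  then show ?thesis by (simp add: power2_sum mult.assoc)
qed

lemma summable_on_square_scale:
  fixes f :: "'i \<Rightarrow> real"
  assumes "(\<lambda>i. (f i)\<^sup>2) summable_on UNIV"
  shows "(\<lambda>i. (c * f i)\<^sup>2) summable_on UNIV"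
  using summable_on_cmult_right[OF assms, of "c\<^sup>2"] by (simp add: power_mult_distrib)

lemma summable_l2_nth: "(\<lambda>i. (l2_nth x i)\<^sup>2) summable_on UNIV"
  using l2_nth[of x] by simp

lemma l2_nth_Abs: "(\<lambda>i. (f i)\<^sup>2) summable_on UNIV \<Longrightarrow> l2_nth (Abs_l2 f) = f"
  by (simp add: Abs_l2_inverse)

lemma l2_eqI: "(\<And>i. l2_nth x i = l2_nth y i) \<Longrightarrow> x = y"
  using l2_nth_inject by blast

instantiation l2 :: (type) real_vector
begin

definition "0 = Abs_l2 (\<lambda>_. 0)"
definition "x + y = Abs_l2 (\<lambda>i. l2_nth x i + l2_nth y i)"
definition "x - y = Abs_l2 (\<lambda>i. l2_nth x i - l2_nth y i)"
definition "- x = Abs_l2 (\<lambda>i. - l2_nth x i)"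
definition "c *\<^sub>R x = Abs_l2 (\<lambda>i. c * l2_nth x i)"

lemma l2_nth_zero: "l2_nth 0 i = 0"
  and l2_nth_add: "l2_nth (x + y) i = l2_nth x i + l2_nth y i"
  and l2_nth_diff: "l2_nth (x - y) i = l2_nth x i - l2_nth y i"
  and l2_nth_minus: "l2_nth (- x) i = - l2_nth x i"
  and l2_nth_scaleR: "l2_nth (c *\<^sub>R x) i = c * l2_nth x i"
  using summable_on_square_add[OF summable_l2_nth[of x] summable_on_square_scale[OF summable_l2_nth[of y], of "-1"]]
    summable_on_square_add[OF summable_l2_nth[of x] summable_l2_nth[of y]]
    summable_on_square_scale[OF summable_l2_nth[of x], of c] summable_l2_nth[of x]
  by (simp_all add: zero_l2_def plus_l2_def minus_l2_def uminus_l2_def scaleR_l2_def l2_nth_Abs)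

instance
  by standard (auto intro!: l2_eqI simp: l2_nth_zero l2_nth_add l2_nth_diff l2_nth_minus l2_nth_scaleR algebra_simps)

end

lemmas l2_nth_simps [simp] = l2_nth_zero l2_nth_add l2_nth_diff l2_nth_minus l2_nth_scaleR

lemma l2_nth_sum [simp]: "l2_nth (\<Sum>a\<in>F. f a) i = (\<Sum>a\<in>F. l2_nth (f a) i)"
  by (induction F rule: infinite_finite_induct) auto

lemma summable_l2_mult: "(\<lambda>i. l2_nth x i * l2_nth y i) summable_on UNIV"
  by (intro summable_on_mult_of_squares summable_l2_nth)

instantiation l2 :: (type) real_inner
begin

definition "inner x y = (\<Sum>\<^sub>\<infinity>i. l2_nth x i * l2_nth y i)"
definition "norm (x :: 'a l2) = sqrt (inner x x)"
definition "sgn (x :: 'a l2) = x /\<^sub>R norm x"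
definition "dist (x :: 'a l2) y = norm (x - y)"
definition "uniformity = (INF e\<in>{0 <..}. principal {(x, y). dist (x :: 'a l2) y < e})"
definition "open (U :: 'a l2 set) = (\<forall>x\<in>U. \<forall>\<^sub>F (x', y) in uniformity. x' = x \<longrightarrow> y \<in> U)"

instance
proof
  fix x y z :: "'a l2" and r :: real and U :: "'a l2 set"
  show "dist x y = norm (x - y)" by (rule dist_l2_def)
  show "sgn x = x /\<^sub>R norm x" by (rule sgn_l2_def)
  show "uniformity = (INF e\<in>{0 <..}. principal {(x, y). dist (x :: 'a l2) y < e})" by (rule uniformity_l2_def)
  show "open U = (\<forall>x\<in>U. \<forall>\<^sub>F (x', y) in uniformity. x' = x \<longrightarrow> y \<in> U)" by (rule open_l2_def)
  show "inner x y = inner y x" by (simp add: inner_l2_def mult.commute)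
  show "inner (x + y) z = inner x z + inner y z"
    by (simp add: inner_l2_def distrib_right infsum_add summable_l2_mult)
  show "inner (r *\<^sub>R x) y = r * inner x y"
    by (simp add: inner_l2_def mult.assoc infsum_cmult_right')
  show "0 \<le> inner x x" by (simp add: inner_l2_def infsum_nonneg)
  show "inner x x = 0 \<longleftrightarrow> x = 0"
  proof
    assume *: "inner x x = 0"
    have "l2_nth x i * l2_nth x i = 0" for i
      by (rule nonneg_infsum_le_0D[of "\<lambda>i. l2_nth x i * l2_nth x i" UNIV])
        (use * in \<open>auto simp: inner_l2_def summable_l2_mult\<close>)
    then show "x = 0" by (intro l2_eqI) simp
  qed (simp add: inner_l2_def)
  show "norm x = sqrt (inner x x)" by (rule norm_l2_def)
qed

end

lemma norm_l2_square: "(norm x)\<^sup>2 = (\<Sum>\<^sub>\<infinity>i. (l2_nth x i)\<^sup>2)"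
  by (simp add: power2_norm_eq_inner inner_l2_def power2_eq_square[of "l2_nth x _"])

lemma sum_squares_le_norm_l2:
  assumes "finite F" shows "(\<Sum>i\<in>F. (l2_nth x i)\<^sup>2) \<le> (norm x)\<^sup>2"
  unfolding norm_l2_square by (rule finite_sum_le_infsum[OF summable_l2_nth assms]) auto

lemma l2_nth_le_norm: "\<bar>l2_nth x i\<bar> \<le> norm x"
  using sum_squares_le_norm_l2[of "{i}" x] by (simp add: abs_le_square_iff[symmetric])

lemma square_summable_of_bounded:
  fixes f :: "'i \<Rightarrow> real"
  assumes "\<And>F. finite F \<Longrightarrow> (\<Sum>i\<in>F. (f i)\<^sup>2) \<le> B"
  shows "(\<lambda>i. (f i)\<^sup>2) summable_on UNIV" and "(\<Sum>\<^sub>\<infinity>i. (f i)\<^sup>2) \<le> B"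
proof -
  show s: "(\<lambda>i. (f i)\<^sup>2) summable_on UNIV"
    by (rule nonneg_bdd_above_summable_on) (use assms in \<open>auto intro!: bdd_aboveI[of _ B]\<close>)
  show "(\<Sum>\<^sub>\<infinity>i. (f i)\<^sup>2) \<le> B"
    by (rule infsum_le_finite_sums[OF s]) (use assms in auto)
qed

instance l2 :: (type) complete_space
proof
  fix X :: "nat \<Rightarrow> 'a l2" assume "Cauchy X"
  have Cauchy_nth: "Cauchy (\<lambda>n. l2_nth (X n) i)" for i
  proof (rule CauchyI)
    fix e :: real assume "e > 0"
    with \<open>Cauchy X\<close> obtain N where N: "\<And>m n. m \<ge> N \<Longrightarrow> n \<ge> N \<Longrightarrow> norm (X m - X n) < e"
      unfolding Cauchy_iff by blast
    have "norm (l2_nth (X m) i - l2_nth (X n) i) < e" if "m \<ge> N" "n \<ge> N" for m n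
      using l2_nth_le_norm[of "X m - X n" i] N[OF that] by simp
    then show "\<exists>N. \<forall>m\<ge>N. \<forall>n\<ge>N. norm (l2_nth (X m) i - l2_nth (X n) i) < e" by blast
  qed
  define f where "f i = lim (\<lambda>n. l2_nth (X n) i)" for i
  have f: "(\<lambda>n. l2_nth (X n) i) \<longlonglongrightarrow> f i" for i
    using Cauchy_convergent[OF Cauchy_nth] by (simp add: f_def convergent_LIMSEQ_iff)
  \<comment> \<open>A bound on finite partial sums survives the coordinatewise limit. It yields both
    that f is square summable and that X converges to it in norm.\<close>
  have bound: "(\<Sum>i\<in>F. (l2_nth (X m) i - f i)\<^sup>2) \<le> e\<^sup>2"
    if "finite F" and "\<And>n. n \<ge> N \<Longrightarrow> norm (X m - X n) \<le> e" for F m N e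
  proof (rule tendsto_upperbound)
    show "(\<lambda>n. \<Sum>i\<in>F. (l2_nth (X m) i - l2_nth (X n) i)\<^sup>2) \<longlonglongrightarrow> (\<Sum>i\<in>F. (l2_nth (X m) i - f i)\<^sup>2)"
      by (intro tendsto_sum tendsto_power tendsto_diff tendsto_const f)
    show "\<forall>\<^sub>F n in sequentially. (\<Sum>i\<in>F. (l2_nth (X m) i - l2_nth (X n) i)\<^sup>2) \<le> e\<^sup>2"
    proof (rule eventually_sequentiallyI[of N])
      fix n assume "N \<le> n"
      have "(\<Sum>i\<in>F. (l2_nth (X m) i - l2_nth (X n) i)\<^sup>2) \<le> (norm (X m - X n))\<^sup>2"
        using sum_squares_le_norm_l2[OF that(1), of "X m - X n"] by simp
      also have "\<dots> \<le> e\<^sup>2" using that(2)[OF \<open>N \<le> n\<close>] by (intro power_mono) auto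
      finally show "(\<Sum>i\<in>F. (l2_nth (X m) i - l2_nth (X n) i)\<^sup>2) \<le> e\<^sup>2" .
    qed
  qed simp
  obtain N1 where N1: "\<And>m n. m \<ge> N1 \<Longrightarrow> n \<ge> N1 \<Longrightarrow> norm (X m - X n) < 1"
    using \<open>Cauchy X\<close> zero_less_one unfolding Cauchy_iff by blast
  have "(\<lambda>i. (l2_nth (X N1) i - f i)\<^sup>2) summable_on UNIV"
    by (rule square_summable_of_bounded(1)[OF bound[where e = 1 and N = N1]]) (assumption, rule less_imp_le, rule N1, simp_all)
  from summable_on_square_add[OF summable_on_square_scale[OF this, of "-1"] summable_l2_nth[of "X N1"]]
  have fs: "(\<lambda>i. (f i)\<^sup>2) summable_on UNIV" by simp
  have "X \<longlonglongrightarrow> Abs_l2 f"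
  proof (rule LIMSEQ_I)
    fix e :: real assume e: "e > 0"
    then have "e / 2 > 0" by simp
    then obtain N where N: "\<And>m n. m \<ge> N \<Longrightarrow> n \<ge> N \<Longrightarrow> norm (X m - X n) < e / 2"
      using \<open>Cauchy X\<close> unfolding Cauchy_iff by blast
    have "norm (X m - Abs_l2 f) < e" if "m \<ge> N" for m
    proof -
      have "(norm (X m - Abs_l2 f))\<^sup>2 \<le> (e / 2)\<^sup>2"
        unfolding norm_l2_square l2_nth_diff l2_nth_Abs[OF fs]
        by (rule square_summable_of_bounded(2)[OF bound[where N = N]]) (assumption, rule less_imp_le, rule N[OF that])
      then have "norm (X m - Abs_l2 f) \<le> e / 2" using e by (simp add: power2_le_iff_abs_le)
      then show ?thesis using e by linarith
    qed
    then show "\<exists>N. \<forall>m\<ge>N. norm (X m - Abs_l2 f) < e" by blast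
  qed
  then show "convergent X" by (rule convergentI)
qed

section \<open>Unit vectors and the existence of adjoints\<close>

definition l2_basis :: "'i \<Rightarrow> 'i l2" where
  "l2_basis i = Abs_l2 (indicator {i})"

lemma l2_nth_basis: "l2_nth (l2_basis i) = indicator {i}"
  unfolding l2_basis_def
proof (rule l2_nth_Abs)
  show "(\<lambda>j. (indicator {i} j :: real)\<^sup>2) summable_on UNIV"
    using summable_on_cong_neutral[where S = UNIV and T = "{i}" and f = "\<lambda>j. (indicator {i} j :: real)\<^sup>2" and g = "\<lambda>_. 1"]
    by simp
qed

lemma inner_l2_basis: "inner x (l2_basis i) = l2_nth x i"
proof -
  have "inner x (l2_basis i) = (\<Sum>\<^sub>\<infinity>j\<in>{i}. l2_nth x j)"
    unfolding inner_l2_def l2_nth_basis by (rule infsum_cong_neutral) auto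
  then show ?thesis by simp
qed

lemma norm_l2_diff_finite_part:
  assumes "finite F"
  shows "(norm (x - (\<Sum>i\<in>F. l2_nth x i *\<^sub>R l2_basis i)))\<^sup>2 = (norm x)\<^sup>2 - (\<Sum>i\<in>F. (l2_nth x i)\<^sup>2)"
proof -
  let ?s = "\<Sum>i\<in>F. l2_nth x i *\<^sub>R l2_basis i"
  have 1: "inner x ?s = (\<Sum>i\<in>F. (l2_nth x i)\<^sup>2)"
    by (simp add: inner_sum_right inner_l2_basis power2_eq_square)
  have "l2_nth ?s j = l2_nth x j" if "j \<in> F" for j
    using assms that by (simp add: l2_nth_basis indicator_def of_bool_def if_distrib cong: if_cong)
  then have 2: "inner ?s ?s = (\<Sum>i\<in>F. (l2_nth x i)\<^sup>2)"
    by (subst inner_sum_right) (simp add: inner_l2_basis power2_eq_square del: l2_nth_sum)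
  show ?thesis
    unfolding power2_norm_eq_inner by (simp add: inner_diff_left inner_diff_right 1 2 inner_commute[of ?s x])
qed

text \<open>Truncations of x to finite sets are killed by f and tend to x in norm; this is density
  of the finitely supported vectors.\<close>

lemma bounded_linear_zero_on_basis:
  assumes f: "bounded_linear f" and 0: "\<And>i. f (l2_basis i) = 0"
  shows "f x = 0"
proof (rule ccontr)
  assume nz: "f x \<noteq> 0"
  interpret f: bounded_linear f by (rule f)
  obtain K where K: "K > 0" "\<And>y. norm (f y) \<le> norm y * K" using f.pos_bounded by blast
  define e where "e = (norm (f x) / K)\<^sup>2"
  have e: "e > 0" using nz K(1) by (simp add: e_def)
  have "((\<lambda>i. (l2_nth x i)\<^sup>2) has_sum (norm x)\<^sup>2) UNIV"
    unfolding norm_l2_square by (rule has_sum_infsum[OF summable_l2_nth])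
  then have "(sum (\<lambda>i. (l2_nth x i)\<^sup>2) \<longlongrightarrow> (norm x)\<^sup>2) (finite_subsets_at_top UNIV)"
    by (simp add: has_sum_def)
  then have "\<forall>\<^sub>F F in finite_subsets_at_top UNIV. dist (sum (\<lambda>i. (l2_nth x i)\<^sup>2) F) ((norm x)\<^sup>2) < e"
    using e by (rule tendstoD)
  then obtain F where F: "finite F" "dist (sum (\<lambda>i. (l2_nth x i)\<^sup>2) F) ((norm x)\<^sup>2) < e"
    by (auto simp: eventually_finite_subsets_at_top)
  let ?s = "\<Sum>i\<in>F. l2_nth x i *\<^sub>R l2_basis i"
  have "f ?s = 0" by (simp add: f.sum f.scaleR 0)
  then have "norm (f x) \<le> norm (x - ?s) * K" using K(2)[of "x - ?s"] by (simp add: f.diff)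
  moreover have "(norm (x - ?s))\<^sup>2 < e"
    using F norm_l2_diff_finite_part[OF F(1), of x] by (simp add: dist_real_def)
  then have "norm (x - ?s) < norm (f x) / K"
    unfolding e_def by (rule power_less_imp_less_base) (use K(1) in simp)
  ultimately show False using K(1) by (simp add: field_simps)
qed

text \<open>The coordinates of z are forced to be <D e_i, y>. They are square summable by testing
  with the truncation s of z itself: its squared norm S equals <D s, y>, which is at most K |y| sqrt
  S.\<close>

lemma l2_adjoint_exists:
  fixes D :: "'i l2 \<Rightarrow> 'j l2"
  assumes D: "bounded_linear D"
  shows "\<exists>z. \<forall>x. inner (D x) y = inner x z"
proof -
  interpret D: bounded_linear D by (rule D)
  obtain K where K: "K > 0" "\<And>x. norm (D x) \<le> norm x * K" using D.pos_bounded by blast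
  define z where "z i = inner (D (l2_basis i)) y" for i
  have "(\<Sum>i\<in>F. (z i)\<^sup>2) \<le> (K * norm y)\<^sup>2" if F: "finite F" for F
  proof -
    define S where "S = (\<Sum>i\<in>F. (z i)\<^sup>2)"
    let ?s = "\<Sum>i\<in>F. z i *\<^sub>R l2_basis i"
    have S0: "S \<ge> 0" unfolding S_def by (simp add: sum_nonneg)
    have "l2_nth ?s j = z j" if "j \<in> F" for j
      using F that by (simp add: l2_nth_basis indicator_def of_bool_def if_distrib cong: if_cong)
    then have "inner ?s ?s = S"
      unfolding S_def
      by (subst inner_sum_right) (simp add: inner_l2_basis power2_eq_square del: l2_nth_sum)
    then have ns: "norm ?s = sqrt S" by (simp add: norm_eq_sqrt_inner)
    have "S = inner (D ?s) y"
      by (simp add: S_def D.sum D.scaleR inner_sum_left z_def power2_eq_square)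
    also have "\<dots> \<le> norm (D ?s) * norm y" by (rule norm_cauchy_schwarz)
    also have "\<dots> \<le> sqrt S * K * norm y"
      using K(2)[of ?s] by (intro mult_right_mono) (auto simp: ns)
    finally have "sqrt S * sqrt S \<le> sqrt S * (K * norm y)" using S0 by (simp add: mult.assoc)
    then have "sqrt S \<le> K * norm y"
    proof (cases "S = 0")
      case False
      then have "sqrt S > 0" using S0 by simp
      then show ?thesis
        using \<open>sqrt S * sqrt S \<le> sqrt S * (K * norm y)\<close> mult_left_le_imp_le by blast
    qed (use K(1) in simp)
    then have "(sqrt S)\<^sup>2 \<le> (K * norm y)\<^sup>2" using S0 by (intro power_mono) auto
    then show ?thesis using S0 by (simp add: S_def)
  qed
  then have zs: "(\<lambda>i. (z i)\<^sup>2) summable_on UNIV" by (rule square_summable_of_bounded(1))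
  have "bounded_linear (\<lambda>x. inner (D x) y - inner x (Abs_l2 z))"
    by (intro bounded_linear_sub bounded_linear_compose[OF bounded_linear_inner_left D] bounded_linear_inner_left)
  from bounded_linear_zero_on_basis[OF this]
  have "inner (D x) y - inner x (Abs_l2 z) = 0" for x
    by (simp add: inner_commute[of "l2_basis _" "Abs_l2 z"] inner_l2_basis l2_nth_Abs[OF zs] z_def)
  then have "\<forall>x. inner (D x) y = inner x (Abs_l2 z)" by simp
  then show ?thesis ..
qed

section \<open>Ranges of spectral projections\<close>

text \<open>For vectors u and v on the two sides of a spectral projection, where the spectral
  measure of u + v is the sum of those of u and v.\<close>

lemma nn_integral_add_measure:
  assumes s: "sets N = sets L" "sets M = sets L"
    and e: "\<And>X. X \<in> sets L \<Longrightarrow> emeasure L X = emeasure M X + emeasure N X"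
    and f: "f \<in> borel_measurable L"
  shows "nn_integral L f = nn_integral M f + nn_integral N f"
proof -
  have mM: "g \<in> borel_measurable M" and mN: "g \<in> borel_measurable N"
    if "g \<in> borel_measurable L" for g :: "_ \<Rightarrow> ennreal"
    using that by (simp_all only: measurable_cong_sets[OF s(1) refl] measurable_cong_sets[OF s(2) refl])
  show ?thesis
    using f
  proof (induction rule: borel_measurable_induct)
    case (cong f g)
    then show ?case
      using nn_integral_cong[of L f g] nn_integral_cong[of M f g] nn_integral_cong[of N f g]
        sets_eq_imp_space_eq[OF s(1)] sets_eq_imp_space_eq[OF s(2)] by auto
  next
    case (set X)
    then show ?case using e[OF set] s by simp
  next
    case (mult u c)
    then have "u \<in> borel_measurable M" "u \<in> borel_measurable N"
      by (simp_all only: mM mN)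
    then show ?case using mult by (simp add: nn_integral_cmult distrib_left)
  next
    case (add u v)
    then have "u \<in> borel_measurable M" "u \<in> borel_measurable N" "v \<in> borel_measurable M" "v \<in> borel_measurable N"
      by (simp_all only: mM mN)
    then show ?case using add by (simp add: nn_integral_add add_ac)
  next
    case (seq U)
    have m: "U i \<in> borel_measurable M" "U i \<in> borel_measurable N" for i
      using seq(1) by (simp_all only: mM mN)
    have inc: "incseq (\<lambda>i. nn_integral M (U i))" "incseq (\<lambda>i. nn_integral N (U i))"
      using seq(3) by (auto simp: incseq_def le_fun_def intro!: nn_integral_mono)
    have eqs: "nn_integral L (SUP i. U i) = (SUP i. nn_integral L (U i))"
      "nn_integral M (SUP i. U i) = (SUP i. nn_integral M (U i))"
      "nn_integral N (SUP i. U i) = (SUP i. nn_integral N (U i))"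
      unfolding SUP_apply by (intro nn_integral_monotone_convergence_SUP seq(1,3) m)+
    show ?case unfolding eqs using inc by (simp add: seq.IH ennreal_SUP_add)
  qed
qed

lemma integral_add_measure:
  fixes f :: "'b \<Rightarrow> real"
  assumes s: "sets N = sets L" "sets M = sets L"
    and e: "\<And>X. X \<in> sets L \<Longrightarrow> emeasure L X = emeasure M X + emeasure N X"
    and i: "integrable M f" "integrable N f" "integrable L f"
  shows "integral\<^sup>L L f = integral\<^sup>L M f + integral\<^sup>L N f"
proof -
  have m: "(\<lambda>x. ennreal (f x)) \<in> borel_measurable L" "(\<lambda>x. ennreal (- f x)) \<in> borel_measurable L"
    using i(3) by auto
  have fin: "(\<integral>\<^sup>+x. ennreal (f x) \<partial>Q)  < \<infinity>" "(\<integral>\<^sup>+x. ennreal (- f x) \<partial>Q)  < \<infinity>" if "integrable Q f" for Q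
  proof -
    have "(\<integral>\<^sup>+x. ennreal (f x) \<partial>Q) \<le> (\<integral>\<^sup>+x. ennreal (norm (f x)) \<partial>Q)"
      "(\<integral>\<^sup>+x. ennreal (- f x) \<partial>Q) \<le> (\<integral>\<^sup>+x. ennreal (norm (f x)) \<partial>Q)"
      by (intro nn_integral_mono ennreal_leI; simp)+
    moreover have "(\<integral>\<^sup>+x. ennreal (norm (f x)) \<partial>Q) < \<infinity>"
      using that by (simp add: integrable_iff_bounded)
    ultimately show "(\<integral>\<^sup>+x. ennreal (f x) \<partial>Q) < \<infinity>" "(\<integral>\<^sup>+x. ennreal (- f x) \<partial>Q) < \<infinity>"
      by (auto intro: le_less_trans)
  qed
  have n: "(\<integral>\<^sup>+x. ennreal (f x) \<partial>L) = (\<integral>\<^sup>+x. ennreal (f x) \<partial>M) + (\<integral>\<^sup>+x. ennreal (f x) \<partial>N)"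
    "(\<integral>\<^sup>+x. ennreal (- f x) \<partial>L) = (\<integral>\<^sup>+x. ennreal (- f x) \<partial>M) + (\<integral>\<^sup>+x. ennreal (- f x) \<partial>N)"
    by (rule nn_integral_add_measure[OF s _ m(1)], rule e, assumption)
      (rule nn_integral_add_measure[OF s _ m(2)], rule e, assumption)
  show ?thesis
    unfolding real_lebesgue_integral_def[OF i(1)] real_lebesgue_integral_def[OF i(2)] real_lebesgue_integral_def[OF i(3)] n
    using fin[OF i(1)] fin[OF i(2)] by (simp add: enn2real_plus)
qed

locale spectral_resolution =
  fixes A :: "'a::real_inner \<Rightarrow> 'a" and E :: "real set \<Rightarrow> 'a \<Rightarrow> 'a"
  assumes res: "resolution A E"
    and linear_A: "linear A"
    and sym_A: "inner (A x) y = inner x (A y)"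
    and pos_A: "0 \<le> inner (A x) x"
begin

lemma E_linear: "\<Omega> \<in> sets borel \<Longrightarrow> linear (E \<Omega>)"
  and E_sym: "\<Omega> \<in> sets borel \<Longrightarrow> inner (E \<Omega> x) y = inner x (E \<Omega> y)"
  and E_mult: "\<Omega> \<in> sets borel \<Longrightarrow> \<Omega>' \<in> sets borel \<Longrightarrow> E \<Omega> (E \<Omega>' x) = E (\<Omega> \<inter> \<Omega>') x"
  using res by (simp_all add: resolution_def)

lemma E_sums:
  fixes S :: "nat \<Rightarrow> real set"
  assumes "range S \<subseteq> sets borel" "disjoint_family S"
  shows "(\<lambda>n. inner (E (S n) x) y) sums inner (E (\<Union>n. S n) x) y"
  using res[unfolded resolution_def, THEN conjunct2, THEN conjunct2, THEN conjunct1] assms by simp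

lemma E_norm: "\<Omega> \<in> sets borel \<Longrightarrow> inner (E \<Omega> x) x = (norm (E \<Omega> x))\<^sup>2"
  using E_sym[of \<Omega> "E \<Omega> x" x] E_mult[of \<Omega> \<Omega> x] by (simp add: power2_norm_eq_inner)

lemma E_contraction: "\<Omega> \<in> sets borel \<Longrightarrow> norm (E \<Omega> x) \<le> norm x"
proof -
  assume \<Omega>: "\<Omega> \<in> sets borel"
  have "norm (E \<Omega> x) * norm (E \<Omega> x) \<le> norm (E \<Omega> x) * norm x"
    using E_norm[OF \<Omega>, of x] norm_cauchy_schwarz[of "E \<Omega> x" x] by (simp add: power2_eq_square)
  then show ?thesis by (cases "norm (E \<Omega> x) = 0") (simp_all add: mult_le_cancel_left)
qed

lemma E_mono:
  assumes "\<Omega> \<in> sets borel" "\<Omega>' \<in> sets borel" "\<Omega> \<subseteq> \<Omega>'"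
  shows "norm (E \<Omega> x) \<le> norm (E \<Omega>' x)"
  using E_contraction[OF assms(1), of "E \<Omega>' x"] E_mult[OF assms(1,2), of x] assms(3) by (simp add: Int_absorb2)

text \<open>Countable additivity for the constantly empty family: a constant series converges only
  if its terms are 0.\<close>

lemma E_empty: "E {} x = 0"
proof -
  have "(\<lambda>n. inner (E {} x) x) sums inner (E {} x) x"
    using E_sums[of "\<lambda>_. {}" x x] by (auto simp: disjoint_family_on_def)
  then have "summable (\<lambda>n::nat. inner (E {} x) x)" by (rule sums_summable)
  then have "inner (E {} x) x = 0" by (simp add: summable_const_iff)
  then show ?thesis using E_norm[of "{}" x] by simp
qed

lemma E_Un:
  assumes "\<Omega> \<in> sets borel" "\<Omega>' \<in> sets borel" "\<Omega> \<inter> \<Omega>' = {}"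
  shows "E (\<Omega> \<union> \<Omega>') x = E \<Omega> x + E \<Omega>' x"
proof (rule inner_eq_all)
  fix y
  have "(\<lambda>n. inner (E (binaryset \<Omega> \<Omega>' n) x) y) sums inner (E (\<Union>n. binaryset \<Omega> \<Omega>' n) x) y"
    by (rule E_sums) (use assms in \<open>auto simp: binaryset_def disjoint_family_on_def\<close>)
  moreover have "(\<lambda>n. inner (E (binaryset \<Omega> \<Omega>' n) x) y) sums (inner (E \<Omega> x) y + inner (E \<Omega>' x) y)"
    by (rule binaryset_sums) (simp add: E_empty)
  ultimately show "inner (E (\<Omega> \<union> \<Omega>') x) y = inner (E \<Omega> x + E \<Omega>' x) y"
    using sums_unique2 by (fastforce simp: UN_binaryset_eq inner_add_left)
qed

section \<open>Scalar spectral measures and the interplay of A and E\<close>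

definition spectral_meas :: "'a \<Rightarrow> real measure" where
  "spectral_meas x = measure_of UNIV (sets borel) (\<lambda>\<Omega>. ennreal (inner (E \<Omega> x) x))"

lemma sets_spectral_meas [simp, measurable_cong]: "sets (spectral_meas x) = sets borel"
  using sets.sets_measure_of_eq[of borel] by (simp add: spectral_meas_def)

lemma space_spectral_meas [simp]: "space (spectral_meas x) = UNIV"
  unfolding spectral_meas_def by (simp add: space_measure_of_conv)

lemma emeasure_spectral_meas:
  assumes "\<Omega> \<in> sets borel"
  shows "emeasure (spectral_meas x) \<Omega> = ennreal ((norm (E \<Omega> x))\<^sup>2)"
proof -
  have "emeasure (spectral_meas x) \<Omega> = ennreal (inner (E \<Omega> x) x)"
    unfolding spectral_meas_def
  proof (rule emeasure_measure_of_sigma)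
    show "sigma_algebra UNIV (sets (borel :: real measure))"
      using sets.sigma_algebra_axioms[of "borel :: real measure"] by simp
    show "positive (sets borel) (\<lambda>\<Omega>. ennreal (inner (E \<Omega> x) x))"
      by (simp add: positive_def E_empty)
    show "countably_additive (sets borel) (\<lambda>\<Omega>. ennreal (inner (E \<Omega> x) x))"
    proof (rule countably_additiveI)
      fix S :: "nat \<Rightarrow> real set" assume S: "range S \<subseteq> sets borel" "disjoint_family S"
      then have "S n \<in> sets borel" for n by auto
      then show "(\<Sum>n. ennreal (inner (E (S n) x) x)) = ennreal (inner (E (\<Union>n. S n) x) x)"
        using E_sums[OF S, of x x] by (intro suminf_ennreal_eq) (auto simp: E_norm)
    qed
  qed (use assms in auto)
  then show ?thesis by (simp add: E_norm assms)
qed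

lemma finite_measure_spectral_meas: "finite_measure (spectral_meas x)"
  by (rule finite_measureI) (simp add: emeasure_spectral_meas)

lemma measure_spectral_meas: "\<Omega> \<in> sets borel \<Longrightarrow> measure (spectral_meas x) \<Omega> = (norm (E \<Omega> x))\<^sup>2"
  by (simp add: measure_def emeasure_spectral_meas)

lemma integrable_spectral_meas: "integrable (spectral_meas x) (\<lambda>t. t)"
  and integral_spectral_meas: "(\<integral>t. t \<partial>spectral_meas x) = inner (A x) x"
  using res by (simp_all add: resolution_def spectral_meas_def Let_def)

lemma AE_spectral_meas:
  assumes "\<Omega> \<in> sets borel" "E (- \<Omega>) x = 0"
  shows "AE t in spectral_meas x. t \<in> \<Omega>"
  by (rule AE_I[where N = "- \<Omega>"]) (use assms in \<open>auto simp: emeasure_spectral_meas\<close>)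

lemma E_compl_eq_0:
  assumes "\<Omega> \<in> sets borel" "\<Omega>' \<in> sets borel" "E \<Omega> x = x" "\<Omega> \<inter> \<Omega>' = {}"
  shows "E \<Omega>' x = 0"
  using E_mult[OF assms(2,1), of x] assms(3,4) by (simp add: E_empty Int_commute)

lemma E_UNIV_range: "\<Omega> \<in> sets borel \<Longrightarrow> E \<Omega> x = x \<Longrightarrow> E UNIV x = x"
  using E_mult[of UNIV \<Omega> x] by simp

text \<open>The spectral measure of such an x lives on t <= s and has total mass |x|^2, and <A x, x>
  is its first moment.\<close>

lemma A_le_on_range:
  assumes "E {..s} x = x" shows "inner (A x) x \<le> s * (norm x)\<^sup>2"
proof -
  interpret finite_measure "spectral_meas x" by (rule finite_measure_spectral_meas)
  have "(\<integral>t. t \<partial>spectral_meas x) \<le> (\<integral>t. s \<partial>spectral_meas x)"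
  proof (rule integral_mono_AE)
    have "AE t in spectral_meas x. t \<in> {..s}"
      by (rule AE_spectral_meas[OF _ E_compl_eq_0[of "{..s}"]]) (auto simp: assms)
    then show "AE t in spectral_meas x. t \<le> s" by simp
  qed (auto simp: integrable_spectral_meas)
  also have "\<dots> = s * (norm x)\<^sup>2"
    using E_UNIV_range[of "{..s}" x] assms by (simp add: measure_spectral_meas)
  finally show ?thesis by (simp add: integral_spectral_meas)
qed

lemma A_ge_on_range:
  assumes "E {s<..} x = x" shows "s * (norm x)\<^sup>2 \<le> inner (A x) x"
proof -
  interpret finite_measure "spectral_meas x" by (rule finite_measure_spectral_meas)
  have le: "(\<integral>t. s \<partial>spectral_meas x) \<le> (\<integral>t. t \<partial>spectral_meas x)"
  proof (rule integral_mono_AE)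
    have "AE t in spectral_meas x. t \<in> {s<..}"
      by (rule AE_spectral_meas[OF _ E_compl_eq_0[of "{s<..}"]]) (auto simp: assms)
    then show "AE t in spectral_meas x. s \<le> t" by (rule eventually_mono) simp
  qed (auto simp: integrable_spectral_meas)
  have eq: "(\<integral>t. s \<partial>spectral_meas x) = s * (norm x)\<^sup>2"
    using E_UNIV_range[of "{s<..}" x] assms by (simp add: measure_spectral_meas)
  show ?thesis using le unfolding eq integral_spectral_meas .
qed

text \<open>All cross terms <E S u, v> vanish, so the spectral measures of u and v add up to that of
  u + v. Integrating t shows that the quadratic form of A is additive on u and v, which by symmetry
  means <A u, v> = 0. This turns the identity for quadratic forms, the only link between A and E,
  into a statement about the operator.\<close>

lemma A_orthogonal:
  assumes \<Omega>: "\<Omega> \<in> sets borel" and u: "E \<Omega> u = u" and v: "E \<Omega> v = 0"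
  shows "inner (A u) v = 0"
proof -
  have cross: "inner (E S u) v = 0" if "S \<in> sets borel" for S
  proof -
    have "E S u = E \<Omega> (E S u)"
      using E_mult[OF that \<Omega>, of u] E_mult[OF \<Omega> that, of u] u by (simp add: Int_commute)
    then have "inner (E S u) v = inner (E S u) (E \<Omega> v)" using E_sym[OF \<Omega>] by metis
    then show ?thesis by (simp add: v)
  qed
  have sq: "(norm (E S (u + v)))\<^sup>2 = (norm (E S u))\<^sup>2 + (norm (E S v))\<^sup>2" if "S \<in> sets borel" for S
  proof -
    have "inner (E S v) u = 0" using cross[OF that] E_sym[OF that, of v u] by (simp add: inner_commute)
    then show ?thesis
      unfolding E_norm[OF that, symmetric]
      by (simp add: linear_add[OF E_linear[OF that]] inner_simps cross[OF that])
  qed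
  have "(\<integral>t. t \<partial>spectral_meas (u + v)) = (\<integral>t. t \<partial>spectral_meas u) + (\<integral>t. t \<partial>spectral_meas v)"
    by (rule integral_add_measure) (auto simp: integrable_spectral_meas emeasure_spectral_meas sq)
  then have "inner (A u) v + inner (A v) u = 0"
    by (simp add: integral_spectral_meas linear_add[OF linear_A] inner_simps)
  then show ?thesis using sym_A[of v u] by (simp add: inner_commute)
qed

text \<open>By the preceding lemma A has no off-diagonal block between the range of E \<Omega> and
  its orthogonal complement.\<close>

lemma E_A_commute:
  assumes \<Omega>: "\<Omega> \<in> sets borel"
  shows "E \<Omega> (A x) = A (E \<Omega> x)"
proof (rule inner_eq_all)
  fix z
  note l = linear_diff[OF E_linear[OF \<Omega>]] and idem = E_mult[OF \<Omega> \<Omega>, simplified]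
  have 1: "inner (A (E \<Omega> x)) (z - E \<Omega> z) = 0" and 2: "inner (A (E \<Omega> z)) (x - E \<Omega> x) = 0"
    by (rule A_orthogonal[OF \<Omega>]; simp add: l idem)+
  have "inner (E \<Omega> (A x)) z = inner (A (E \<Omega> z)) x"
    using E_sym[OF \<Omega>, of "A x" z] sym_A[of "E \<Omega> z" x] by (simp add: inner_commute)
  also have "\<dots> = inner (A (E \<Omega> z)) (E \<Omega> x)" using 2 by (simp add: inner_diff_right)
  also have "\<dots> = inner (A (E \<Omega> x)) (E \<Omega> z)" using sym_A[of "E \<Omega> z" "E \<Omega> x"] by (simp add: inner_commute)
  also have "\<dots> = inner (A (E \<Omega> x)) z" using 1 by (simp add: inner_diff_right)
  finally show "inner (E \<Omega> (A x)) z = inner (A (E \<Omega> x)) z" .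
qed

lemma E_funpow_commute: "\<Omega> \<in> sets borel \<Longrightarrow> E \<Omega> ((A ^^ n) x) = (A ^^ n) (E \<Omega> x)"
  by (induction n) (auto simp: E_A_commute)

text \<open>The energy splits into that of E \<Omega> x and that of the remainder, and the latter is
  nonnegative.\<close>

lemma inner_A_E_le:
  assumes \<Omega>: "\<Omega> \<in> sets borel"
  shows "inner (A (E \<Omega> x)) (E \<Omega> x) \<le> inner (A x) x"
proof -
  note l = linear_diff[OF E_linear[OF \<Omega>]] and idem = E_mult[OF \<Omega> \<Omega>, simplified]
  define u v where "u = E \<Omega> x" and "v = x - E \<Omega> x"
  have x: "x = u + v" by (simp add: u_def v_def)
  have 1: "inner (A u) v = 0"
    by (rule A_orthogonal[OF \<Omega>]) (simp_all add: u_def v_def l idem)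
  then have "inner (A v) u = 0" using sym_A[of v u] by (simp add: inner_commute)
  then have "inner (A x) x = inner (A u) u + inner (A v) v"
    unfolding x using 1 by (simp add: linear_add[OF linear_A] inner_simps)
  then show ?thesis using pos_A[of v] by (simp add: u_def)
qed

text \<open>\<open>0 \<le> A \<le> s\<close> implies \<open>A\<^sup>2 \<le> s A\<close> because \<open>s (s A - A\<^sup>2) = A (s - A) A + (s - A) A (s - A)\<close>.\<close>

lemma norm_A_le_aux:
  assumes x: "E {..s} x = x" and s: "s > 0"
  shows "norm (A x) \<le> s * norm x"
proof -
  define z where "z = s *\<^sub>R x - A x"
  have Ax: "E {..s} (A x) = A x" by (simp add: E_A_commute x)
  have 1: "inner (A (A x)) (A x) \<le> s * inner (A x) (A x)"
    using A_le_on_range[OF Ax] by (simp add: power2_norm_eq_inner)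
  have "0 \<le> inner (A z) z" by (rule pos_A)
  also have "inner (A z) z = s * (s * inner (A x) x) - 2 * s * inner (A x) (A x) + inner (A (A x)) (A x)"
    unfolding z_def using sym_A[of "A x" x]
    by (simp add: linear_diff[OF linear_A] linear_scale[OF linear_A] inner_simps algebra_simps)
  finally have "s * inner (A x) (A x) \<le> s * (s * inner (A x) x)" using 1 by simp
  then have "inner (A x) (A x) \<le> s * inner (A x) x" using s by simp
  also have "\<dots> \<le> s * (s * (norm x)\<^sup>2)" using A_le_on_range[OF x] s by simp
  finally have "(norm (A x))\<^sup>2 \<le> (s * norm x)\<^sup>2"
    by (simp add: power2_norm_eq_inner[symmetric] power_mult_distrib power2_eq_square mult_ac)
  then show ?thesis using s by (simp add: abs_le_square_iff[symmetric] abs_mult)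
qed

text \<open>The preceding estimate divides by s. The value s = 0 is reached by enlarging s
  slightly.\<close>

lemma norm_A_le:
  assumes x: "E {..s} x = x" and s: "s \<ge> 0"
  shows "norm (A x) \<le> s * norm x"
proof (rule field_le_epsilon)
  fix e :: real assume e: "e > 0"
  \<comment> \<open>Chosen so that (r - s) |x| <= e, also for x = 0.\<close>
  define r where "r = s + e / (norm x + 1)"
  have r: "r > 0" "s \<le> r" using e s by (auto simp: r_def add_nonneg_pos)
  have "E {..r} x = x" using E_mult[of "{..r}" "{..s}" x] x r by (simp add: Int_absorb1)
  then have "norm (A x) \<le> r * norm x" by (rule norm_A_le_aux) (rule r)
  also have "\<dots> = s * norm x + e * (norm x / (norm x + 1))" by (simp add: r_def algebra_simps)
  also have "\<dots> \<le> s * norm x + e * 1"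
    using e by (intro add_left_mono mult_left_mono) (auto simp: divide_le_eq add_nonneg_pos)
  finally show "norm (A x) \<le> s * norm x + e" by simp
qed

text \<open>The range of \<open>E {..s}\<close> is described by \<open>A\<close> alone, so it is preserved by every
  isometry commuting with \<open>A\<close>; this replaces the uniqueness of the spectral measure.\<close>

lemma E_atMost_range_iff:
  assumes s: "s \<ge> 0"
  shows "E {..s} x = x \<longleftrightarrow> E UNIV x = x \<and> (\<forall>n. norm ((A ^^ n) x) \<le> s ^ n * norm x)"
proof (intro iffI conjI allI)
  assume x: "E {..s} x = x"
  then show "E UNIV x = x" by (rule E_UNIV_range[rotated]) simp
  fix n show "norm ((A ^^ n) x) \<le> s ^ n * norm x"
  proof (induction n)
    case (Suc n)
    have "E {..s} ((A ^^ n) x) = (A ^^ n) x" by (simp add: E_funpow_commute x)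
    then have "norm (A ((A ^^ n) x)) \<le> s * norm ((A ^^ n) x)" by (rule norm_A_le[OF _ s])
    also have "\<dots> \<le> s * (s ^ n * norm x)" using Suc s by (intro mult_left_mono) auto
    finally show ?case by (simp add: mult.assoc)
  qed simp
next
  assume "E UNIV x = x \<and> (\<forall>n. norm ((A ^^ n) x) \<le> s ^ n * norm x)"
  then have U: "E UNIV x = x" and n: "\<And>n. norm ((A ^^ n) x) \<le> s ^ n * norm x" by auto
  \<comment> \<open>Under A^n the component v above t grows at least like t^n, while x grows at most
    like s^n. Hence |v| <= (s/t)^n |x| for every n.\<close>
  have zero: "E {t<..} x = 0" if t: "t > s" for t
  proof -
    define v where "v = E {t<..} x"
    have v: "E {t<..} v = v" using E_mult[of "{t<..}" "{t<..}" x] by (simp add: v_def)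
    have low: "t ^ n * norm v \<le> norm ((A ^^ n) v)" for n
    proof (induction n)
      case (Suc n)
      define y where "y = (A ^^ n) v"
      have "E {t<..} y = y" by (simp add: y_def E_funpow_commute v)
      then have "t * (norm y)\<^sup>2 \<le> inner (A y) y" by (rule A_ge_on_range)
      also have "\<dots> \<le> norm (A y) * norm y" by (rule norm_cauchy_schwarz)
      finally have "norm y * (t * norm y) \<le> norm y * norm (A y)" by (simp add: power2_eq_square mult_ac)
      then have "t * norm y \<le> norm (A y)"
        by (cases "norm y = 0") (simp_all add: mult_le_cancel_left)
      moreover have "t * (t ^ n * norm v) \<le> t * norm y"
        using Suc t s by (intro mult_left_mono) (auto simp: y_def)
      ultimately show ?case by (simp add: y_def mult.assoc)
    qed simp
    have "norm v \<le> (s / t) ^ n * norm x" for n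
    proof -
      have "t ^ n * norm v \<le> norm ((A ^^ n) v)" by (rule low)
      also have "\<dots> = norm (E {t<..} ((A ^^ n) x))" by (simp add: v_def E_funpow_commute)
      also have "\<dots> \<le> norm ((A ^^ n) x)" by (rule E_contraction) simp
      also have "\<dots> \<le> s ^ n * norm x" by (rule n)
      finally show ?thesis using t s by (simp add: power_divide field_simps)
    qed
    moreover have "(\<lambda>n. (s / t) ^ n * norm x) \<longlonglongrightarrow> 0"
      using t s by (intro tendsto_mult_left_zero LIMSEQ_power_zero) simp
    ultimately have "norm v \<le> 0" by (intro LIMSEQ_le_const) auto
    then show ?thesis by (simp add: v_def)
  qed
  \<comment> \<open>The preceding argument requires t > s strictly; countably many such t exhaust
    the open half-line.\<close>
  have "emeasure (spectral_meas x) (\<Union>n::nat. {s + 1 / Suc n<..}) = 0"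
    by (rule emeasure_UN_eq_0) (auto simp: emeasure_spectral_meas zero)
  also have "(\<Union>n::nat. {s + 1 / Suc n<..}) = {s<..}"
  proof (intro equalityI subsetI)
    fix t assume "t \<in> {s<..}"
    then obtain n where "inverse (Suc n) < t - s" using reals_Archimedean[of "t - s"] by auto
    then have "t \<in> {s + 1 / Suc n<..}" by (simp add: inverse_eq_divide)
    then show "t \<in> (\<Union>n::nat. {s + 1 / Suc n<..})" by blast
  next
    fix t assume "t \<in> (\<Union>n::nat. {s + 1 / Suc n<..})"
    then obtain n :: nat where "s + 1 / Suc n < t" by auto
    moreover have "0 < 1 / real (Suc n)" by simp
    ultimately show "t \<in> {s<..}" by (simp only: greaterThan_iff)
  qed
  finally have "E {s<..} x = 0" by (simp add: emeasure_spectral_meas)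
  moreover have "E UNIV x = E {..s} x + E {s<..} x"
  proof -
    have "{..s} \<union> {s<..} = UNIV" "{..s} \<inter> {s<..} = {}" by auto
    then show ?thesis using E_Un[of "{..s}" "{s<..}" x] by simp
  qed
  ultimately show "E {..s} x = x" using U by simp
qed

text \<open>By the preceding characterization both U and its adjoint V map the range of E {..s} into
  itself. An orthogonal projection whose range is invariant under a map and its adjoint commutes
  with the map.\<close>

lemma E_atMost_isometry_commute:
  assumes iso: "\<And>x. norm (U x) = norm x" "\<And>x. norm (V x) = norm x"
    and adj: "\<And>x y. inner (U x) y = inner x (V y)"
    and comm: "\<And>x. A (U x) = U (A x)" "\<And>x. A (V x) = V (A x)"
    and univ: "\<And>x. E UNIV (U x) = U (E UNIV x)" "\<And>x. E UNIV (V x) = V (E UNIV x)"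
    and s: "s \<ge> 0"
  shows "E {..s} (U x) = U (E {..s} x)"
proof -
  have inv: "E {..s} (W (E {..s} x)) = W (E {..s} x)"
    if W: "\<And>x. norm (W x) = norm x" "\<And>x. A (W x) = W (A x)" "\<And>x. E UNIV (W x) = W (E UNIV x)" for W :: "'a \<Rightarrow> 'a" and x
  proof -
    have *: "(A ^^ n) (W y) = W ((A ^^ n) y)" for n y
      by (induction n) (auto simp: W(2))
    have "E {..s} (E {..s} x) = E {..s} x" using E_mult[of "{..s}" "{..s}" x] by simp
    then have "E UNIV (E {..s} x) = E {..s} x" "\<forall>n. norm ((A ^^ n) (E {..s} x)) \<le> s ^ n * norm (E {..s} x)"
      using E_atMost_range_iff[OF s, of "E {..s} x"] by auto
    then show ?thesis
      using E_atMost_range_iff[OF s, of "W (E {..s} x)"] by (simp add: W(1,3) *)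
  qed
  have b: "{..s} \<in> sets borel" by simp
  show ?thesis
  proof (rule inner_eq_all)
    fix y
    have "inner (E {..s} (U x)) y = inner x (V (E {..s} y))" by (simp only: E_sym[OF b] adj)
    also have "\<dots> = inner x (E {..s} (V (E {..s} y)))" by (simp only: inv[OF iso(2) comm(2) univ(2)])
    also have "\<dots> = inner (E {..s} x) (V (E {..s} y))" by (rule E_sym[OF b, symmetric])
    also have "\<dots> = inner (U (E {..s} x)) (E {..s} y)" by (rule adj[symmetric])
    also have "\<dots> = inner (E {..s} (U (E {..s} x))) y" by (rule E_sym[OF b, symmetric])
    also have "\<dots> = inner (U (E {..s} x)) y" by (simp only: inv[OF iso(1) comm(1) univ(1)])
    finally show "inner (E {..s} (U x)) y = inner (U (E {..s} x)) y" .
  qed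
qed

text \<open>Reduces the interval to half-lines, whose ranges are the ones characterized through
  A.\<close>

lemma E_interval: "0 \<le> s \<Longrightarrow> E {0<..s} x = E {..s} x - E {..0} x"
proof -
  assume "0 \<le> s"
  then have "{..0} \<union> {0<..s} = {..s}" by auto
  then show ?thesis using E_Un[of "{..0}" "{0<..s}" x] by (auto simp: disjoint_iff)
qed

end

section \<open>The Sobolev inequality for a growth bound\<close>

text \<open>The quantifier over m is in the conclusion because the induction on the largest element
  b uses the bound at m = b - 1, where it reads 2^b.\<close>

lemma dyadic_sum_le:
  fixes N :: "int set"
  assumes "finite N"
  shows "\<forall>m. (\<forall>n\<in>N. n \<le> m) \<longrightarrow> (\<Sum>n\<in>N. 2 powr real_of_int n) \<le> 2 * 2 powr real_of_int m"
  using assms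
proof (induction rule: finite_linorder_max_induct)
  case empty
  then show ?case by simp
next
  case (insert b N)
  have "(\<Sum>n\<in>N. 2 powr real_of_int n) \<le> 2 * 2 powr real_of_int (b - 1)"
    by (rule insert.IH[rule_format]) (use insert.hyps in fastforce)
  also have "2 * 2 powr real_of_int (b - 1) = 2 powr real_of_int b"
    by (simp add: powr_diff)
  finally have "(\<Sum>n\<in>insert b N. 2 powr real_of_int n) \<le> 2 * 2 powr real_of_int b"
    using insert by (subst sum.insert) auto
  also have "\<dots> \<le> 2 * 2 powr real_of_int m" if "\<forall>n\<in>insert b N. n \<le> m" for m
    using that by simp
  finally show ?case by blast
qed

text \<open>A discrete layer-cake formula: it compares sums over dyadic energy levels with the
  integral of t.\<close>

lemma dyadic_indicator_sum_le:
  fixes N :: "int set"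
  assumes N: "finite N" and t: "t \<ge> 0"
  shows "(\<Sum>n\<in>N. 2 powr real_of_int n * indicator {2 powr real_of_int n<..} t) \<le> 2 * t"
proof -
  define M where "M = {n \<in> N. 2 powr real_of_int n < t}"
  have M: "finite M" using N by (simp add: M_def)
  have "(\<Sum>n\<in>N. 2 powr real_of_int n * indicator {2 powr real_of_int n<..} t) = (\<Sum>n\<in>M. 2 powr real_of_int n)"
    using N by (intro sum.mono_neutral_cong_right) (auto simp: M_def)
  also have "\<dots> \<le> 2 * t"
  proof (cases "M = {}")
    case False
    then have "Max M \<in> M" using M by simp
    then have "2 powr real_of_int (Max M) < t" by (simp add: M_def)
    moreover have "(\<Sum>n\<in>M. 2 powr real_of_int n) \<le> 2 * 2 powr real_of_int (Max M)"
      using dyadic_sum_le[OF M] M by simp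
    ultimately show ?thesis by linarith
  qed (use t in simp)
  finally show ?thesis .
qed

lemma interval_dyadic_decomposition:
  fixes s :: real
  assumes "s > 0"
  shows "(\<Union>n::nat. {s / 2 ^ Suc n<..s / 2 ^ n}) = {0<..s}"
    and "disjoint_family (\<lambda>n::nat. {s / 2 ^ Suc n<..s / 2 ^ n})"
proof -
  have dec: "s / 2 ^ n \<le> s / 2 ^ m" if "m \<le> n" for m n :: nat
    using assms that by (intro divide_left_mono power_increasing) auto
  show "(\<Union>n::nat. {s / 2 ^ Suc n<..s / 2 ^ n}) = {0<..s}"
  proof (intro equalityI subsetI)
    fix t assume "t \<in> (\<Union>n::nat. {s / 2 ^ Suc n<..s / 2 ^ n})"
    then obtain n where "s / 2 ^ Suc n < t" "t \<le> s / 2 ^ n" by auto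
    moreover have "0 < s / 2 ^ Suc n" "s / 2 ^ n \<le> s" using assms dec[of 0 n] by auto
    ultimately show "t \<in> {0<..s}" by (auto simp del: power_Suc)
  next
    fix t assume t: "t \<in> {0<..s}"
    have "(\<lambda>n. s * (1 / 2) ^ n) \<longlonglongrightarrow> 0"
      by (intro tendsto_mult_right_zero LIMSEQ_power_zero) simp
    then have "\<forall>\<^sub>F n in sequentially. s * (1 / 2) ^ n < t" using t by (intro order_tendstoD(2)) auto
    then obtain m where m: "s / 2 ^ m < t"
      by (auto simp: eventually_sequentially power_one_over)
    \<comment> \<open>The shell containing t ends just above the first dyadic point that is below
      t.\<close>
    define n where "n = (LEAST n. s / 2 ^ n < t)"
    have n: "s / 2 ^ n < t" unfolding n_def by (rule LeastI[of _ m]) (rule m)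
    have "n \<noteq> 0" using n t by (intro notI) auto
    then obtain k where k: "n = Suc k" by (cases n) auto
    have "\<not> s / 2 ^ k < t" using not_less_Least[of k "\<lambda>n. s / 2 ^ n < t"] k by (simp add: n_def)
    then have "t \<in> {s / 2 ^ Suc k<..s / 2 ^ k}" using n k by simp
    then show "t \<in> (\<Union>n::nat. {s / 2 ^ Suc n<..s / 2 ^ n})" by blast
  qed
  show "disjoint_family (\<lambda>n::nat. {s / 2 ^ Suc n<..s / 2 ^ n})"
    unfolding disjoint_family_on_def
  proof (intro ballI impI)
    fix m n :: nat assume "m \<noteq> n"
    then consider "Suc m \<le> n" | "Suc n \<le> m" by linarith
    then show "{s / 2 ^ Suc m<..s / 2 ^ m} \<inter> {s / 2 ^ Suc n<..s / 2 ^ n} = {}"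
    proof cases
      case 1
      from dec[OF 1] show ?thesis by (auto simp del: power_Suc)
    next
      case 2
      from dec[OF 2] show ?thesis by (auto simp del: power_Suc)
    qed
  qed
qed

locale spectral_growth = spectral_resolution A E
  for A :: "'i l2 \<Rightarrow> 'i l2" and E +
  fixes \<alpha> D :: real
  assumes alpha: "\<alpha> > 2" and D_nonneg: "D \<ge> 0"
    and growth: "s > 0 \<Longrightarrow> (norm (E {0<..s} (l2_basis i)))\<^sup>2 \<le> D * s powr (\<alpha> / 2)"
begin

definition "\<gamma> = (\<alpha> - 2) / 4"

lemma gamma_pos: "\<gamma> > 0"
  using alpha by (simp add: \<gamma>_def)

text \<open>E of the shell may be applied to both sides of the inner product. On the shell A >= r/2,
  which bounds the part of \<beta> by its energy, while \<open>growth\<close> bounds the part of the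
  unit vector. The powers of r combine to \<alpha>/4 - 1/2 = \<gamma>.\<close>

lemma coordinate_dyadic_bound:
  assumes r: "r > 0"
  shows "\<bar>inner (E {r / 2<..r} \<beta>) (l2_basis i)\<bar> \<le> sqrt (2 * D) * sqrt (inner (A \<beta>) \<beta>) * r powr \<gamma>"
proof -
  let ?I = "{r / 2<..r}"
  define u where "u = E ?I \<beta>"
  define v where "v = E ?I (l2_basis i)"
  have "E {r / 2<..} u = u"
    using E_mult[of "{r / 2<..}" ?I \<beta>] by (simp add: u_def Int_absorb1 greaterThanAtMost_def)
  then have "r / 2 * (norm u)\<^sup>2 \<le> inner (A u) u" by (rule A_ge_on_range)
  also have "\<dots> \<le> inner (A \<beta>) \<beta>" unfolding u_def by (rule inner_A_E_le) simp
  finally have "(norm u)\<^sup>2 \<le> 2 / r * inner (A \<beta>) \<beta>" using r by (simp add: field_simps)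
  then have u: "norm u \<le> sqrt (2 / r * inner (A \<beta>) \<beta>)" by (rule real_le_rsqrt)
  have "norm v \<le> norm (E {0<..r} (l2_basis i))"
    unfolding v_def by (rule E_mono) (use r in auto)
  then have "(norm v)\<^sup>2 \<le> (norm (E {0<..r} (l2_basis i)))\<^sup>2" by (intro power_mono) auto
  also have "\<dots> \<le> D * r powr (\<alpha> / 2)" by (rule growth[OF r])
  finally have v: "norm v \<le> sqrt (D * r powr (\<alpha> / 2))" by (rule real_le_rsqrt)
  have "inner u (l2_basis i) = inner u v"
    using E_mult[of ?I ?I \<beta>] E_sym[of ?I u "l2_basis i"] by (simp add: u_def v_def)
  then have "\<bar>inner u (l2_basis i)\<bar> \<le> norm u * norm v"
    using Cauchy_Schwarz_ineq2[of u v] by simp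
  also have "\<dots> \<le> sqrt (2 / r * inner (A \<beta>) \<beta>) * sqrt (D * r powr (\<alpha> / 2))"
    using u v r pos_A[of \<beta>] by (intro mult_mono) auto
  also have "\<dots> = sqrt (2 * D) * sqrt (inner (A \<beta>) \<beta>) * sqrt (r powr (\<alpha> / 2) / r)"
    by (simp add: real_sqrt_mult real_sqrt_divide)
  also have "sqrt (r powr (\<alpha> / 2) / r) = r powr \<gamma>"
  proof -
    have "r powr (\<alpha> / 2) / r = r powr (\<alpha> / 2 - 1)" using r by (simp add: powr_diff)
    also have "\<dots> = (r powr \<gamma>)\<^sup>2"
    proof -
      have "\<alpha> / 2 - 1 = \<gamma> + \<gamma>" by (simp add: \<gamma>_def field_simps)
      then show ?thesis by (simp only: powr_add power2_eq_square)
    qed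
    finally show ?thesis by simp
  qed
  finally show ?thesis by (simp add: u_def)
qed

text \<open>The dyadic bounds at s / 2^n form a geometric series of ratio 2^(-\<gamma>); the factor
  multiplying the root of the energy and s^\<gamma> in its sum is this constant.\<close>

definition "pointwise_const = sqrt (2 * D) / (1 - 2 powr (- \<gamma>))"

lemma pointwise_const_nonneg: "pointwise_const \<ge> 0"
  unfolding pointwise_const_def using gamma_pos D_nonneg
  by (intro divide_nonneg_pos) (auto simp: powr_less_one)

lemma coordinate_low_energy_bound:
  assumes s: "s > 0"
  shows "\<bar>l2_nth (E {0<..s} \<beta>) i\<bar> \<le> pointwise_const * sqrt (inner (A \<beta>) \<beta>) * s powr \<gamma>"
proof -
  let ?I = "\<lambda>n::nat. {s / 2 ^ Suc n<..s / 2 ^ n}"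
  let ?c = "sqrt (2 * D) * sqrt (inner (A \<beta>) \<beta>) * s powr \<gamma>"
  define q where "q = (2::real) powr (- \<gamma>)"
  have q: "0 < q" "q < 1" using gamma_pos by (auto simp: q_def powr_less_one)
  have "(\<lambda>n. inner (E (?I n) \<beta>) (l2_basis i)) sums inner (E {0<..s} \<beta>) (l2_basis i)"
  proof -
    have "range ?I \<subseteq> sets borel" by auto
    from E_sums[OF this interval_dyadic_decomposition(2)[OF s], of \<beta> "l2_basis i"]
    show ?thesis unfolding interval_dyadic_decomposition(1)[OF s] .
  qed
  moreover have "(\<lambda>n. ?c * q ^ n) sums (?c * (1 / (1 - q)))"
    using q by (intro sums_mult geometric_sums) auto
  moreover have "norm (inner (E (?I n) \<beta>) (l2_basis i)) \<le> ?c * q ^ n" for n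
  proof -
    have "\<bar>inner (E (?I n) \<beta>) (l2_basis i)\<bar> \<le> sqrt (2 * D) * sqrt (inner (A \<beta>) \<beta>) * (s / 2 ^ n) powr \<gamma>"
      using coordinate_dyadic_bound[of "s / 2 ^ n" \<beta> i] s by (simp add: mult.commute)
    also have "(s / 2 ^ n) powr \<gamma> = s powr \<gamma> * q ^ n"
    proof -
      have "(s / 2 ^ n) powr \<gamma> = s powr \<gamma> / (2 powr real n) powr \<gamma>"
        using s by (simp add: powr_divide powr_realpow)
      also have "\<dots> = s powr \<gamma> * 2 powr (- \<gamma> * real n)"
        by (simp add: powr_powr powr_minus divide_inverse mult.commute)
      also have "2 powr (- \<gamma> * real n) = q ^ n"
        using q by (simp add: q_def powr_powr flip: powr_realpow)
      finally show ?thesis .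
    qed
    finally show ?thesis by (simp add: mult.assoc)
  qed
  ultimately have "norm (inner (E {0<..s} \<beta>) (l2_basis i)) \<le> ?c * (1 / (1 - q))"
    using norm_sums_le by blast
  then show ?thesis
    by (simp add: inner_l2_basis pointwise_const_def q_def mult_ac)
qed

text \<open>Marcinkiewicz-type splitting: at a coordinate where \<open>\<beta>\<close> has size \<open>2 c r\<^sup>\<gamma>\<close>, at most half
  of \<open>\<beta>\<close> comes from energies below \<open>r\<close>. Rounding \<open>r\<close> to a power of \<open>2\<close> leaves finite sums only.\<close>

lemma sum_powr_le_aux:
  assumes univ: "E UNIV \<beta> = \<beta>" and low: "E {..0} \<beta> = 0" and F: "finite F"
    and c: "c > 0" "c \<ge> pointwise_const * sqrt (inner (A \<beta>) \<beta>)"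
  shows "(\<Sum>i\<in>F. \<bar>l2_nth \<beta> i\<bar> powr (2 + 1 / \<gamma>)) \<le> 16 * (2 * c) powr (1 / \<gamma>) * inner (A \<beta>) \<beta>"
proof -
  define b where "b i = \<bar>l2_nth \<beta> i\<bar>" for i
  \<comment> \<open>The solution of 2 c s^\<gamma> = b i: up to this energy the low part is at most
    half of \<beta> at i.\<close>
  define s where "s i = (b i / (2 * c)) powr (1 / \<gamma>)" for i
  define n where "n i = \<lfloor>log 2 (s i)\<rfloor>" for i
  define h where "h m i = (l2_nth (E {2 powr real_of_int m<..} \<beta>) i)\<^sup>2" for m :: int and i
  \<comment> \<open>Where \<beta> vanishes, s i is 0 and the logarithm carries no
    information.\<close>
  define F' where "F' = {i \<in> F. b i \<noteq> 0}"
  have F': "finite F'" using F by (simp add: F'_def)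
  \<comment> \<open>The factor 8 is 4, from squaring a half, times 2, from the rounding s i < 2
    r.\<close>
  have coord: "b i powr (2 + 1 / \<gamma>) \<le> 8 * (2 * c) powr (1 / \<gamma>) * (2 powr n i * h (n i) i)" if "i \<in> F'" for i
  proof -
    define r where "r = (2::real) powr n i"
    have bi: "b i > 0" using that by (auto simp: F'_def b_def)
    have si: "s i > 0" using bi c by (simp add: s_def)
    have r: "r > 0" "r \<le> s i" "s i < 2 * r"
    proof -
      show "r > 0" by (simp add: r_def)
      have "r \<le> 2 powr log 2 (s i)" unfolding r_def n_def by (intro powr_mono) auto
      then show "r \<le> s i" using si by simp
      have "2 powr log 2 (s i) < 2 powr (n i + 1)" unfolding n_def by (intro powr_less_mono) auto
      then show "s i < 2 * r" using si by (simp add: r_def powr_add)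
    qed
    have split: "\<beta> = E {0<..r} \<beta> + E {r<..} \<beta>"
    proof -
      have 1: "{..0} \<union> {0<..r} = {..r}" "{..0} \<inter> {0<..r} = {}" "{..r} \<union> {r<..} = UNIV" "{..r} \<inter> {r<..} = {}"
        using r by auto
      have "\<beta> = E ({..r} \<union> {r<..}) \<beta>" using univ 1 by simp
      also have "\<dots> = E {..r} \<beta> + E {r<..} \<beta>" using 1 by (intro E_Un) auto
      also have "E {..r} \<beta> = E ({..0} \<union> {0<..r}) \<beta>" using 1 by simp
      also have "\<dots> = E {..0} \<beta> + E {0<..r} \<beta>" using 1 by (intro E_Un) auto
      finally show ?thesis using low by simp
    qed
    have "\<bar>l2_nth (E {0<..r} \<beta>) i\<bar> \<le> pointwise_const * sqrt (inner (A \<beta>) \<beta>) * r powr \<gamma>"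
      by (rule coordinate_low_energy_bound) (rule r)
    also have "\<dots> \<le> c * s i powr \<gamma>"
      using c r gamma_pos by (intro mult_mono powr_mono2) auto
    also have "s i powr \<gamma> = b i / (2 * c)"
      using gamma_pos bi c by (simp add: s_def powr_powr)
    finally have "\<bar>l2_nth (E {0<..r} \<beta>) i\<bar> \<le> b i / 2" using c by simp
    moreover have "l2_nth \<beta> i = l2_nth (E {0<..r} \<beta>) i + l2_nth (E {r<..} \<beta>) i"
      using split by (metis l2_nth_add)
    ultimately have "b i / 2 \<le> \<bar>l2_nth (E {r<..} \<beta>) i\<bar>" unfolding b_def by linarith
    then have "(b i / 2)\<^sup>2 \<le> \<bar>l2_nth (E {r<..} \<beta>) i\<bar>\<^sup>2" using bi by (intro power_mono) auto
    then have sq: "(b i)\<^sup>2 \<le> 4 * h (n i) i" by (simp add: h_def r_def power_divide)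
    have "b i powr (2 + 1 / \<gamma>) = (b i)\<^sup>2 * b i powr (1 / \<gamma>)"
      using bi by (simp add: powr_add)
    also have "b i powr (1 / \<gamma>) = (2 * c) powr (1 / \<gamma>) * s i"
      using bi c by (simp add: s_def powr_divide)
    also have "(b i)\<^sup>2 * ((2 * c) powr (1 / \<gamma>) * s i) \<le> (4 * h (n i) i) * ((2 * c) powr (1 / \<gamma>) * (2 * r))"
      using sq r by (intro mult_mono mult_left_mono) (auto simp: h_def)
    finally show ?thesis by (simp add: r_def mult_ac)
  qed
  \<comment> \<open>Coordinate i contributes at its own level n i only. Admitting every level for
    every coordinate allows the sums to be exchanged; the inner sum is then at most the spectral
    measure of a half-line. The factor 2 is the one of the dyadic sum and turns 8 into 16.\<close>
  have energy: "(\<Sum>i\<in>F'. 2 powr n i * h (n i) i) \<le> 2 * inner (A \<beta>) \<beta>"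
  proof -
    interpret finite_measure "spectral_meas \<beta>" by (rule finite_measure_spectral_meas)
    let ?N = "n ` F'"
    have ind: "integrable (spectral_meas \<beta>) (indicat_real {x<..})" for x
      by (rule integrable_real_indicator) (auto simp: emeasure_spectral_meas)
    have "(\<Sum>i\<in>F'. 2 powr n i * h (n i) i) \<le> (\<Sum>i\<in>F'. \<Sum>m\<in>?N. 2 powr m * h m i)"
      using F' by (intro sum_mono member_le_sum[where f = "\<lambda>m. 2 powr real_of_int m * h m _"]) (auto simp: h_def)
    also have "\<dots> = (\<Sum>m\<in>?N. 2 powr m * (\<Sum>i\<in>F'. h m i))"
      by (subst sum.swap) (simp add: sum_distrib_left)
    also have "\<dots> \<le> (\<Sum>m\<in>?N. 2 powr m * measure (spectral_meas \<beta>) {2 powr real_of_int m<..})"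
      using F' by (intro sum_mono mult_left_mono)
        (auto simp: h_def measure_spectral_meas intro: sum_squares_le_norm_l2)
    also have "\<dots> = (\<integral>t. (\<Sum>m\<in>?N. 2 powr m * indicator {2 powr real_of_int m<..} t) \<partial>spectral_meas \<beta>)"
      by (subst Bochner_Integration.integral_sum) (auto simp: ind)
    also have "\<dots> \<le> (\<integral>t. 2 * t \<partial>spectral_meas \<beta>)"
    proof (rule integral_mono_AE)
      have "AE t in spectral_meas \<beta>. t \<in> {0<..}"
        by (rule AE_spectral_meas) (use low in \<open>auto simp: Compl_greaterThan\<close>)
      then show "AE t in spectral_meas \<beta>. (\<Sum>m\<in>?N. 2 powr real_of_int m * indicator {2 powr real_of_int m<..} t) \<le> 2 * t"
      proof (rule eventually_mono)
        fix t :: real assume "t \<in> {0<..}"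
        then have "0 \<le> t" by simp
        then show "(\<Sum>m\<in>?N. 2 powr real_of_int m * indicator {2 powr real_of_int m<..} t) \<le> 2 * t"
          using F' by (intro dyadic_indicator_sum_le finite_imageI)
      qed
    qed (auto simp: integrable_spectral_meas ind)
    also have "\<dots> = 2 * inner (A \<beta>) \<beta>" by (simp add: integral_spectral_meas)
    finally show ?thesis .
  qed
  have "(\<Sum>i\<in>F. b i powr (2 + 1 / \<gamma>)) = (\<Sum>i\<in>F'. b i powr (2 + 1 / \<gamma>))"
    using F by (intro sum.mono_neutral_right) (auto simp: F'_def)
  also have "\<dots> \<le> (\<Sum>i\<in>F'. 8 * (2 * c) powr (1 / \<gamma>) * (2 powr n i * h (n i) i))"
    by (intro sum_mono coord)
  also have "\<dots> = 8 * (2 * c) powr (1 / \<gamma>) * (\<Sum>i\<in>F'. 2 powr n i * h (n i) i)"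
    by (simp add: sum_distrib_left)
  also have "\<dots> \<le> 8 * (2 * c) powr (1 / \<gamma>) * (2 * inner (A \<beta>) \<beta>)"
    by (intro mult_left_mono energy) simp
  finally show ?thesis by (simp add: b_def mult_ac)
qed

text \<open>Comes from c = (\<open>pointwise_const\<close> + 1) times the root of the energy; the
  added 1 keeps c positive when D = 0.\<close>

definition "sobolev_const = 16 * (2 * (pointwise_const + 1)) powr (1 / \<gamma>)"

lemma sum_powr_le:
  assumes univ: "E UNIV \<beta> = \<beta>" and low: "E {..0} \<beta> = 0" and F: "finite F"
  shows "(\<Sum>i\<in>F. \<bar>l2_nth \<beta> i\<bar> powr (2 + 1 / \<gamma>)) \<le> sobolev_const * sqrt (inner (A \<beta>) \<beta>) powr (2 + 1 / \<gamma>)"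
proof (cases "inner (A \<beta>) \<beta> = 0")
  case True
  \<comment> \<open>For zero energy that c would be 0. Here c = 1 is admissible, and the bound is 0
    as well.\<close>
  then show ?thesis
    using sum_powr_le_aux[OF univ low F, of 1] by simp
next
  case False
  define a where "a = sqrt (inner (A \<beta>) \<beta>)"
  have a: "a > 0" "inner (A \<beta>) \<beta> = a\<^sup>2" using False pos_A[of \<beta>] by (auto simp: a_def)
  have "(\<Sum>i\<in>F. \<bar>l2_nth \<beta> i\<bar> powr (2 + 1 / \<gamma>)) \<le> 16 * (2 * ((pointwise_const + 1) * a)) powr (1 / \<gamma>) * inner (A \<beta>) \<beta>"
    by (rule sum_powr_le_aux[OF univ low F])
      (use a pointwise_const_nonneg in \<open>auto simp: a_def[symmetric] intro!: mult_pos_pos mult_right_mono\<close>)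
  also have "\<dots> = sobolev_const * (a powr (1 / \<gamma>) * a\<^sup>2)"
    using a pointwise_const_nonneg
    by (simp add: sobolev_const_def powr_mult mult.assoc flip: mult.assoc[of 2])
  also have "a powr (1 / \<gamma>) * a\<^sup>2 = a powr (2 + 1 / \<gamma>)"
    using a by (simp add: powr_add)
  finally show ?thesis by (simp add: a_def)
qed

end

section \<open>Operators between spaces of square summable functions\<close>

text \<open>Keeps the exponent 2 a numeral, so that rules about \<open>lp_space 2\<close> and
  \<open>lp_norm 2\<close> still match.\<close>

declare numeral_eq_ereal [simp del]

lemma real_of_ereal_numeral_2: "real_of_ereal 2 = 2"
  by (metis numeral_eq_ereal real_of_ereal.simps(1))

lemma infinity_neq_2: "\<infinity> \<noteq> (2 :: ereal)" "(2 :: ereal) \<noteq> \<infinity>"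
  by (simp_all add: numeral_eq_ereal)

lemma l2_space_iff:
  "f \<in> l2_space S \<longleftrightarrow> (\<forall>i. i \<notin> S \<longrightarrow> f i = 0) \<and> (\<lambda>i. (f i)\<^sup>2) summable_on UNIV"
  by (simp add: lp_space_def real_of_ereal_numeral_2 infinity_neq_2)

lemma lp_norm_2: "lp_norm 2 f = sqrt (\<Sum>\<^sub>\<infinity>i. (f i)\<^sup>2)"
  by (simp add: lp_norm_def real_of_ereal_numeral_2 infinity_neq_2 powr_half_sqrt infsum_nonneg)

lemma lp_norm_l2_nth: "lp_norm 2 (l2_nth x) = norm x"
  by (simp add: lp_norm_2 flip: norm_l2_square)

lemma l2_inner_l2_nth: "l2_inner (l2_nth x) (l2_nth y) = inner x y"
  by (simp add: l2_inner_def inner_l2_def)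

definition l2_supp :: "'i set \<Rightarrow> 'i l2 set" where
  "l2_supp S = {x. \<forall>i. i \<notin> S \<longrightarrow> l2_nth x i = 0}"

lemma l2_nth_in_l2_space_iff: "l2_nth x \<in> l2_space S \<longleftrightarrow> x \<in> l2_supp S"
  by (simp add: l2_space_iff l2_supp_def summable_l2_nth)

lemma l2_space_cases:
  assumes "f \<in> l2_space S" obtains x where "f = l2_nth x" "x \<in> l2_supp S"
proof (rule that)
  show 1: "f = l2_nth (Abs_l2 f)" using assms by (simp add: l2_space_iff l2_nth_Abs)
  show "Abs_l2 f \<in> l2_supp S" using assms 1 l2_nth_in_l2_space_iff by metis
qed

lemma Abs_l2_nth: "Abs_l2 (l2_nth x) = x"
  by (rule l2_nth_inverse)

lemma subspace_l2_supp: "subspace (l2_supp S)"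
  by (auto simp: subspace_def l2_supp_def)

lemma tendsto_l2_nth:
  assumes "X \<longlonglongrightarrow> x" shows "(\<lambda>n. l2_nth (X n) i) \<longlonglongrightarrow> l2_nth x i"
  using tendsto_inner[OF assms tendsto_const[of "l2_basis i"]] by (simp add: inner_l2_basis)

lemma closed_l2_supp: "closed (l2_supp S)"
  unfolding closed_sequential_limits
proof (intro allI impI)
  fix X x assume X: "(\<forall>n. X n \<in> l2_supp S) \<and> X \<longlonglongrightarrow> x"
  have "l2_nth x i = 0" if "i \<notin> S" for i
  proof -
    have "(\<lambda>n. l2_nth (X n) i) = (\<lambda>n. 0)" using X that by (auto simp: l2_supp_def)
    then show ?thesis using tendsto_l2_nth[of X x i] X by (simp add: LIMSEQ_const_iff)
  qed
  then show "x \<in> l2_supp S" by (simp add: l2_supp_def)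
qed

text \<open>The orthogonal projection onto \<open>l2_supp S\<close>. It will be the value of E UNIV
  and extends operators on S to the whole type.\<close>

definition l2_cut :: "'i set \<Rightarrow> 'i l2 \<Rightarrow> 'i l2" where
  "l2_cut S x = Abs_l2 (\<lambda>i. if i \<in> S then l2_nth x i else 0)"

lemma l2_nth_cut: "l2_nth (l2_cut S x) i = (if i \<in> S then l2_nth x i else 0)"
proof -
  have "(\<lambda>i. (if i \<in> S then l2_nth x i else 0)\<^sup>2) summable_on UNIV"
  proof (rule square_summable_of_bounded(1))
    fix F :: "'a set" assume F: "finite F"
    have "(\<Sum>i\<in>F. (if i \<in> S then l2_nth x i else 0)\<^sup>2) \<le> (\<Sum>i\<in>F. (l2_nth x i)\<^sup>2)"
      by (intro sum_mono) simp
    also have "\<dots> \<le> (norm x)\<^sup>2" by (rule sum_squares_le_norm_l2[OF F])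
    finally show "(\<Sum>i\<in>F. (if i \<in> S then l2_nth x i else 0)\<^sup>2) \<le> (norm x)\<^sup>2" .
  qed
  then show ?thesis by (simp add: l2_cut_def l2_nth_Abs)
qed

lemma l2_cut_in_supp [simp]: "l2_cut S x \<in> l2_supp S"
  by (simp add: l2_supp_def l2_nth_cut)

lemma l2_cut_eq: "x \<in> l2_supp S \<Longrightarrow> l2_cut S x = x"
  by (intro l2_eqI) (auto simp: l2_nth_cut l2_supp_def)

lemma inner_l2_cut: "x \<in> l2_supp S \<Longrightarrow> inner x (l2_cut S y) = inner x y"
  unfolding inner_l2_def by (rule infsum_cong) (auto simp: l2_nth_cut l2_supp_def)

lemma inner_l2_cut_left: "x \<in> l2_supp S \<Longrightarrow> inner (l2_cut S y) x = inner y x"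
  using inner_l2_cut[of x S y] by (simp add: inner_commute)

text \<open>Single-element sums give |f i| <= B, and then |f i|^r = |f i|^q |f i|^(r-q) is at most
  |f i|^q B^(r-q). The hypothesis speaks of finite sums, so that summability is a
  conclusion.\<close>

lemma lp_from_smaller_exponent:
  fixes f :: "'i \<Rightarrow> real" and p :: ereal
  assumes q: "q > 0" "ereal q \<le> p" and B: "B \<ge> 0"
    and f: "\<And>F. finite F \<Longrightarrow> (\<Sum>i\<in>F. \<bar>f i\<bar> powr q) \<le> B powr q"
  shows "lp_norm p f \<le> B" and "(\<And>i. i \<notin> S \<Longrightarrow> f i = 0) \<Longrightarrow> f \<in> lp_space p S"
proof -
  have fB: "\<bar>f i\<bar> \<le> B" for i
  proof (rule ccontr)
    assume "\<not> \<bar>f i\<bar> \<le> B"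
    then have "B powr q < \<bar>f i\<bar> powr q" using q B by (intro powr_less_mono2) auto
    then show False using f[of "{i}"] by simp
  qed
  have "lp_norm p f \<le> B \<and> ((\<forall>i. i \<notin> S \<longrightarrow> f i = 0) \<longrightarrow> f \<in> lp_space p S)"
  proof (cases "p = \<infinity>")
    case True
    have "bdd_above (range (\<lambda>i. \<bar>f i\<bar>))" using fB by (auto intro!: bdd_aboveI[of _ B])
    moreover have "(SUP i. \<bar>f i\<bar>) \<le> B" using fB by (intro cSUP_least) auto
    ultimately show ?thesis by (simp add: True lp_norm_def lp_space_def)
  next
    case False
    then obtain r where r: "p = ereal r" "q \<le> r" using q by (cases p) auto
    have sums: "(\<Sum>i\<in>F. \<bar>f i\<bar> powr r) \<le> B powr r" if F: "finite F" for F
    proof -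
      have "(\<Sum>i\<in>F. \<bar>f i\<bar> powr r) \<le> (\<Sum>i\<in>F. \<bar>f i\<bar> powr q * B powr (r - q))"
      proof (rule sum_mono)
        fix i
        have "\<bar>f i\<bar> powr r = \<bar>f i\<bar> powr q * \<bar>f i\<bar> powr (r - q)" by (simp flip: powr_add)
        also have "\<dots> \<le> \<bar>f i\<bar> powr q * B powr (r - q)"
          using fB[of i] r by (intro mult_left_mono powr_mono2) auto
        finally show "\<bar>f i\<bar> powr r \<le> \<bar>f i\<bar> powr q * B powr (r - q)" .
      qed
      also have "\<dots> = (\<Sum>i\<in>F. \<bar>f i\<bar> powr q) * B powr (r - q)" by (simp add: sum_distrib_right)
      also have "\<dots> \<le> B powr q * B powr (r - q)" by (intro mult_right_mono f F) simp
      also have "\<dots> = B powr r" by (simp flip: powr_add)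
      finally show ?thesis .
    qed
    have s: "(\<lambda>i. \<bar>f i\<bar> powr r) summable_on UNIV"
      by (rule nonneg_bdd_above_summable_on) (use sums in \<open>auto intro!: bdd_aboveI[of _ "B powr r"]\<close>)
    have "(\<Sum>\<^sub>\<infinity>i. \<bar>f i\<bar> powr r) \<le> B powr r"
      by (rule infsum_le_finite_sums[OF s]) (use sums in auto)
    then have "(\<Sum>\<^sub>\<infinity>i. \<bar>f i\<bar> powr r) powr (1 / r) \<le> (B powr r) powr (1 / r)"
      using q r by (intro powr_mono2) (auto intro: infsum_nonneg)
    also have "\<dots> = B" using q r B by (simp add: powr_powr)
    finally show ?thesis using s r by (simp add: lp_norm_def lp_space_def)
  qed
  then show "lp_norm p f \<le> B" and "(\<And>i. i \<notin> S \<Longrightarrow> f i = 0) \<Longrightarrow> f \<in> lp_space p S" by auto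
qed

lemma is_spectral_measure_projection:
  assumes "is_spectral_measure S L P" "\<Omega> \<in> sets borel" "x \<in> l2_supp S"
  obtains y where "P \<Omega> (l2_nth x) = l2_nth y" "y \<in> l2_supp S"
proof -
  have "P \<Omega> \<in> l2_space S \<rightarrow> l2_space S"
    using assms(1,2) by (simp add: is_spectral_measure_def is_l2_projection_def)
  then have "P \<Omega> (l2_nth x) \<in> l2_space S" using assms(3) l2_nth_in_l2_space_iff by blast
  then show ?thesis using l2_space_cases that by metis
qed

text \<open>Evaluates the definite description behind \<open>vN_dim\<close> on the range of a
  spectral projection, so that the \<Gamma>-dimension becomes the trace of that projection.\<close>

lemma l2_projection_onto_range:
  assumes P: "is_l2_projection S P" and x: "x \<in> l2_space S"
  shows "l2_projection_onto S (P ` l2_space S) x = P x"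
  unfolding l2_projection_onto_def
proof (rule the_equality)
  have mem: "P f \<in> l2_space S" if "f \<in> l2_space S" for f
    using P that by (auto simp: is_l2_projection_def)
  have diff: "(\<lambda>i. f i - g i) \<in> l2_space S" if fg: "f \<in> l2_space S" "g \<in> l2_space S" for f g
  proof -
    obtain a b where "f = l2_nth a" "a \<in> l2_supp S" "g = l2_nth b" "b \<in> l2_supp S"
      using fg by (metis l2_space_cases)
    moreover from this have "a - b \<in> l2_supp S" by (intro subspace_diff subspace_l2_supp)
    ultimately show ?thesis
      using l2_nth_in_l2_space_iff[of "a - b" S] by (simp add: l2_nth_diff[abs_def])
  qed
  have ortho: "l2_inner (\<lambda>i. x i - P x i) (P f) = 0" if f: "f \<in> l2_space S" for f
  proof -
    have "P (\<lambda>i. 1 * x i + (-1) * P x i) = (\<lambda>i. 1 * P x i + (-1) * P (P x) i)"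
      using P x mem[OF x] unfolding is_l2_projection_def by blast
    then have "P (\<lambda>i. x i - P x i) = (\<lambda>i. 0)"
      using P x by (simp add: is_l2_projection_def)
    moreover have "l2_inner (\<lambda>i. x i - P x i) (P f) = l2_inner (P (\<lambda>i. x i - P x i)) f"
      using P diff[OF x mem[OF x]] f by (simp add: is_l2_projection_def)
    ultimately show ?thesis by (simp add: l2_inner_def)
  qed
  show px: "P x \<in> P ` l2_space S \<and> (\<lambda>i. x i - P x i) \<in> l2_orthogonal S (P ` l2_space S)"
    using x ortho diff[OF x mem[OF x]] by (auto simp: l2_orthogonal_def)
  fix y assume y: "y \<in> P ` l2_space S \<and> (\<lambda>i. x i - y i) \<in> l2_orthogonal S (P ` l2_space S)"
  then obtain f where f: "f \<in> l2_space S" "y = P f" by blast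
  obtain a b c where abc: "x = l2_nth a" "P x = l2_nth b" "y = l2_nth c"
    using x mem f by (metis l2_space_cases)
  have pf: "\<And>f. f \<in> l2_space S \<Longrightarrow> l2_inner (\<lambda>i. x i - y i) (P f) = 0"
    using y by (auto simp: l2_orthogonal_def)
  have "l2_inner (l2_nth (a - c)) (l2_nth b) = 0" "l2_inner (l2_nth (a - c)) (l2_nth c) = 0"
    "l2_inner (l2_nth (a - b)) (l2_nth b) = 0" "l2_inner (l2_nth (a - b)) (l2_nth c) = 0"
    using pf[OF x] pf[OF f(1)] ortho[OF x] ortho[OF f(1)] f(2) abc by (simp_all add: l2_nth_diff[abs_def])
  then have "inner (b - c) (b - c) = 0"
    by (simp add: l2_inner_l2_nth inner_simps inner_commute)
  then show "y = P x" using abc by simp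
qed

text \<open>D is d on the Hilbert space of the whole type. \<open>d_local\<close> lets it be
  restricted to S, and \<open>d_lim\<close> controls d at coordinatewise limits that may lie outside
  l^2.\<close>

locale l2_operator =
  fixes S :: "'i set" and d :: "('i \<Rightarrow> real) \<Rightarrow> ('j \<Rightarrow> real)" and D :: "'i l2 \<Rightarrow> 'j l2"
  assumes D_bounded: "bounded_linear D"
    and D_nth: "l2_nth (D x) = d (l2_nth x)"
    and d_local: "(\<And>i. i \<in> S \<Longrightarrow> f i = g i) \<Longrightarrow> d f = d g"
    and d_lim: "(\<And>i. (\<lambda>n. F n i) \<longlonglongrightarrow> f i) \<Longrightarrow> (\<lambda>n. d (F n) j) \<longlonglongrightarrow> d f j"
begin

sublocale D: bounded_linear D by (rule D_bounded)

lemma D_cut: "D (l2_cut S x) = D x"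
proof (rule l2_eqI)
  fix j
  have "d (l2_nth (l2_cut S x)) = d (l2_nth x)" by (rule d_local) (simp add: l2_nth_cut)
  then show "l2_nth (D (l2_cut S x)) j = l2_nth (D x) j" by (simp add: D_nth)
qed

definition Dadj :: "'j l2 \<Rightarrow> 'i l2" where
  "Dadj y = (SOME z. \<forall>x. inner (D x) y = inner x z)"

lemma Dadj: "inner (D x) y = inner x (Dadj y)"
proof -
  have "\<forall>x. inner (D x) y = inner x (Dadj y)"
    unfolding Dadj_def by (rule someI_ex) (rule l2_adjoint_exists[OF D_bounded])
  then show ?thesis ..
qed

text \<open>D kills every unit vector outside S, because d does not see those coordinates.\<close>

lemma Dadj_supp: "Dadj y \<in> l2_supp S"
proof -
  have "l2_nth (Dadj y) i = 0" if "i \<notin> S" for i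
  proof -
    have "l2_cut S (l2_basis i) = 0" using that by (intro l2_eqI) (auto simp: l2_nth_cut l2_nth_basis indicator_def)
    then have "D (l2_basis i) = 0" using D_cut[of "l2_basis i"] by (simp add: D.zero)
    moreover have "l2_nth (Dadj y) i = inner (l2_basis i) (Dadj y)"
      unfolding inner_l2_basis[symmetric] by (rule inner_commute)
    ultimately show ?thesis by (simp flip: Dadj)
  qed
  then show ?thesis by (simp add: l2_supp_def)
qed

lemma l2_adjoint_d: "l2_adjoint S d (l2_nth y) = l2_nth (Dadj y)"
  unfolding l2_adjoint_def
proof (rule the_equality)
  show "l2_nth (Dadj y) \<in> l2_space S \<and> (\<forall>x\<in>l2_space S. l2_inner (d x) (l2_nth y) = l2_inner x (l2_nth (Dadj y)))"
  proof (intro conjI ballI)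
    show "l2_nth (Dadj y) \<in> l2_space S" by (simp add: l2_nth_in_l2_space_iff Dadj_supp)
    fix f assume "f \<in> l2_space S"
    then obtain x where "f = l2_nth x" by (metis l2_space_cases)
    then show "l2_inner (d f) (l2_nth y) = l2_inner f (l2_nth (Dadj y))"
      using Dadj[of x y] by (simp add: l2_inner_l2_nth flip: D_nth)
  qed
  fix z assume z: "z \<in> l2_space S \<and> (\<forall>x\<in>l2_space S. l2_inner (d x) (l2_nth y) = l2_inner x z)"
  then obtain Z where Z: "z = l2_nth Z" "Z \<in> l2_supp S" using l2_space_cases by blast
  have W: "Z - Dadj y \<in> l2_supp S" using Z Dadj_supp by (intro subspace_diff subspace_l2_supp)
  then have "l2_inner (d (l2_nth (Z - Dadj y))) (l2_nth y) = l2_inner (l2_nth (Z - Dadj y)) z"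
    using z l2_nth_in_l2_space_iff by blast
  then have "inner (D (Z - Dadj y)) y = inner (Z - Dadj y) Z"
    by (simp add: Z l2_inner_l2_nth flip: D_nth)
  then have "inner (Z - Dadj y) (Z - Dadj y) = 0"
    by (simp add: Dadj inner_diff_right)
  then show "z = l2_nth (Dadj y)" by (simp add: Z)
qed

definition A :: "'i l2 \<Rightarrow> 'i l2" where "A x = Dadj (D x)"

lemma inner_A: "inner (A x) y = inner (D x) (D y)"
  using Dadj[of y "D x"] by (simp add: A_def inner_commute)

lemma linear_A: "linear A"
  by (rule linearI; rule inner_eq_all) (simp_all add: inner_A D.add D.scaleR inner_simps)

lemma sym_A: "inner (A x) y = inner x (A y)"
  using inner_A[of x y] inner_A[of y x] by (simp add: inner_commute)

lemma pos_A: "0 \<le> inner (A x) x"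
  by (simp add: inner_A)

lemma A_supp: "A x \<in> l2_supp S"
  by (simp add: A_def Dadj_supp)

definition L :: "('i \<Rightarrow> real) \<Rightarrow> ('i \<Rightarrow> real)" where
  "L f = l2_adjoint S d (d f)"

lemma L_nth: "L (l2_nth x) = l2_nth (A x)"
  by (simp add: L_def A_def l2_adjoint_d flip: D_nth)

text \<open>Makes the choice in \<open>spectral_projection\<close> meaningful. The functions
  supported on S are a closed A-invariant subspace, hence invariant under the spectral measure of A
  on the whole type, which restricts to them.\<close>

lemma spectral_measure_exists: "\<exists>P. is_spectral_measure S L P"
proof -
  obtain K where K: "K > 0" "\<And>x. norm (D x) \<le> norm x * K" using D.pos_bounded by blast
  have le: "inner (A x) x \<le> K\<^sup>2 * inner x x" for x
  proof -
    have "(norm (D x))\<^sup>2 \<le> (norm x * K)\<^sup>2" using K by (intro power_mono) auto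
    then show ?thesis by (simp add: inner_A power2_norm_eq_inner power_mult_distrib mult.commute)
  qed
  have "K\<^sup>2 > 0" using K by simp
  then obtain E where E: "resolution A E" "\<And>x. E UNIV x = x"
    and inv: "\<And>\<Omega> W x. \<Omega> \<in> sets borel \<Longrightarrow> subspace W \<Longrightarrow> closed W \<Longrightarrow> (\<And>w. w \<in> W \<Longrightarrow> A w \<in> W) \<Longrightarrow> x \<in> W \<Longrightarrow> E \<Omega> x \<in> W"
    using spectral_theorem_nonneg[OF linear_A sym_A pos_A le] by metis
  interpret spectral_resolution A E
    by (rule spectral_resolution.intro[OF E(1) linear_A sym_A pos_A])
  define P where "P \<Omega> f = l2_nth (E \<Omega> (Abs_l2 f))" for \<Omega> f
  have P: "P \<Omega> (l2_nth x) = l2_nth (E \<Omega> x)" for \<Omega> x by (simp add: P_def Abs_l2_nth)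
  have supp: "E \<Omega> x \<in> l2_supp S" if "\<Omega> \<in> sets borel" "x \<in> l2_supp S" for \<Omega> x
    by (rule inv[OF that(1) subspace_l2_supp closed_l2_supp A_supp that(2)])
  have proj: "is_l2_projection S (P \<Omega>)" if \<Omega>: "\<Omega> \<in> sets borel" for \<Omega>
    unfolding is_l2_projection_def
  proof (intro conjI ballI allI Pi_I)
    fix f g assume "f \<in> l2_space S" "g \<in> l2_space S"
    then obtain x y where f: "f = l2_nth x" "x \<in> l2_supp S" and g: "g = l2_nth y" "y \<in> l2_supp S"
      by (metis l2_space_cases)
    show "P \<Omega> f \<in> l2_space S" by (simp add: f P l2_nth_in_l2_space_iff supp \<Omega>)
    show "P \<Omega> (P \<Omega> f) = P \<Omega> f" using E_mult[OF \<Omega> \<Omega>] by (simp add: f P)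
    show "l2_inner (P \<Omega> f) g = l2_inner f (P \<Omega> g)" by (simp add: f g P l2_inner_l2_nth E_sym[OF \<Omega>])
    fix a b :: real
    have eq: "(\<lambda>i. a * f i + b * g i) = l2_nth (a *\<^sub>R x + b *\<^sub>R y)" by (auto simp: f g)
    have "P \<Omega> (\<lambda>i. a * f i + b * g i) = l2_nth (a *\<^sub>R E \<Omega> x + b *\<^sub>R E \<Omega> y)"
      unfolding eq P by (simp only: linear_add[OF E_linear[OF \<Omega>]] linear_scale[OF E_linear[OF \<Omega>]])
    also have "\<dots> = (\<lambda>i. a * P \<Omega> f i + b * P \<Omega> g i)"
      by (simp add: fun_eq_iff f g P)
    finally show "P \<Omega> (\<lambda>i. a * f i + b * g i) = (\<lambda>i. a * P \<Omega> f i + b * P \<Omega> g i)" .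
  qed
  have "is_spectral_measure S L P"
    unfolding is_spectral_measure_def
  proof (intro conjI ballI allI impI proj)
    fix f assume "f \<in> l2_space S"
    then obtain x where f: "f = l2_nth x" "x \<in> l2_supp S" by (metis l2_space_cases)
    show "P UNIV f = f" by (simp add: f P E)
    show "P (\<Omega> \<inter> \<Omega>') f = P \<Omega> (P \<Omega>' f)" if "\<Omega> \<in> sets borel" "\<Omega>' \<in> sets borel" for \<Omega> \<Omega>'
      by (simp add: f P E_mult that)
    show "let \<mu> = measure_of UNIV (sets borel) (\<lambda>\<Omega>. ennreal (l2_inner (P \<Omega> f) f))
      in integrable \<mu> (\<lambda>t. t) \<and> (LINT t|\<mu>. t) = l2_inner (L f) f"
      unfolding f P l2_inner_l2_nth L_nth Let_def spectral_meas_def[symmetric]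
      by (simp add: integrable_spectral_meas integral_spectral_meas)
    fix g and \<Omega> :: "nat \<Rightarrow> real set" assume "range \<Omega> \<subseteq> sets borel \<and> disjoint_family \<Omega>" "g \<in> l2_space S"
    moreover from this obtain y where g: "g = l2_nth y" by (metis l2_space_cases)
    ultimately show "(\<lambda>n. l2_inner (P (\<Omega> n) f) g) sums l2_inner (P (\<Union>n. \<Omega> n) f) g"
      by (simp add: f P l2_inner_l2_nth E_sums)
  qed auto
  then show ?thesis by (rule exI[of _ P])
qed

text \<open>The opposite direction, for an arbitrary chosen P. Its values outside
  \<open>l2_space S\<close> are unspecified, so it is precomposed with the cut; this gives an
  everywhere defined linear family whose total projection is the cut.\<close>

lemma resolution_of_spectral_measure:
  assumes P: "is_spectral_measure S L P"
  defines "E \<equiv> \<lambda>\<Omega> x. Abs_l2 (P \<Omega> (l2_nth (l2_cut S x)))"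
  shows "resolution A E" and "E UNIV x = l2_cut S x"
    and "\<Omega> \<in> sets borel \<Longrightarrow> x \<in> l2_supp S \<Longrightarrow> P \<Omega> (l2_nth x) = l2_nth (E \<Omega> x)"
    and "\<Omega> \<in> sets borel \<Longrightarrow> E \<Omega> x \<in> l2_supp S"
proof -
  have *: "P \<Omega> (l2_nth (l2_cut S x)) = l2_nth (E \<Omega> x) \<and> E \<Omega> x \<in> l2_supp S" if \<Omega>: "\<Omega> \<in> sets borel" for \<Omega> x
  proof -
    obtain y where y: "P \<Omega> (l2_nth (l2_cut S x)) = l2_nth y" "y \<in> l2_supp S"
      by (rule is_spectral_measure_projection[OF P \<Omega> l2_cut_in_supp])
    then show ?thesis by (simp add: E_def Abs_l2_nth)
  qed
  then have E: "P \<Omega> (l2_nth (l2_cut S x)) = l2_nth (E \<Omega> x)" and E_supp: "E \<Omega> x \<in> l2_supp S"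
    if "\<Omega> \<in> sets borel" for \<Omega> x using that by blast+
  show "\<Omega> \<in> sets borel \<Longrightarrow> E \<Omega> x \<in> l2_supp S" by (rule E_supp)
  show E': "P \<Omega> (l2_nth x) = l2_nth (E \<Omega> x)" if "\<Omega> \<in> sets borel" "x \<in> l2_supp S" for \<Omega> x
    using E[OF that(1), of x] l2_cut_eq[OF that(2)] by simp
  have E_cut: "E \<Omega> (l2_cut S x) = E \<Omega> x" for \<Omega> x
    by (simp add: E_def l2_cut_eq)
  have mem: "l2_nth (l2_cut S x) \<in> l2_space S" for x by (simp add: l2_nth_in_l2_space_iff)
  have proj: "is_l2_projection S (P \<Omega>)" if "\<Omega> \<in> sets borel" for \<Omega>
    using P that by (simp add: is_spectral_measure_def)
  have U: "P UNIV f = f" if "f \<in> l2_space S" for f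
    using P that by (simp add: is_spectral_measure_def)
  have mult: "P (\<Omega> \<inter> \<Omega>') f = P \<Omega> (P \<Omega>' f)" if "\<Omega> \<in> sets borel" "\<Omega>' \<in> sets borel" "f \<in> l2_space S" for \<Omega> \<Omega>' f
    using P that by (simp add: is_spectral_measure_def)
  have sums: "(\<lambda>n. l2_inner (P (F n) f) g) sums l2_inner (P (\<Union>n. F n) f) g"
    if "range F \<subseteq> sets borel" "disjoint_family F" "f \<in> l2_space S" "g \<in> l2_space S" for F f g
    using P that unfolding is_spectral_measure_def by simp
  have quad: "let \<mu> = measure_of UNIV (sets borel) (\<lambda>\<Omega>. ennreal (l2_inner (P \<Omega> f) f))
      in integrable \<mu> (\<lambda>t. t) \<and> (LINT t|\<mu>. t) = l2_inner (L f) f" if "f \<in> l2_space S" for f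
    using P that unfolding is_spectral_measure_def by blast
  show "E UNIV x = l2_cut S x"
    by (simp add: E_def U mem Abs_l2_nth)
  have inner_E: "inner (E \<Omega> x) y = l2_inner (P \<Omega> (l2_nth (l2_cut S x))) (l2_nth (l2_cut S y))"
    if "\<Omega> \<in> sets borel" for \<Omega> x y
    using inner_l2_cut[OF E_supp[OF that]] by (simp add: E[OF that] l2_inner_l2_nth)
  have sym: "inner (E \<Omega> x) y = inner x (E \<Omega> y)" if \<Omega>: "\<Omega> \<in> sets borel" for \<Omega> x y
  proof -
    have "inner (E \<Omega> x) y = l2_inner (l2_nth (l2_cut S x)) (P \<Omega> (l2_nth (l2_cut S y)))"
      using proj[OF \<Omega>] mem by (simp add: inner_E[OF \<Omega>] is_l2_projection_def)
    then show ?thesis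
      using inner_l2_cut_left[OF E_supp[OF \<Omega>]] by (simp add: E[OF \<Omega>] l2_inner_l2_nth)
  qed
  show "resolution A E"
    unfolding resolution_def
  proof (intro conjI ballI allI impI sym)
    fix \<Omega> :: "real set" assume \<Omega>: "\<Omega> \<in> sets borel"
    show "linear (E \<Omega>)"
      by (rule linearI; rule inner_eq_all) (simp_all add: sym[OF \<Omega>] inner_simps)
    fix \<Omega>' :: "real set" and x assume \<Omega>': "\<Omega>' \<in> sets borel"
    have "l2_nth (E (\<Omega> \<inter> \<Omega>') x) = P \<Omega> (P \<Omega>' (l2_nth (l2_cut S x)))"
      using E[of "\<Omega> \<inter> \<Omega>'" x] mult[OF \<Omega> \<Omega>' mem[of x]] \<Omega> \<Omega>' by simp
    also have "\<dots> = l2_nth (E \<Omega> (E \<Omega>' x))"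
      by (simp add: E[OF \<Omega>'] E'[OF \<Omega> E_supp[OF \<Omega>']])
    finally show "E (\<Omega> \<inter> \<Omega>') x = E \<Omega> (E \<Omega>' x)" by (simp add: l2_nth_inject)
  next
    fix F :: "nat \<Rightarrow> real set" and x y assume F: "range F \<subseteq> sets borel \<and> disjoint_family F"
    then have "F n \<in> sets borel" "(\<Union>n. F n) \<in> sets borel" for n by auto
    then show "(\<lambda>n. inner (E (F n) x) y) sums inner (E (\<Union>n. F n) x) y"
      using sums[of F "l2_nth (l2_cut S x)" "l2_nth (l2_cut S y)"] F mem by (simp add: inner_E)
  next
    fix x
    have eq: "measure_of UNIV (sets borel) (\<lambda>\<Omega>. ennreal (l2_inner (P \<Omega> (l2_nth (l2_cut S x))) (l2_nth (l2_cut S x))))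
      = measure_of UNIV (sets borel) (\<lambda>\<Omega>. ennreal (inner (E \<Omega> x) x))"
      by (rule measure_of_eq) (auto simp: sets.sigma_sets_eq[of borel, simplified] inner_E)
    have "l2_inner (L (l2_nth (l2_cut S x))) (l2_nth (l2_cut S x)) = inner (A x) x"
      by (simp add: L_nth l2_inner_l2_nth inner_A D_cut)
    then show "let \<mu> = measure_of UNIV (sets borel) (\<lambda>\<Omega>. ennreal (inner (E \<Omega> x) x))
          in integrable \<mu> (\<lambda>t. t) \<and> (LINT t|\<mu>. t) = inner (A x) x"
      using quad[OF mem[of x]] eq by simp
  qed
qed

text \<open>Both parts rest on the finite-sum estimate \<open>bound\<close> for functions without
  zero-energy component. Orthogonality to the kernel of d makes that component vanish in (i); in
  (ii) it is subtracted from the preimages.\<close>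

theorem sobolev_inequalities:
  fixes \<alpha> C :: real and p :: ereal
  assumes res: "resolution A E" and univ: "\<And>x. E UNIV x = l2_cut S x"
    and growth: "\<And>s i. s > 0 \<Longrightarrow> (norm (E {0<..s} (l2_basis i)))\<^sup>2 \<le> C * s powr (\<alpha> / 2)"
    and alpha: "\<alpha> > 2" and C: "C \<ge> 0"
    and p: "2 \<le> p" "1 / p \<le> ereal (1 / 2 - 1 / \<alpha>)"
  shows "(\<exists>C'. \<forall>\<beta>\<in>l2_orthogonal S {\<beta> \<in> l2_space S. d \<beta> = (\<lambda>j. 0)}. lp_norm p \<beta> \<le> C' * lp_norm 2 (d \<beta>))
    \<and> l2_closure T (d ` l2_space S) \<subseteq> d ` lp_space p S"
proof -
  interpret spectral_growth A E \<alpha> C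
    by (intro spectral_growth.intro spectral_resolution.intro spectral_growth_axioms.intro
        res linear_A sym_A pos_A alpha C growth)
  define q where "q = 2 + 1 / \<gamma>"
  have q: "q > 0" using gamma_pos by (simp add: q_def add_pos_pos)
  \<comment> \<open>The condition on 1/p says q <= p, since 1/q = 1/2 - 1/\<alpha>.\<close>
  have qp: "ereal q \<le> p"
  proof (cases p)
    case (real r)
    have r: "r \<ge> 2" using p(1) real by (metis ereal_less_eq(3) numeral_eq_ereal)
    have "1 / r \<le> 1 / 2 - 1 / \<alpha>" using p(2) real r by (simp add: one_ereal_def)
    moreover have "1 / 2 - 1 / \<alpha> = 1 / q"
      using alpha by (simp add: q_def \<gamma>_def field_simps)
    ultimately show ?thesis using q r real by (simp add: field_simps)
  qed (use p in \<open>auto simp: numeral_eq_ereal\<close>)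
  define K where "K = sobolev_const powr (1 / q)"
  have const0: "sobolev_const \<ge> 0" by (simp add: sobolev_const_def)
  have K: "K \<ge> 0" "K powr q = sobolev_const"
    using q const0 by (auto simp: K_def powr_powr)
  have A_D: "sqrt (inner (A \<beta>) \<beta>) = norm (D \<beta>)" for \<beta>
    by (simp add: inner_A norm_eq_sqrt_inner)
  have bound: "(\<Sum>i\<in>F. \<bar>l2_nth \<beta> i\<bar> powr q) \<le> (K * norm (D \<beta>)) powr q"
    if "\<beta> \<in> l2_supp S" "E {..0} \<beta> = 0" "finite F" for \<beta> F
    using sum_powr_le[of \<beta> F] that K by (simp add: univ l2_cut_eq q_def[symmetric] A_D powr_mult)
  \<comment> \<open>On this range <A y, y> = |D y|^2 is at most 0, so the range lies in the kernel
    of D.\<close>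
  have D_low: "D (E {..0} x) = 0" for x
  proof -
    have "inner (A (E {..0} x)) (E {..0} x) \<le> 0"
      using A_le_on_range[of 0 "E {..0} x"] E_mult[of "{..0}" "{..0}" x] by simp
    then show ?thesis
      unfolding inner_A by (metis inner_eq_zero_iff inner_ge_zero order_antisym)
  qed
  have E_supp: "E \<Omega> x \<in> l2_supp S" if "\<Omega> \<in> sets borel" for \<Omega> x
    using E_mult[of UNIV \<Omega> x] that univ[of "E \<Omega> x"] l2_cut_in_supp[of S "E \<Omega> x"] by simp
  have "lp_norm p f \<le> K * lp_norm 2 (d f)" if "f \<in> l2_orthogonal S {\<beta> \<in> l2_space S. d \<beta> = (\<lambda>j. 0)}" for f
  proof -
    from that have "f \<in> l2_space S" by (simp add: l2_orthogonal_def)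
    then obtain \<beta> where f: "f = l2_nth \<beta>" "\<beta> \<in> l2_supp S" by (metis l2_space_cases)
    have "d (l2_nth (E {..0} \<beta>)) = (\<lambda>j. 0)"
      unfolding D_nth[symmetric] D_low by auto
    moreover have "l2_nth (E {..0} \<beta>) \<in> l2_space S"
      by (simp add: l2_nth_in_l2_space_iff E_supp)
    ultimately have "l2_inner f (l2_nth (E {..0} \<beta>)) = 0"
      using that by (simp add: l2_orthogonal_def)
    then have "inner (E {..0} \<beta>) \<beta> = 0"
      by (simp add: f l2_inner_l2_nth inner_commute)
    then have "E {..0} \<beta> = 0" using E_norm[of "{..0}" \<beta>] by simp
    then have "lp_norm p (l2_nth \<beta>) \<le> K * norm (D \<beta>)"
      by (intro lp_from_smaller_exponent(1)[OF q qp] bound f mult_nonneg_nonneg K) auto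
    then show ?thesis
      using lp_norm_l2_nth[of "D \<beta>"] by (simp add: f D_nth)
  qed
  moreover have "y \<in> d ` lp_space p S" if y: "y \<in> l2_closure T (d ` l2_space S)" for y
  proof -
    from y have "y \<in> l2_space T" by (simp add: l2_closure_def)
    then obtain Y where Y: "y = l2_nth Y" by (metis l2_space_cases)
    have "\<exists>b. b \<in> l2_supp S \<and> norm (Y - D b) < 1 / real (Suc n)" for n
    proof -
      have "\<exists>m\<in>d ` l2_space S. lp_norm 2 (\<lambda>i. y i - m i) < 1 / real (Suc n)"
        using y by (simp add: l2_closure_def)
      then obtain f where f: "f \<in> l2_space S" "lp_norm 2 (\<lambda>i. y i - d f i) < 1 / real (Suc n)" by blast
      then obtain b where b: "f = l2_nth b" "b \<in> l2_supp S" by (metis l2_space_cases)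
      have "(\<lambda>i. y i - d f i) = l2_nth (Y - D b)"
        by (auto simp: Y b D_nth)
      then have "norm (Y - D b) < 1 / real (Suc n)"
        using f(2) lp_norm_l2_nth[of "Y - D b"] by simp
      then show ?thesis using b by blast
    qed
    then obtain b where b: "\<And>n. b n \<in> l2_supp S" "\<And>n. norm (Y - D (b n)) < 1 / real (Suc n)" by metis
    \<comment> \<open>Removing the zero-energy part leaves D (b n) unchanged and brings the preimage
      into the scope of \<open>bound\<close>.\<close>
    define \<beta> where "\<beta> n = b n - E {..0} (b n)" for n
    have \<beta>_supp: "\<beta> n \<in> l2_supp S" for n
      unfolding \<beta>_def using b E_supp by (intro subspace_diff subspace_l2_supp) auto
    have D\<beta>: "D (\<beta> n) = D (b n)" for n by (simp add: \<beta>_def D.diff D_low)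
    have lin: "linear (E {..0})" by (rule E_linear) simp
    have low: "E {..0} (\<beta> n) = 0" for n
      using E_mult[of "{..0}" "{..0}" "b n"] by (simp add: \<beta>_def linear_diff[OF lin])
    have "(\<lambda>n. norm (D (\<beta> n) - Y)) \<longlonglongrightarrow> 0"
    proof (rule real_tendsto_sandwich[OF _ _ tendsto_const LIMSEQ_inverse_real_of_nat])
      show "\<forall>\<^sub>F n in sequentially. norm (D (\<beta> n) - Y) \<le> inverse (real (Suc n))"
        using b(2) by (intro always_eventually allI) (simp add: D\<beta> norm_minus_commute inverse_eq_divide less_imp_le)
    qed simp
    then have lim: "(\<lambda>n. D (\<beta> n)) \<longlonglongrightarrow> Y"
      using LIM_zero_cancel tendsto_norm_zero_iff by blast
    \<comment> \<open>\<open>bound\<close> for the one-element set {i}, applied to a difference of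
      two preimages.\<close>
    have coord: "\<bar>l2_nth (\<beta> n) i - l2_nth (\<beta> m) i\<bar> \<le> K * norm (D (\<beta> n) - D (\<beta> m))" for n m i
    proof -
      have "(\<Sum>i\<in>{i}. \<bar>l2_nth (\<beta> n - \<beta> m) i\<bar> powr q) \<le> (K * norm (D (\<beta> n - \<beta> m))) powr q"
        by (rule bound) (auto simp: linear_diff[OF lin] low intro: subspace_diff[OF subspace_l2_supp \<beta>_supp \<beta>_supp])
      then have le: "\<bar>l2_nth (\<beta> n) i - l2_nth (\<beta> m) i\<bar> powr q \<le> (K * norm (D (\<beta> n) - D (\<beta> m))) powr q"
        by (simp add: D.diff)
      show ?thesis
      proof (rule ccontr)
        assume "\<not> ?thesis"
        then have "(K * norm (D (\<beta> n) - D (\<beta> m))) powr q < \<bar>l2_nth (\<beta> n) i - l2_nth (\<beta> m) i\<bar> powr q"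
          using q K by (intro powr_less_mono2) auto
        then show False using le by simp
      qed
    qed
    have Cau: "Cauchy (\<lambda>n. l2_nth (\<beta> n) i)" for i
    proof (rule CauchyI)
      fix e :: real assume e: "e > 0"
      have "Cauchy (\<lambda>n. D (\<beta> n))" using lim by (rule LIMSEQ_imp_Cauchy)
      moreover have "e / (K + 1) > 0" using e K by simp
      ultimately obtain M where M: "\<And>m n. m \<ge> M \<Longrightarrow> n \<ge> M \<Longrightarrow> norm (D (\<beta> m) - D (\<beta> n)) < e / (K + 1)"
        unfolding Cauchy_iff by blast
      have "norm (l2_nth (\<beta> m) i - l2_nth (\<beta> n) i) < e" if "m \<ge> M" "n \<ge> M" for m n
      proof -
        have "norm (l2_nth (\<beta> m) i - l2_nth (\<beta> n) i) \<le> K * norm (D (\<beta> m) - D (\<beta> n))"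
          using coord[of m i n] by simp
        also have "\<dots> \<le> K * (e / (K + 1))" using M[OF that] K by (intro mult_left_mono) auto
        also have "\<dots> < e" using e K by (simp add: field_simps)
        finally show ?thesis .
      qed
      then show "\<exists>M. \<forall>m\<ge>M. \<forall>n\<ge>M. norm (l2_nth (\<beta> m) i - l2_nth (\<beta> n) i) < e" by blast
    qed
    define g where "g i = lim (\<lambda>n. l2_nth (\<beta> n) i)" for i
    have g: "(\<lambda>n. l2_nth (\<beta> n) i) \<longlonglongrightarrow> g i" for i
      using Cauchy_convergent[OF Cau[of i]] by (simp add: g_def convergent_LIMSEQ_iff)
    have "Bseq (\<lambda>n. D (\<beta> n))" using lim by (intro convergent_imp_Bseq convergentI)
    then obtain R where R: "R > 0" "\<And>n. norm (D (\<beta> n)) \<le> R" unfolding Bseq_def by blast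
    \<comment> \<open>A finite sum commutes with the coordinatewise limit, so the uniform l^q bound
      passes to g.\<close>
    have "(\<Sum>i\<in>F. \<bar>g i\<bar> powr q) \<le> (K * R) powr q" if F: "finite F" for F
    proof (rule tendsto_upperbound)
      show "(\<lambda>n. \<Sum>i\<in>F. \<bar>l2_nth (\<beta> n) i\<bar> powr q) \<longlonglongrightarrow> (\<Sum>i\<in>F. \<bar>g i\<bar> powr q)"
        using q by (intro tendsto_sum tendsto_powr' tendsto_rabs g tendsto_const) auto
      show "\<forall>\<^sub>F n in sequentially. (\<Sum>i\<in>F. \<bar>l2_nth (\<beta> n) i\<bar> powr q) \<le> (K * R) powr q"
      proof (intro always_eventually allI)
        fix n
        have "(\<Sum>i\<in>F. \<bar>l2_nth (\<beta> n) i\<bar> powr q) \<le> (K * norm (D (\<beta> n))) powr q"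
          by (rule bound[OF \<beta>_supp low F])
        also have "\<dots> \<le> (K * R) powr q"
          using R(2)[of n] K q by (intro powr_mono2 mult_left_mono mult_nonneg_nonneg) auto
        finally show "(\<Sum>i\<in>F. \<bar>l2_nth (\<beta> n) i\<bar> powr q) \<le> (K * R) powr q" .
      qed
    qed simp
    moreover have "g i = 0" if "i \<notin> S" for i
      using g[of i] \<beta>_supp that by (simp add: l2_supp_def LIMSEQ_const_iff)
    ultimately have "g \<in> lp_space p S"
      using K R by (intro lp_from_smaller_exponent(2)[OF q qp, of "K * R"]) auto
    moreover have "y = d g"
    proof
      fix j
      \<comment> \<open>D cannot be applied to g, which is only known to be in l^p; coordinatewise
        continuity of d takes its place.\<close>
      have "(\<lambda>n. d (l2_nth (\<beta> n)) j) \<longlonglongrightarrow> d g j" by (rule d_lim) (rule g)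
      moreover have "(\<lambda>n. d (l2_nth (\<beta> n)) j) \<longlonglongrightarrow> y j"
        using tendsto_l2_nth[OF lim, of j] by (simp add: Y D_nth)
      ultimately show "y j = d g j" using LIMSEQ_unique by blast
    qed
    ultimately show ?thesis by blast
  qed
  ultimately show ?thesis by blast
qed

end

section \<open>The simplicial coboundary\<close>

text \<open>A pullback: it sends the unit vector at \<pi> i to the one at i. For a bijection of the
  whole type it is an isometry whose adjoint is the pullback along the inverse.\<close>

definition l2_reindex :: "('i \<Rightarrow> 'i) \<Rightarrow> 'i l2 \<Rightarrow> 'i l2" where
  "l2_reindex \<pi> x = Abs_l2 (\<lambda>i. l2_nth x (\<pi> i))"

lemma l2_nth_reindex:
  assumes "bij \<pi>" shows "l2_nth (l2_reindex \<pi> x) i = l2_nth x (\<pi> i)"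
proof -
  have "(\<lambda>i. (l2_nth x (\<pi> i))\<^sup>2) summable_on UNIV"
    using summable_on_reindex_bij_betw[OF assms, of "\<lambda>i. (l2_nth x i)\<^sup>2"] summable_l2_nth[of x] by simp
  then show ?thesis by (simp add: l2_reindex_def l2_nth_Abs)
qed

lemma inner_l2_reindex:
  assumes "bij \<pi>" shows "inner (l2_reindex \<pi> x) (l2_reindex \<pi> y) = inner x y"
  unfolding inner_l2_def l2_nth_reindex[OF assms]
  by (rule infsum_reindex_bij_betw[OF assms])

lemma norm_l2_reindex: "bij \<pi> \<Longrightarrow> norm (l2_reindex \<pi> x) = norm x"
  by (simp add: norm_eq_sqrt_inner inner_l2_reindex)

lemma l2_reindex_inverse:
  assumes "bij \<pi>" "bij \<pi>'" "\<And>i. \<pi>' (\<pi> i) = i"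
  shows "l2_reindex \<pi> (l2_reindex \<pi>' x) = x"
  by (rule l2_eqI) (simp add: l2_nth_reindex assms)

lemma inner_l2_reindex_adjoint:
  assumes "bij \<pi>" "bij \<pi>'" "\<And>i. \<pi>' (\<pi> i) = i"
  shows "inner (l2_reindex \<pi> x) y = inner x (l2_reindex \<pi>' y)"
  using inner_l2_reindex[OF assms(1), of x "l2_reindex \<pi>' y"] by (simp add: l2_reindex_inverse[OF assms])

context l2_operator
begin

text \<open>The pullbacks along \<pi> and \<pi>' are mutually adjoint isometries. Since D
  intertwines them with those along \<rho> and \<rho>', they commute with A, hence with the
  half-line projections and with their difference.\<close>

lemma spectral_projection_invariant:
  assumes res: "resolution A E" and univ: "\<And>x. E UNIV x = l2_cut S x"
    and \<pi>: "bij \<pi>" "bij \<pi>'" "\<And>i. \<pi>' (\<pi> i) = i" "\<And>i. \<pi> (\<pi>' i) = i" "\<And>i. \<pi> i \<in> S \<longleftrightarrow> i \<in> S"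
    and \<rho>: "bij \<rho>" "bij \<rho>'" "\<And>j. \<rho>' (\<rho> j) = j" "\<And>j. \<rho> (\<rho>' j) = j"
    and equi: "\<And>x. D (l2_reindex \<pi> x) = l2_reindex \<rho> (D x)"
    and s: "s \<ge> 0"
  shows "norm (E {0<..s} (l2_basis (\<pi> i))) = norm (E {0<..s} (l2_basis i))"
proof -
  interpret spectral_resolution A E
    by (rule spectral_resolution.intro[OF res linear_A sym_A pos_A])
  let ?U = "l2_reindex \<pi>" and ?V = "l2_reindex \<pi>'"
  have equi': "D (?V x) = l2_reindex \<rho>' (D x)" for x
  proof -
    have "D x = l2_reindex \<rho> (D (?V x))"
      using equi[of "?V x"] by (simp add: l2_reindex_inverse \<pi>)
    then show ?thesis by (simp add: l2_reindex_inverse \<rho>)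
  qed
  have comm: "A (?U x) = ?U (A x)" for x
    by (rule inner_eq_all) (simp add: inner_A equi inner_l2_reindex_adjoint[OF \<rho>(1-3)] inner_l2_reindex_adjoint[OF \<pi>(1-3)] equi')
  have comm': "A (?V x) = ?V (A x)" for x
    by (rule inner_eq_all) (simp add: inner_A equi' inner_l2_reindex_adjoint[OF \<rho>(2,1,4)] inner_l2_reindex_adjoint[OF \<pi>(2,1,4)] equi)
  have S': "\<pi>' i \<in> S \<longleftrightarrow> i \<in> S" for i using \<pi>(5)[of "\<pi>' i"] \<pi>(4) by simp
  have E_comm: "E {..r} (?U x) = ?U (E {..r} x)" if "r \<ge> 0" for r x
    by (rule E_atMost_isometry_commute[where V = ?V])
      (auto simp: norm_l2_reindex \<pi> comm comm' that univ l2_nth_cut l2_nth_reindex S' intro!: l2_eqI inner_l2_reindex_adjoint)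
  have "?U (l2_basis (\<pi> i)) = l2_basis i"
    by (rule l2_eqI) (auto simp: l2_nth_reindex \<pi> l2_nth_basis indicator_def bij_is_inj[THEN inj_eq])
  then have "E {0<..s} (l2_basis i) = E {0<..s} (?U (l2_basis (\<pi> i)))" by simp
  also have "\<dots> = ?U (E {..s} (l2_basis (\<pi> i))) - ?U (E {..0} (l2_basis (\<pi> i)))"
    using s by (simp add: E_interval E_comm)
  also have "\<dots> = ?U (E {0<..s} (l2_basis (\<pi> i)))"
    using s by (intro l2_eqI) (simp add: E_interval l2_nth_reindex \<pi>)
  finally show ?thesis by (simp add: norm_l2_reindex \<pi>)
qed

end

section \<open>The group acting on simplexes\<close>

context simplicial_covering
begin

lemma simplex_finite: "\<sigma> \<in> X \<Longrightarrow> finite \<sigma>"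
  and simplex_nonempty: "\<sigma> \<in> X \<Longrightarrow> \<sigma> \<noteq> {}"
  and simplex_face: "\<sigma> \<in> X \<Longrightarrow> \<tau> \<subseteq> \<sigma> \<Longrightarrow> \<tau> \<noteq> {} \<Longrightarrow> \<tau> \<in> X"
  using complex_total unfolding abstract_complex_def by blast+

lemma inj_on_simplex: "g \<in> carrier G \<Longrightarrow> \<sigma> \<in> X \<Longrightarrow> inj_on (\<phi> g) \<sigma>"
  using inj_prop[of g] by (rule inj_on_subset) auto

lemma group_G: "group G"
  using group_hom by (rule group_hom.axioms(1))

lemma inverse_image_simplex:
  assumes "g \<in> carrier G" "\<sigma> \<in> X"
  shows "\<phi> (inv\<^bsub>G\<^esub> g) ` (\<phi> g ` \<sigma>) = \<sigma>"
proof -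
  have "\<phi> (inv\<^bsub>G\<^esub> g) (\<phi> g x) = x" if "x \<in> \<sigma>" for x
    by (rule orbit_sym_aux) (use that assms in auto)
  then show ?thesis by (simp add: image_image)
qed

lemma pr_action: "g \<in> carrier G \<Longrightarrow> x \<in> \<Union>X \<Longrightarrow> pr (\<phi> g x) = pr x"
  using fibres_are_orbits[of x "\<phi> g x"] element_image[of g x "\<phi> g x"] by auto

lemma same_image_same_vertex:
  assumes "x \<in> \<sigma>" "x \<in> \<tau>" "\<sigma> \<in> X" "\<tau> \<in> X" "pr ` \<sigma> = pr ` \<tau>"
  shows "\<sigma> = \<tau>"
proof -
  have "inj_on (\<lambda>\<sigma>. pr ` \<sigma>) {\<sigma> \<in> X. x \<in> \<sigma>}"
    using star_bij[of x] assms by (auto simp: bij_betw_def)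
  then show ?thesis using assms by (auto dest: inj_onD)
qed

lemma pr_simplex: "\<sigma> \<in> X \<Longrightarrow> pr ` \<sigma> \<in> K"
proof -
  assume \<sigma>: "\<sigma> \<in> X"
  then obtain x where x: "x \<in> \<sigma>" using simplex_nonempty by blast
  then have "(\<lambda>\<sigma>. pr ` \<sigma>) ` {\<sigma> \<in> X. x \<in> \<sigma>} = {\<tau> \<in> K. pr x \<in> \<tau>}"
    using star_bij[of x] \<sigma> by (auto simp: bij_betw_def)
  then show ?thesis using \<sigma> x by auto
qed

text \<open>Carry a vertex x of \<sigma> to the vertex y of \<tau> over the same point. The
  translate of \<sigma> and \<tau> then share y and have the same image, so they agree by unique
  lifting.\<close>

lemma same_image_same_orbit:
  assumes \<sigma>: "\<sigma> \<in> X" and \<tau>: "\<tau> \<in> X" and pr: "pr ` \<sigma> = pr ` \<tau>"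
  shows "\<exists>g\<in>carrier G. \<tau> = \<phi> g ` \<sigma>"
proof -
  obtain x where x: "x \<in> \<sigma>" using simplex_nonempty[OF \<sigma>] by blast
  then obtain y where y: "y \<in> \<tau>" "pr x = pr y" using pr by (metis imageE imageI)
  have X: "x \<in> \<Union>X" "y \<in> \<Union>X" using x y \<sigma> \<tau> by auto
  then obtain g where g: "g \<in> carrier G" "y = \<phi> g x" using fibres_are_orbits y by blast
  have "pr ` (\<phi> g ` \<sigma>) = pr ` \<sigma>"
    unfolding image_image using \<sigma> g by (intro image_cong pr_action) auto
  then have "\<phi> g ` \<sigma> = \<tau>"
    using same_image_same_vertex[of y "\<phi> g ` \<sigma>" \<tau>] x y g \<sigma> \<tau> simplicial_action pr by auto
  then show ?thesis using g by blast
qed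

text \<open>The identity outside X, so that it is a bijection of the whole type, as
  \<open>l2_reindex\<close> requires.\<close>

definition simplex_action :: "'g \<Rightarrow> 'v set \<Rightarrow> 'v set" where
  "simplex_action g \<sigma> = (if \<sigma> \<in> X then \<phi> g ` \<sigma> else \<sigma>)"

lemma simplex_action_inverse:
  assumes g: "g \<in> carrier G"
  shows "simplex_action (inv\<^bsub>G\<^esub> g) (simplex_action g \<sigma>) = \<sigma>"
    and "simplex_action g (simplex_action (inv\<^bsub>G\<^esub> g) \<sigma>) = \<sigma>"
proof -
  have *: "simplex_action (inv\<^bsub>G\<^esub> h) (simplex_action h \<sigma>) = \<sigma>" if "h \<in> carrier G" for h \<sigma>
    using inverse_image_simplex[OF that] simplicial_action[OF that] by (simp add: simplex_action_def)
  show "simplex_action (inv\<^bsub>G\<^esub> g) (simplex_action g \<sigma>) = \<sigma>" by (rule *[OF g])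
  show "simplex_action g (simplex_action (inv\<^bsub>G\<^esub> g) \<sigma>) = \<sigma>"
    using *[of "inv\<^bsub>G\<^esub> g" \<sigma>] g group.inv_closed[OF group_G g] group.inv_inv[OF group_G g] by simp
qed

lemma bij_simplex_action:
  assumes "g \<in> carrier G" shows "bij (simplex_action g)"
  by (rule o_bij[of "simplex_action (inv\<^bsub>G\<^esub> g)"]) (auto simp: fun_eq_iff simplex_action_inverse[OF assms])

lemma simplex_action_simplexes:
  assumes g: "g \<in> carrier G"
  shows "simplex_action g \<sigma> \<in> simplexes X n \<longleftrightarrow> \<sigma> \<in> simplexes X n"
  using simplicial_action[OF g] card_image[OF inj_on_simplex[OF g]]
  by (auto simp: simplex_action_def simplexes_def)

lemma face_in_simplexes:
  assumes "\<tau> \<in> simplexes X (Suc k)" "v \<in> \<tau>"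
  shows "\<tau> - {v} \<in> simplexes X k"
proof -
  have fin: "finite \<tau>" and c: "card \<tau> = Suc (Suc k)" and \<tau>: "\<tau> \<in> X"
    using assms simplex_finite by (auto simp: simplexes_def)
  have card: "card (\<tau> - {v}) = Suc k" using fin c assms(2) by simp
  then have "\<tau> - {v} \<noteq> {}" by (metis card.empty nat.distinct(1))
  then have "\<tau> - {v} \<in> X" using simplex_face[OF \<tau>, of "\<tau> - {v}"] by blast
  then show ?thesis using card by (simp add: simplexes_def)
qed

text \<open>The signs depend only on the order of the projected vertices, and the action does not
  change projections.\<close>

lemma coboundary_equivariant:
  assumes g: "g \<in> carrier G"
  shows "coboundary X pr idx k (\<lambda>\<sigma>. c (simplex_action g \<sigma>)) \<tau> = coboundary X pr idx k c (simplex_action g \<tau>)"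
proof (cases "\<tau> \<in> simplexes X (Suc k)")
  case True
  then have \<tau>: "\<tau> \<in> X" by (simp add: simplexes_def)
  have inj: "inj_on (\<phi> g) \<tau>" by (rule inj_on_simplex[OF g \<tau>])
  have pr: "pr (\<phi> g x) = pr x" if "x \<in> \<tau>" for x by (rule pr_action[OF g]) (use that \<tau> in auto)
  have act: "simplex_action g \<tau> = \<phi> g ` \<tau>" using \<tau> by (simp add: simplex_action_def)
  have sgn: "card {w \<in> \<phi> g ` \<tau>. idx (pr w) < idx (pr (\<phi> g v))} = card {w \<in> \<tau>. idx (pr w) < idx (pr v)}" if "v \<in> \<tau>" for v
  proof -
    have "{w \<in> \<phi> g ` \<tau>. idx (pr w) < idx (pr (\<phi> g v))} = \<phi> g ` {w \<in> \<tau>. idx (pr w) < idx (pr v)}"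
      using pr that by auto
    moreover have "inj_on (\<phi> g) {w \<in> \<tau>. idx (pr w) < idx (pr v)}"
      using inj by (rule inj_on_subset) auto
    ultimately show ?thesis by (simp add: card_image)
  qed
  have face: "simplex_action g (\<tau> - {v}) = \<phi> g ` \<tau> - {\<phi> g v}" if "v \<in> \<tau>" for v
  proof -
    have "\<tau> - {v} \<in> X" using face_in_simplexes[OF True that] by (simp add: simplexes_def)
    then show ?thesis
      using inj that by (simp add: simplex_action_def inj_on_image_set_diff[OF inj, of \<tau> "{v}"])
  qed
  have "simplex_action g \<tau> \<in> simplexes X (Suc k)" using True simplex_action_simplexes[OF g] by simp
  then have "coboundary X pr idx k c (simplex_action g \<tau>)
     = (\<Sum>w\<in>\<phi> g ` \<tau>. (- 1) ^ card {u \<in> \<phi> g ` \<tau>. idx (pr u) < idx (pr w)} * c (\<phi> g ` \<tau> - {w}))"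
    by (simp add: coboundary_def act)
  also have "\<dots> = (\<Sum>v\<in>\<tau>. (- 1) ^ card {u \<in> \<tau>. idx (pr u) < idx (pr v)} * c (simplex_action g (\<tau> - {v})))"
    by (subst sum.reindex[OF inj]) (auto intro!: sum.cong simp: sgn face)
  also have "\<dots> = coboundary X pr idx k (\<lambda>\<sigma>. c (simplex_action g \<sigma>)) \<tau>"
    using True by (simp add: coboundary_def)
  finally show ?thesis ..
next
  case False
  then have "simplex_action g \<tau> \<notin> simplexes X (Suc k)" using simplex_action_simplexes[OF g] by simp
  then show ?thesis using False by (simp add: coboundary_def)
qed

text \<open>Each simplex \<sigma> occurs as a face \<tau> - {v} at most card K times: \<tau>
  contains a fixed vertex x of \<sigma>, so by unique lifting its image in K determines it, and
  \<tau> determines v. This local finiteness of X is what bounds d on l^2.\<close>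

lemma sum_faces_le:
  fixes h :: "'v set \<Rightarrow> real"
  assumes K: "finite K" and F: "finite F" "F \<subseteq> simplexes X (Suc k)" and h: "\<And>\<sigma>. h \<sigma> \<ge> 0"
    and B: "\<And>Q. finite Q \<Longrightarrow> sum h Q \<le> B"
  shows "(\<Sum>\<tau>\<in>F. \<Sum>v\<in>\<tau>. h (\<tau> - {v})) \<le> real (card K) * B"
proof -
  define P where "P = (SIGMA \<tau>:F. \<tau>)"
  define f where "f = (\<lambda>(\<tau>, v). \<tau> - {v} :: 'v set)"
  have FX: "\<tau> \<in> X" if "\<tau> \<in> F" for \<tau> using F that by (auto simp: simplexes_def)
  have fin: "finite P" unfolding P_def using F FX simplex_finite by (intro finite_SigmaI) auto
  have card: "card {q \<in> P. f q = \<sigma>} \<le> card K" if "\<sigma> \<in> f ` P" for \<sigma>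
  proof -
    from that obtain q where "q \<in> P" "\<sigma> = f q" by blast
    moreover obtain \<tau>0 v0 where "q = (\<tau>0, v0)" by (cases q)
    ultimately have "(\<tau>0, v0) \<in> P" "\<sigma> = \<tau>0 - {v0}" by (simp_all add: f_def)
    then have "\<sigma> \<in> X" using face_in_simplexes[of \<tau>0 k v0] F by (auto simp: P_def simplexes_def)
    then obtain x where x: "x \<in> \<sigma>" using simplex_nonempty by blast
    have "inj_on (\<lambda>q. pr ` fst q) {q \<in> P. f q = \<sigma>}"
    proof (rule inj_onI)
      fix q r assume q: "q \<in> {q \<in> P. f q = \<sigma>}" and r: "r \<in> {q \<in> P. f q = \<sigma>}" and eq: "pr ` fst q = pr ` fst r"
      obtain \<tau> v where q': "q = (\<tau>, v)" by (cases q)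
      obtain \<tau>' v' where r': "r = (\<tau>', v')" by (cases r)
      have m: "\<tau> \<in> F" "v \<in> \<tau>" "\<tau> - {v} = \<sigma>" "\<tau>' \<in> F" "v' \<in> \<tau>'" "\<tau>' - {v'} = \<sigma>"
        using q r by (auto simp: q' r' P_def f_def)
      have "\<tau> = \<tau>'"
        by (rule same_image_same_vertex[of x]) (use x m eq FX in \<open>auto simp: q' r'\<close>)
      moreover from this have "v = v'" using m by blast
      ultimately show "q = r" by (simp add: q' r')
    qed
    moreover have "(\<lambda>q. pr ` fst q) ` {q \<in> P. f q = \<sigma>} \<subseteq> K"
      using FX by (auto simp: P_def intro: pr_simplex)
    ultimately show ?thesis using K by (rule card_inj_on_le)
  qed
  have "(\<Sum>\<tau>\<in>F. \<Sum>v\<in>\<tau>. h (\<tau> - {v})) = (\<Sum>q\<in>P. h (f q))"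
    unfolding P_def f_def using F FX simplex_finite by (subst sum.Sigma) (auto simp: case_prod_beta)
  also have "\<dots> = (\<Sum>\<sigma>\<in>f ` P. \<Sum>q\<in>{q \<in> P. f q = \<sigma>}. h (f q))"
    by (rule sum.image_gen[OF fin])
  also have "\<dots> = (\<Sum>\<sigma>\<in>f ` P. real (card {q \<in> P. f q = \<sigma>}) * h \<sigma>)"
    by (intro sum.cong refl) simp
  also have "\<dots> \<le> (\<Sum>\<sigma>\<in>f ` P. real (card K) * h \<sigma>)"
    by (intro sum_mono mult_right_mono h) (use card in auto)
  also have "\<dots> = real (card K) * sum h (f ` P)" by (simp add: sum_distrib_left)
  also have "\<dots> \<le> real (card K) * B" using fin by (intro mult_left_mono B) auto
  finally show ?thesis .
qed

text \<open>Cauchy-Schwarz against the k + 2 signs.\<close>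

lemma coboundary_square_le:
  assumes \<tau>: "\<tau> \<in> simplexes X (Suc k)"
  shows "(coboundary X pr idx k c \<tau>)\<^sup>2 \<le> real (k + 2) * (\<Sum>v\<in>\<tau>. (c (\<tau> - {v}))\<^sup>2)"
proof -
  have card: "card \<tau> = k + 2" using \<tau> by (simp add: simplexes_def)
  have "(coboundary X pr idx k c \<tau>)\<^sup>2 \<le>
      (\<Sum>v\<in>\<tau>. ((- 1) ^ card {w \<in> \<tau>. idx (pr w) < idx (pr v)} :: real)\<^sup>2) * (\<Sum>v\<in>\<tau>. (c (\<tau> - {v}))\<^sup>2)"
    using \<tau> unfolding coboundary_def by (simp add: Cauchy_Schwarz_ineq_sum)
  also have "(\<Sum>v\<in>\<tau>. ((- 1) ^ card {w \<in> \<tau>. idx (pr w) < idx (pr v)} :: real)\<^sup>2) = real (k + 2)"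
    by (simp add: card flip: power_mult)
  finally show ?thesis .
qed

lemma sum_coboundary_square_le:
  assumes K: "finite K" and F: "finite F"
  shows "(\<Sum>\<tau>\<in>F. (coboundary X pr idx k (l2_nth x) \<tau>)\<^sup>2) \<le> real (k + 2) * (real (card K) * (norm x)\<^sup>2)"
proof -
  let ?F = "F \<inter> simplexes X (Suc k)"
  have "(\<Sum>\<tau>\<in>F. (coboundary X pr idx k (l2_nth x) \<tau>)\<^sup>2) = (\<Sum>\<tau>\<in>?F. (coboundary X pr idx k (l2_nth x) \<tau>)\<^sup>2)"
    using F by (intro sum.mono_neutral_right) (auto simp: coboundary_def)
  also have "\<dots> \<le> (\<Sum>\<tau>\<in>?F. real (k + 2) * (\<Sum>v\<in>\<tau>. (l2_nth x (\<tau> - {v}))\<^sup>2))"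
    by (intro sum_mono coboundary_square_le) simp
  also have "\<dots> = real (k + 2) * (\<Sum>\<tau>\<in>?F. \<Sum>v\<in>\<tau>. (l2_nth x (\<tau> - {v}))\<^sup>2)"
    by (simp only: sum_distrib_left)
  also have "\<dots> \<le> real (k + 2) * (real (card K) * (norm x)\<^sup>2)"
    using F by (intro mult_left_mono sum_faces_le[OF K, where h = "\<lambda>\<sigma>. (l2_nth x \<sigma>)\<^sup>2"] sum_squares_le_norm_l2) auto
  finally show ?thesis .
qed

definition l2_coboundary :: "('w \<Rightarrow> nat) \<Rightarrow> nat \<Rightarrow> 'v set l2 \<Rightarrow> 'v set l2" where
  "l2_coboundary idx k x = Abs_l2 (coboundary X pr idx k (l2_nth x))"

lemma l2_nth_coboundary:
  assumes "finite K"
  shows "l2_nth (l2_coboundary idx k x) = coboundary X pr idx k (l2_nth x)"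
  unfolding l2_coboundary_def
  by (rule l2_nth_Abs, rule square_summable_of_bounded(1), rule sum_coboundary_square_le[OF assms])

lemma l2_operator_coboundary:
  assumes K: "finite K"
  shows "l2_operator (simplexes X k) (coboundary X pr idx k) (l2_coboundary idx k)"
proof
  note nth = l2_nth_coboundary[OF K]
  show "l2_coboundary idx k (x + y) = l2_coboundary idx k x + l2_coboundary idx k y" for x y
    by (rule l2_eqI) (auto simp: nth coboundary_def distrib_left sum.distrib)
  show "l2_coboundary idx k (r *\<^sub>R x) = r *\<^sub>R l2_coboundary idx k x" for r x
    by (rule l2_eqI) (auto simp: nth coboundary_def sum_distrib_left mult.left_commute)
  show "\<exists>C. \<forall>x. norm (l2_coboundary idx k x) \<le> norm x * C"
  proof (intro exI allI)
    fix x
    have "(norm (l2_coboundary idx k x))\<^sup>2 \<le> real (k + 2) * (real (card K) * (norm x)\<^sup>2)"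
      unfolding norm_l2_square[of "l2_coboundary idx k x"] nth
      by (rule square_summable_of_bounded(2)) (rule sum_coboundary_square_le[OF K])
    then have "norm (l2_coboundary idx k x) \<le> sqrt (real (k + 2) * (real (card K) * (norm x)\<^sup>2))"
      by (rule real_le_rsqrt)
    also have "\<dots> = norm x * sqrt (real (k + 2) * real (card K))"
      by (simp add: real_sqrt_mult)
    finally show "norm (l2_coboundary idx k x) \<le> norm x * sqrt (real (k + 2) * real (card K))" .
  qed
  show "l2_nth (l2_coboundary idx k x) = coboundary X pr idx k (l2_nth x)" for x by (rule nth)
  show "coboundary X pr idx k f = coboundary X pr idx k g" if "\<And>\<sigma>. \<sigma> \<in> simplexes X k \<Longrightarrow> f \<sigma> = g \<sigma>" for f g
    using that face_in_simplexes by (auto simp: coboundary_def fun_eq_iff intro!: sum.cong)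
  show "(\<lambda>n. coboundary X pr idx k (F n) \<tau>) \<longlonglongrightarrow> coboundary X pr idx k f \<tau>"
    if "\<And>\<sigma>. (\<lambda>n. F n \<sigma>) \<longlonglongrightarrow> f \<sigma>" for F f \<tau>
    unfolding coboundary_def by (auto intro!: tendsto_sum tendsto_mult tendsto_const that)
qed

lemma simplex_orbit_translate:
  assumes g: "g \<in> carrier G" and \<sigma>: "\<sigma> \<in> X"
  shows "{\<phi> h ` (\<phi> g ` \<sigma>) | h. h \<in> carrier G} = {\<phi> h ` \<sigma> | h. h \<in> carrier G}"
proof -
  have sub: "{\<phi> h ` (\<phi> g ` \<sigma>) | h. h \<in> carrier G} \<subseteq> {\<phi> h ` \<sigma> | h. h \<in> carrier G}"
    if g: "g \<in> carrier G" and \<sigma>: "\<sigma> \<in> X" for g \<sigma>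
  proof safe
    fix h assume h: "h \<in> carrier G"
    have "\<phi> h ` (\<phi> g ` \<sigma>) = \<phi> (h \<otimes>\<^bsub>G\<^esub> g) ` \<sigma>"
      unfolding image_image using \<sigma> by (intro image_cong composition_rule[symmetric] h g) auto
    moreover have "h \<otimes>\<^bsub>G\<^esub> g \<in> carrier G"
      using group.is_monoid[OF group_G] h g by (rule monoid.m_closed)
    ultimately show "\<exists>h'. \<phi> h ` (\<phi> g ` \<sigma>) = \<phi> h' ` \<sigma> \<and> h' \<in> carrier G" by blast
  qed
  show ?thesis
    using sub[OF g \<sigma>] sub[OF group.inv_closed[OF group_G g] simplicial_action[OF g \<sigma>]]
    by (simp add: inverse_image_simplex[OF g \<sigma>])
qed

text \<open>An orbit is determined by the image of its simplexes in the finite K. Finiteness matters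
  because \<open>vN_trace\<close> is a sum over the orbits, and a sum over an infinite set is 0 by
  default.\<close>

lemma finite_simplex_orbits:
  assumes "finite K"
  shows "finite (simplex_orbits G \<phi> (simplexes X k))"
proof -
  let ?S = "simplexes X k"
  define O' where "O' \<sigma> = {\<phi> h ` \<sigma> | h. h \<in> carrier G}" for \<sigma>
  define rep where "rep t = (SOME \<sigma>. \<sigma> \<in> ?S \<and> pr ` \<sigma> = t)" for t
  have "O' \<sigma> = O' (rep (pr ` \<sigma>))" if "\<sigma> \<in> ?S" for \<sigma>
  proof -
    have "rep (pr ` \<sigma>) \<in> ?S \<and> pr ` rep (pr ` \<sigma>) = pr ` \<sigma>"
      unfolding rep_def by (rule someI[of _ \<sigma>]) (use that in simp)
    then have X: "\<sigma> \<in> X" "rep (pr ` \<sigma>) \<in> X" "pr ` \<sigma> = pr ` rep (pr ` \<sigma>)"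
      using that by (auto simp: simplexes_def)
    obtain g where "g \<in> carrier G" "rep (pr ` \<sigma>) = \<phi> g ` \<sigma>"
      using same_image_same_orbit[OF X] by blast
    then show ?thesis using simplex_orbit_translate[OF _ X(1)] by (simp add: O'_def)
  qed
  then have "O' ` ?S \<subseteq> (\<lambda>t. O' (rep t)) ` ((\<lambda>\<sigma>. pr ` \<sigma>) ` ?S)" by blast
  moreover have "(\<lambda>\<sigma>. pr ` \<sigma>) ` ?S \<subseteq> K" using pr_simplex by (auto simp: simplexes_def)
  then have "finite ((\<lambda>t. O' (rep t)) ` ((\<lambda>\<sigma>. pr ` \<sigma>) ` ?S))"
    using assms finite_subset by blast
  ultimately have "finite (O' ` ?S)" by (rule finite_subset)
  then show ?thesis by (simp add: simplex_orbits_def O'_def[abs_def])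
qed

end

theorem theorem1p9:
  fixes G :: "('g, 'm) monoid_scheme" and X :: "'v set set" and \<phi> :: "'g \<Rightarrow> 'v \<Rightarrow> 'v"
    and K :: "'w set set" and pr :: "'v \<Rightarrow> 'w" and idx :: "'w \<Rightarrow> nat"
    and k :: nat and \<alpha> C :: real
  assumes covering: "simplicial_covering G X \<phi> K pr"
    and finite_base: "finite K"
    and orientation: "inj_on idx (\<Union>K)"
    and alpha: "\<alpha> > 2"
    and density: "\<And>s. s > 0 \<Longrightarrow> spectral_density G \<phi> X pr idx k s \<le> C * s powr (\<alpha> / 2)"
  shows "\<forall>p::ereal. 2 \<le> p \<and> 1 / p \<le> ereal (1 / 2 - 1 / \<alpha>) \<longrightarrow>
    (\<exists>C'. \<forall>\<beta> \<in> l2_orthogonal (simplexes X k) (cocycles X pr idx k).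
       lp_norm p \<beta> \<le> C' * lp_norm 2 (coboundary X pr idx k \<beta>)) \<and>
    l2_closure (simplexes X (k + 1)) (coboundary X pr idx k ` l2_space (simplexes X k))
      \<subseteq> coboundary X pr idx k ` lp_space p (simplexes X k)"
proof (intro allI impI)
  fix p :: ereal assume p: "2 \<le> p \<and> 1 / p \<le> ereal (1 / 2 - 1 / \<alpha>)"
  interpret simplicial_covering G X \<phi> K pr by (rule covering)
  let ?S = "simplexes X k"
  interpret op: l2_operator ?S "coboundary X pr idx k" "l2_coboundary idx k"
    by (rule l2_operator_coboundary[OF finite_base])
  have lap: "up_laplacian X pr idx k = op.L"
    by (simp add: fun_eq_iff up_laplacian_def op.L_def)
  define P where "P = spectral_projection ?S op.L"
  have P: "is_spectral_measure ?S op.L P"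
    unfolding P_def spectral_projection_def by (rule someI_ex[OF op.spectral_measure_exists])
  define E where "E \<Omega> x = Abs_l2 (P \<Omega> (l2_nth (l2_cut ?S x)))" for \<Omega> x
  note E = op.resolution_of_spectral_measure[OF P, folded E_def]
  interpret spectral_resolution op.A E
    by (rule spectral_resolution.intro[OF E(1) op.linear_A op.sym_A op.pos_A])
  have proj: "is_l2_projection ?S (P \<Omega>)" if "\<Omega> \<in> sets borel" for \<Omega>
    using P that by (simp add: is_spectral_measure_def)
  have basis: "l2_basis \<sigma> \<in> l2_supp ?S" if "\<sigma> \<in> ?S" for \<sigma>
    using that by (auto simp: l2_supp_def l2_nth_basis indicator_def)
  \<comment> \<open>A diagonal entry of an orthogonal projection is the squared norm of the
    projected unit vector; in particular all terms of the trace are nonnegative.\<close>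
  have diag: "l2_inner (l2_projection_onto ?S (P {0<..s} ` l2_space ?S) (indicator {\<sigma>})) (indicator {\<sigma>})
      = (norm (E {0<..s} (l2_basis \<sigma>)))\<^sup>2" if "\<sigma> \<in> ?S" for \<sigma> s
  proof -
    have mem: "l2_nth (l2_basis \<sigma>) \<in> l2_space ?S"
      using basis[OF that] by (simp add: l2_nth_in_l2_space_iff)
    have "l2_projection_onto ?S (P {0<..s} ` l2_space ?S) (l2_nth (l2_basis \<sigma>)) = l2_nth (E {0<..s} (l2_basis \<sigma>))"
      using l2_projection_onto_range[OF proj mem] E(3)[OF _ basis[OF that]] by simp
    then show ?thesis
      using E_norm[of "{0<..s}" "l2_basis \<sigma>"] by (simp add: l2_inner_l2_nth flip: l2_nth_basis)
  qed
  \<comment> \<open>The bound is wanted at every index, also off the k-simplexes, where the left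
    side is 0 and C alone might be negative.\<close>
  have growth: "(norm (E {0<..s} (l2_basis \<sigma>)))\<^sup>2 \<le> \<bar>C\<bar> * s powr (\<alpha> / 2)" if s: "s > 0" for s \<sigma>
  proof (cases "\<sigma> \<in> ?S")
    case False
    then have "l2_cut ?S (l2_basis \<sigma>) = 0"
      by (intro l2_eqI) (auto simp: l2_nth_cut l2_nth_basis indicator_def)
    then have "E UNIV (l2_basis \<sigma>) = 0" using E(2) by simp
    then have "E {0<..s} (l2_basis \<sigma>) = 0"
      using E_mult[of "{0<..s}" UNIV "l2_basis \<sigma>"] linear_0[OF E_linear[of "{0<..s}"]] by simp
    then show ?thesis by simp
  next
    case True
    let ?O = "simplex_orbits G \<phi> ?S"
    define B where "B = {\<phi> g ` \<sigma> | g. g \<in> carrier G}"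
    \<comment> \<open>The same choice term as in \<open>vN_trace\<close>, so that the trace can be
      folded into it. The given \<sigma> is a translate of the representative of its orbit, not the
      representative itself.\<close>
    define rep where "rep B = (SOME \<sigma>. \<sigma> \<in> B)" for B :: "'v set set"
    have one: "\<one>\<^bsub>G\<^esub> \<in> carrier G" using group.is_monoid[OF group_G] by (rule monoid.one_closed)
    have rep_mem: "rep B \<in> B" if "B \<in> ?O" for B
      unfolding rep_def some_in_eq using that one by (auto simp: simplex_orbits_def)
    have rep_S: "rep B \<in> ?S" if B: "B \<in> ?O" for B
    proof -
      obtain \<tau> g where "\<tau> \<in> ?S" "g \<in> carrier G" "rep B = \<phi> g ` \<tau>"
        using rep_mem[OF B] B by (auto simp: simplex_orbits_def)
      moreover from this have "\<tau> \<in> X" by (simp add: simplexes_def)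
      ultimately show ?thesis using simplex_action_simplexes[of g \<tau> k] by (simp add: simplex_action_def)
    qed
    have B: "B \<in> ?O" using True by (auto simp: B_def simplex_orbits_def)
    obtain g where g: "g \<in> carrier G" "rep B = \<phi> g ` \<sigma>"
      using rep_mem[OF B] by (auto simp: B_def)
    have act: "rep B = simplex_action g \<sigma>" using g True by (simp add: simplex_action_def simplexes_def)
    have inv_g: "inv\<^bsub>G\<^esub> g \<in> carrier G" by (rule group.inv_closed[OF group_G g(1)])
    have equi: "l2_coboundary idx k (l2_reindex (simplex_action g) x)
        = l2_reindex (simplex_action g) (l2_coboundary idx k x)" for x
      by (rule l2_eqI)
        (simp add: l2_nth_coboundary[OF finite_base] l2_nth_reindex[OF bij_simplex_action[OF g(1)]]
          l2_nth_reindex[OF bij_simplex_action[OF g(1)], abs_def] coboundary_equivariant[OF g(1)])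
    have "norm (E {0<..s} (l2_basis (simplex_action g \<sigma>))) = norm (E {0<..s} (l2_basis \<sigma>))"
      by (rule op.spectral_projection_invariant[OF E(1,2) bij_simplex_action[OF g(1)] bij_simplex_action[OF inv_g]
            simplex_action_inverse[OF g(1)] simplex_action_simplexes[OF g(1)]
            bij_simplex_action[OF g(1)] bij_simplex_action[OF inv_g] simplex_action_inverse[OF g(1)] equi])
        (use s in simp)
    then have "(norm (E {0<..s} (l2_basis \<sigma>)))\<^sup>2 = (norm (E {0<..s} (l2_basis (rep B))))\<^sup>2"
      by (simp add: act)
    \<comment> \<open>One nonnegative diagonal entry is at most the whole trace.\<close>
    also have "\<dots> \<le> (\<Sum>B\<in>?O. (norm (E {0<..s} (l2_basis (rep B))))\<^sup>2)"
      using finite_simplex_orbits[OF finite_base] B by (intro member_le_sum) auto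
    also have "\<dots> = spectral_density G \<phi> X pr idx k s"
      unfolding spectral_density_def vN_dim_def vN_trace_def Let_def lap P_def[symmetric] rep_def[symmetric]
      by (intro sum.cong refl diag[symmetric] rep_S)
    also have "\<dots> \<le> C * s powr (\<alpha> / 2)" by (rule density[OF s])
    also have "\<dots> \<le> \<bar>C\<bar> * s powr (\<alpha> / 2)" by (intro mult_right_mono) auto
    finally show ?thesis .
  qed
  show "(\<exists>C'. \<forall>\<beta> \<in> l2_orthogonal (simplexes X k) (cocycles X pr idx k).
       lp_norm p \<beta> \<le> C' * lp_norm 2 (coboundary X pr idx k \<beta>)) \<and>
    l2_closure (simplexes X (k + 1)) (coboundary X pr idx k ` l2_space (simplexes X k))
      \<subseteq> coboundary X pr idx k ` lp_space p (simplexes X k)"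
    unfolding cocycles_def
    using op.sobolev_inequalities[OF E(1,2) growth alpha abs_ge_zero] p by blast
qed

end
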